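(* Let $n\ge 2$, let $\mathcal{F}\subseteq M_n$ be a non-empty set of matrices, and let $\mathcal{F}^*=\{A^*:A\in\mathcal{F}\}$. Let $\mathcal{B}=\{B_1,\dots,B_r\}$ be a basis for one of the complex linear spans $\operatorname{span}(\mathcal{F})$, $\operatorname{span}(\mathcal{F}^* )$, or $\operatorname{span}(\mathcal{F}\cup\mathcal{F}^* )$ (in the last case $\mathcal{B}$ may be chosen to consist of Hermitian matrices). Then the following conditions are all equivalent. Here (a) comprises three conditions, one for each choice of $\mathcal{T}$, and (c) and (d) each comprise four conditions, one for each choice of $\mathcal{S}$; all of these are equivalent to each other and to (b) and (e). (a) $\mathcal{T}$ consists of mutually commuting normal matrices, where $\mathcal{T}$ is any one of the sets $\mathcal{F}$, $\mathcal{F}\cup\mathcal{F}^*$, $\mathcal{B}$. (b) For any Hermitian $C\in M_n$ and any finite $\{A_1,\dots,A_m\}\subseteq\operatorname{span}(\mathcal{F}\cup\mathcal{F}^* )$, $W_C(A_1,\dots,A_m)$ is polyhedral. (c) There is a Hermitian $C\in M_n$ with eigenvalues $c_1\ge\cdots\ge c_n$ and $c_k>c_{k+1}$ for some $k\in\{1,\dots,n-1\}$ satisfying $n/2-1\le k\le n/2+1$ such that $W_C(X,Y)$ is polyhedral for any $X,Y\in\mathcal{S}$ (the case $X=Y$ included), where $\mathcal{S}$ is any one of the sets $\mathcal{F},\mathcal{F}^*,\mathcal{F}\cup\mathcal{F}^*,\mathcal{B}$. (d) There is an integer $k$ with $1\le k\le n-1$ and $n/2-1\le k\le n/2+1$ such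 that $W_k(X,Y)$ is polyhedral for any $X,Y\in\mathcal{S}$ (the case $X=Y$ included), where $\mathcal{S}$ is any one of the sets $\mathcal{F},\mathcal{F}^*,\mathcal{F}\cup\mathcal{F}^*,\mathcal{B}$. (e) There is a Hermitian $C\in M_n$ with eigenvalues $c_1\ge\cdots\ge c_n$ and $c_k>c_{k+1}$ for some $k\in\{1,\dots,n-1\}$ satisfying $n/2-1\le k\le n/2+1$ such that $W_C(B_1,\dots,B_r)$ is polyhedral.
   Context: $M_n$ is the set of $n\times n$ complex matrices. For a Hermitian $C\in M_n$ and $A_1,\dots,A_m\in M_n$, the joint $C$-numerical range is $$W_C(A_1,\dots,A_m)=\{(\operatorname{tr} CU^*A_1U,\dots,\operatorname{tr} CU^*A_mU): U\in M_n \text{ unitary}\}\subseteq\mathbb{C}^m .$$ The joint $k$-numerical range $W_k(A_1,\dots,A_m)$ is $W_C(A_1,\dots,A_m)$ for $C=I_k\oplus 0_{n-k}$. A subset of $\mathbb{C}^m$ is polyhedral if it is the convex hull of a finite set of points. In the degenerate case $\mathcal{F}=\{0\}$ the basis $\mathcal{B}$ is empty ($r=0$), and $W_C$ of the empty tuple is the single point of $\mathbb{C}^0$, which is polyhedral. *)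

theory Defs
  imports
    "HOL-Analysis.Polytope"
    "HOL-Analysis.Finite_Function_Topology"
    "Jordan_Normal_Form.Schur_Decomposition"
begin

definition mat_trace :: "complex mat \<Rightarrow> complex" where
  "mat_trace A = (\<Sum>i<dim_row A. A $$ (i, i))"

definition hermitian_mat :: "complex mat \<Rightarrow> bool" where
  "hermitian_mat A \<longleftrightarrow> mat_adjoint A = A"

definition normal_mat :: "complex mat \<Rightarrow> bool" where
  "normal_mat A \<longleftrightarrow> A * mat_adjoint A = mat_adjoint A * A"

definition unitary_mats :: "nat \<Rightarrow> complex mat set" where
  "unitary_mats n =
    {U \<in> carrier_mat n n. mat_adjoint U * U = 1\<^sub>m n \<and> U * mat_adjoint U = 1\<^sub>m n}"

definition adjoints :: "complex mat set \<Rightarrow> complex mat set" where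
  "adjoints F = mat_adjoint ` F"

abbreviation cspan :: "nat \<Rightarrow> complex mat set \<Rightarrow> complex mat set" where
  "cspan n S \<equiv> LinearCombinations.module.span class_ring (module_mat TYPE(complex) n n) S"

text \<open>The family \<open>Bs\<close> lists, without repetition, a basis of the subspace \<open>W\<close> of the
  complex vector space of n-by-n matrices.\<close>

definition lists_basis :: "nat \<Rightarrow> complex mat set \<Rightarrow> complex mat list \<Rightarrow> bool" where
  "lists_basis n W Bs \<longleftrightarrow> distinct Bs \<and>
    vectorspace.basis class_ring ((module_mat TYPE(complex) n n) \<lparr>carrier := W\<rparr>) (set Bs)"

text \<open>The number m of matrices varies, so \<open>\<complex>\<^sup>m\<close> is identified with the subspace of those finitely
  supported sequences that vanish from index m on: \<open>Poly_Mapping.nth [z\<^sub>0, \<dots>]\<close> is the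
  list of coordinates extended by zeros. The real vector space structure, hence the convex hull,
  is the coordinatewise one, and \<open>polytope\<close> says precisely that a set is the convex hull of a
  finite set. The empty tuple has the one-point joint range \<open>{0}\<close>.\<close>

definition joint_C_range :: "nat \<Rightarrow> complex mat \<Rightarrow> complex mat list \<Rightarrow> (nat \<Rightarrow>\<^sub>0 complex) set" where
  "joint_C_range n C As =
    {Poly_Mapping.nth (map (\<lambda>A. mat_trace (C * mat_adjoint U * A * U)) As) | U. U \<in> unitary_mats n}"

definition joint_k_range :: "nat \<Rightarrow> nat \<Rightarrow> complex mat list \<Rightarrow> (nat \<Rightarrow>\<^sub>0 complex) set" where
  "joint_k_range n k As = joint_C_range n (diag_block_mat [1\<^sub>m k, 0\<^sub>m (n - k) (n - k)]) As"

text \<open>\<open>c 1, \<dots>, c n\<close> are the eigenvalues of \<open>C\<close>, repeated according to multiplicity, in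
  non-increasing order.\<close>

definition ordered_eigenvalues :: "nat \<Rightarrow> complex mat \<Rightarrow> (nat \<Rightarrow> real) \<Rightarrow> bool" where
  "ordered_eigenvalues n C c \<longleftrightarrow>
    char_poly C = (\<Prod>i\<in>{1..n}. [:- complex_of_real (c i), 1:]) \<and>
    (\<forall>i\<in>{1..<n}. c i \<ge> c (i + 1))"

definition central_index :: "nat \<Rightarrow> nat \<Rightarrow> bool" where
  "central_index n k \<longleftrightarrow> k \<in> {1..n - 1} \<and> real n / 2 - 1 \<le> real k \<and> real k \<le> real n / 2 + 1"

definition has_central_gap :: "nat \<Rightarrow> complex mat \<Rightarrow> bool" where
  "has_central_gap n C \<longleftrightarrow>
    (\<exists>c. ordered_eigenvalues n C c \<and> (\<exists>k. central_index n k \<and> c k > c (k + 1)))"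

definition commuting_normal :: "complex mat set \<Rightarrow> bool" where
  "commuting_normal T \<longleftrightarrow> (\<forall>X\<in>T. normal_mat X) \<and> (\<forall>X\<in>T. \<forall>Y\<in>T. X * Y = Y * X)"

definition all_C_ranges_polyhedral :: "nat \<Rightarrow> complex mat set \<Rightarrow> bool" where
  "all_C_ranges_polyhedral n F \<longleftrightarrow>
    (\<forall>C\<in>carrier_mat n n. hermitian_mat C \<longrightarrow>
      (\<forall>As. set As \<subseteq> cspan n (F \<union> adjoints F) \<longrightarrow> polytope (joint_C_range n C As)))"

definition pairwise_C_range_polyhedral :: "nat \<Rightarrow> complex mat set \<Rightarrow> bool" where
  "pairwise_C_range_polyhedral n S \<longleftrightarrow>
    (\<exists>C\<in>carrier_mat n n. hermitian_mat C \<and> has_central_gap n C \<and>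
      (\<forall>X\<in>S. \<forall>Y\<in>S. polytope (joint_C_range n C [X, Y])))"

definition pairwise_k_range_polyhedral :: "nat \<Rightarrow> complex mat set \<Rightarrow> bool" where
  "pairwise_k_range_polyhedral n S \<longleftrightarrow>
    (\<exists>k. central_index n k \<and> (\<forall>X\<in>S. \<forall>Y\<in>S. polytope (joint_k_range n k [X, Y])))"

definition basis_C_range_polyhedral :: "nat \<Rightarrow> complex mat list \<Rightarrow> bool" where
  "basis_C_range_polyhedral n Bs \<longleftrightarrow>
    (\<exists>C\<in>carrier_mat n n. hermitian_mat C \<and> has_central_gap n C \<and> polytope (joint_C_range n C Bs))"

end

theory Submission
  imports Defs "HOL-Analysis.Homotopy"
begin

text \<open>
  All conditions are equivalent to a single one, \<open>star_commuting F\<close>: the elements of \<open>F \<union> F\<^sup>*\<close> commute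
  with each other. By Fuglede's theorem (\<open>fuglede\<close>) commuting normal matrices satisfy it, and it is
  inherited by linear spans (\<open>star_commuting_cspan\<close>), so that the choice of the generating set or of
  the basis is immaterial.

  From commutation to polytopes. A star-commuting family is diagonal in some orthonormal basis
  (\<open>simultaneous_diagonalization\<close>). In this basis the numbers \<open>tr C U\<^sup>* A U\<close> depend only on the diagonal
  of a conjugate of \<open>C\<close>, and depend linearly on it. By the Schur-Horn theorem these diagonals
  form the convex hull of all rearrangements of the eigenvalues of \<open>C\<close> (\<open>schur_horn_image\<close>); the
  joint range is a linear image of this polytope.

  From polytopes to commutation. Splitting matrices into Hermitian parts, it suffices that two
  Hermitian matrices \<open>H\<close> and \<open>K\<close> commute if the planar range of the points \<open>(tr C U\<^sup>* H U, tr C U\<^sup>* K U)\<close>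
  is a polygon (\<open>polygonal_trace_range_imp_commute\<close>). The support function of this range in a direction
  \<open>d\<close> pairs the eigenvalues of \<open>C\<close> with those of \<open>H\<^sub>d = Re d H + Im d K\<close>. A matrix \<open>U\<close> that attains a vertex
  is extremal for all directions in the normal cone of the vertex. Because of the gap at \<open>k\<close>, the projection
  \<open>P\<close> onto the eigenvectors of \<open>U C U\<^sup>*\<close> for its \<open>k\<close> largest eigenvalues is then a spectral projection for
  the \<open>k\<close> largest eigenvalues of every such \<open>H\<^sub>d\<close> (\<open>leading_projection_top_rows\<close>), so \<open>P\<close> commutes with \<open>H\<close> and
  \<open>K\<close>. The commutator \<open>Z\<close> of \<open>H\<close> and \<open>K\<close> is a multiple of the commutator of \<open>H\<^sub>d\<close> with another
  combination of \<open>H\<close> and \<open>K\<close>, and therefore vanishes on every subspace that is invariant under both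
  and on which some \<open>H\<^sub>d\<close> is scalar. This allows a comparison of the projections at neighbouring vertices, and, going around
  the polygon, at opposite ones: for \<open>k \<le> n / 2\<close> all products \<open>Z P\<close> vanish. Two neighbouring projections
  together with an opposite one then cover so much of the space that, for a central \<open>k\<close>, at most
  one eigenvalue of \<open>H\<^sub>d\<close> is left on the rest, and \<open>Z = 0\<close> (\<open>commutator_zero_of_edge\<close>). Gaps above
  \<open>n / 2\<close> are reduced to this case by passing to \<open>- C\<close>.
\<close>

section \<open>Matrices, traces and unitary conjugation\<close>

lemma dim_mat_adjoint [simp]:
  "dim_row (mat_adjoint A) = dim_col A" "dim_col (mat_adjoint A) = dim_row A"
  unfolding mat_adjoint_def by (auto simp: mat_of_rows_def)

lemma carrier_mat_adjoint [simp]: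
  "A \<in> carrier_mat n m \<Longrightarrow> mat_adjoint A \<in> carrier_mat m n"
  by auto

lemma index_mat_adjoint [simp]:
  "i < dim_col A \<Longrightarrow> j < dim_row A \<Longrightarrow> mat_adjoint A $$ (i, j) = cnj (A $$ (j, i))"
  unfolding mat_adjoint_def by (auto simp: mat_of_rows_def conjugate_complex_def)

lemma index_mult_mat_sum:
  assumes "A \<in> carrier_mat n m" "B \<in> carrier_mat m p" "i < n" "j < p"
  shows "(A * B) $$ (i, j) = (\<Sum>l<m. A $$ (i, l) * B $$ (l, j))"
  using assms by (auto simp: scalar_prod_def atLeast0LessThan intro!: sum.cong)

lemma mat_adjoint_mult:
  assumes A: "A \<in> carrier_mat n m" and B: "B \<in> carrier_mat m p"
  shows "mat_adjoint (A * B) = mat_adjoint B * mat_adjoint (A :: complex mat)"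
proof (rule eq_matI)
  fix i j assume "i < dim_row (mat_adjoint B * mat_adjoint A)" "j < dim_col (mat_adjoint B * mat_adjoint A)"
  then have i: "i < p" and j: "j < n" using A B by auto
  have "mat_adjoint (A * B) $$ (i, j) = cnj ((A * B) $$ (j, i))"
    using A B i j by (intro index_mat_adjoint) auto
  also have "\<dots> = (\<Sum>l<m. mat_adjoint B $$ (i, l) * mat_adjoint A $$ (l, j))"
    unfolding index_mult_mat_sum[OF A B j i] using A B i j by (auto intro!: sum.cong)
  also have "\<dots> = (mat_adjoint B * mat_adjoint A) $$ (i, j)"
    using A B i j by (intro index_mult_mat_sum[symmetric, of _ p m _ n]) auto
  finally show "mat_adjoint (A * B) $$ (i, j) = (mat_adjoint B * mat_adjoint A) $$ (i, j)" .
qed (use A B in auto)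

lemma mat_adjoint_adjoint [simp]: "mat_adjoint (mat_adjoint A) = (A :: complex mat)"
  by (rule eq_matI) auto

lemma mat_adjoint_add:
  assumes "A \<in> carrier_mat n m" "B \<in> carrier_mat n m"
  shows "mat_adjoint (A + B) = mat_adjoint A + mat_adjoint (B :: complex mat)"
  using assms by (intro eq_matI) auto

lemma mat_adjoint_minus:
  assumes "A \<in> carrier_mat n m" "B \<in> carrier_mat n m"
  shows "mat_adjoint (A - B) = mat_adjoint A - mat_adjoint (B :: complex mat)"
  using assms by (intro eq_matI) auto

lemma mat_adjoint_smult: "mat_adjoint (c \<cdot>\<^sub>m A) = cnj c \<cdot>\<^sub>m mat_adjoint (A :: complex mat)"
  by (intro eq_matI) auto

lemma mat_adjoint_diag: "mat_adjoint (mat_diag n f) = mat_diag n (\<lambda>i. cnj (f i))"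
  by (intro eq_matI) (auto simp: mat_diag_def)

lemma mat_adjoint_one: "mat_adjoint (1\<^sub>m n :: complex mat) = 1\<^sub>m n"
  by (intro eq_matI) auto

lemma hermitian_iff_entries:
  assumes "A \<in> carrier_mat n n"
  shows "hermitian_mat A \<longleftrightarrow> (\<forall>i<n. \<forall>j<n. A $$ (i, j) = cnj (A $$ (j, i)))"
proof
  assume "hermitian_mat A"
  then show "\<forall>i<n. \<forall>j<n. A $$ (i, j) = cnj (A $$ (j, i))"
    using assms by (metis carrier_matD hermitian_mat_def index_mat_adjoint)
next
  assume "\<forall>i<n. \<forall>j<n. A $$ (i, j) = cnj (A $$ (j, i))"
  then have "mat_adjoint A $$ (i, j) = A $$ (i, j)" if "i < n" "j < n" for i j
    using that assms by (metis carrier_matD index_mat_adjoint)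
  then show "hermitian_mat A" unfolding hermitian_mat_def using assms by (intro eq_matI) auto
qed

lemma hermitian_entry:
  "hermitian_mat A \<Longrightarrow> A \<in> carrier_mat n n \<Longrightarrow> i < n \<Longrightarrow> j < n \<Longrightarrow> A $$ (i, j) = cnj (A $$ (j, i))"
  using hermitian_iff_entries by blast

lemma mat_trace_mult:
  assumes "A \<in> carrier_mat n m" "B \<in> carrier_mat m n"
  shows "mat_trace (A * B) = (\<Sum>i<n. \<Sum>j<m. A $$ (i, j) * B $$ (j, i))"
  using assms by (auto simp: mat_trace_def index_mult_mat_sum[OF assms] simp del: index_mult_mat(1) intro!: sum.cong)

lemma mat_trace_commute:
  assumes "A \<in> carrier_mat n m" "B \<in> carrier_mat m n"
  shows "mat_trace (A * B) = mat_trace (B * A)"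
  unfolding mat_trace_mult[OF assms] mat_trace_mult[OF assms(2,1)]
  by (subst sum.swap) (simp add: mult.commute)

lemma mat_trace_add:
  "A \<in> carrier_mat n n \<Longrightarrow> B \<in> carrier_mat n n \<Longrightarrow> mat_trace (A + B) = mat_trace A + mat_trace B"
  by (auto simp: mat_trace_def sum.distrib)

lemma mat_trace_smult: "A \<in> carrier_mat n n \<Longrightarrow> mat_trace (c \<cdot>\<^sub>m A) = c * mat_trace A"
  by (auto simp: mat_trace_def sum_distrib_left)

lemma mat_trace_adjoint: "A \<in> carrier_mat n n \<Longrightarrow> mat_trace (mat_adjoint A) = cnj (mat_trace A)"
  by (auto simp: mat_trace_def)

lemma mult_carrier_sq [simp]:
  "A \<in> carrier_mat n n \<Longrightarrow> B \<in> carrier_mat n n \<Longrightarrow> A * B \<in> carrier_mat n n"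
  by (rule mult_carrier_mat)

lemma one_mult_sq [simp]:
  "A \<in> carrier_mat n n \<Longrightarrow> 1\<^sub>m n * A = A" "A \<in> carrier_mat n n \<Longrightarrow> A * 1\<^sub>m n = A"
  "A \<in> carrier_mat n n \<Longrightarrow> 0\<^sub>m n n * A = 0\<^sub>m n n" "A \<in> carrier_mat n n \<Longrightarrow> A * 0\<^sub>m n n = 0\<^sub>m n n"
  for A :: "complex mat"
  by auto

lemma dim_mat_diag [simp]: "dim_row (mat_diag n f) = n" "dim_col (mat_diag n f) = n"
  by (simp_all add: mat_diag_def)

lemma minus_carrier_sq [simp]:
  "A \<in> carrier_mat n n \<Longrightarrow> B \<in> carrier_mat n n \<Longrightarrow> A - B \<in> carrier_mat n n"
  by (rule minus_carrier_mat)

lemmas assoc_sq = assoc_mult_mat[of _ n n _ n _ n for n]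

lemma diff_mult_diff:
  fixes A B C D :: "complex mat"
  assumes "A \<in> carrier_mat n n" "B \<in> carrier_mat n n" "C \<in> carrier_mat n n" "D \<in> carrier_mat n n"
  shows "(A - B) * (C - D) = (A * C - A * D) - (B * C - B * D)"
proof -
  have "(A - B) * (C - D) = A * (C - D) - B * (C - D)"
    using assms by (intro minus_mult_distrib_mat) auto
  also have "A * (C - D) = A * C - A * D" by (rule mult_minus_distrib_mat[OF assms(1,3,4)])
  also have "B * (C - D) = B * C - B * D" by (rule mult_minus_distrib_mat[OF assms(2-4)])
  finally show ?thesis .
qed

lemma minus_mat_eq_zero_iff:
  fixes A B :: "complex mat"
  assumes c: "A \<in> carrier_mat n n" "B \<in> carrier_mat n n"
  shows "A - B = 0\<^sub>m n n \<longleftrightarrow> A = B"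
proof
  assume e: "A - B = 0\<^sub>m n n"
  have "A $$ (i, j) = B $$ (i, j)" if "i < n" "j < n" for i j
    using arg_cong[OF e, of "\<lambda>M. M $$ (i, j)"] that c by simp
  then show "A = B" using c by (intro eq_matI) auto
qed (use c in auto)

lemma smult_mat_eq_zero_iff:
  fixes A :: "complex mat"
  assumes A: "A \<in> carrier_mat n n" and a: "a \<noteq> 0"
  shows "a \<cdot>\<^sub>m A = 0\<^sub>m n n \<longleftrightarrow> A = 0\<^sub>m n n"
proof
  assume e: "a \<cdot>\<^sub>m A = 0\<^sub>m n n"
  have "A $$ (i, j) = 0" if "i < n" "j < n" for i j
    using arg_cong[OF e, of "\<lambda>M. M $$ (i, j)"] that A a by simp
  then show "A = 0\<^sub>m n n" using A by (intro eq_matI) auto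
qed auto

text \<open>The sets in question are orbits of unitary conjugation, so the proof works throughout with
  \<open>U\<^sup>* A U\<close>, which turns a matrix into its expression in the orthonormal basis given by the
  columns of \<open>U\<close>.\<close>

definition conj_by :: "complex mat \<Rightarrow> complex mat \<Rightarrow> complex mat" where
  "conj_by U A = mat_adjoint U * A * U"

lemma unitary_carrier: "U \<in> unitary_mats n \<Longrightarrow> U \<in> carrier_mat n n"
  by (simp add: unitary_mats_def)

lemma unitary_mats_adjoint: "U \<in> unitary_mats n \<Longrightarrow> mat_adjoint U \<in> unitary_mats n"
  by (auto simp: unitary_mats_def)

lemma unitary_mats_one: "1\<^sub>m n \<in> unitary_mats n"
  by (simp add: unitary_mats_def mat_adjoint_one)

lemma unitary_matsI:
  assumes "U \<in> carrier_mat n n" "mat_adjoint U * U = 1\<^sub>m n"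
  shows "U \<in> unitary_mats n"
  using assms mat_mult_left_right_inverse[of "mat_adjoint U" n U] by (auto simp: unitary_mats_def)

lemma unitary_mats_mult:
  assumes U: "U \<in> unitary_mats n" and V: "V \<in> unitary_mats n"
  shows "U * V \<in> unitary_mats n"
proof (rule unitary_matsI)
  have c [simp]: "U \<in> carrier_mat n n" "V \<in> carrier_mat n n" using U V by (auto simp: unitary_mats_def)
  show "U * V \<in> carrier_mat n n" by (rule mult_carrier_mat[OF c])
  have "mat_adjoint (U * V) * (U * V) = mat_adjoint V * ((mat_adjoint U * U) * V)"
    by (simp add: mat_adjoint_mult[OF c] assoc_sq[where n = n])
  then show "mat_adjoint (U * V) * (U * V) = 1\<^sub>m n" using U V by (simp add: unitary_mats_def)
qed

lemma carrier_conj_by [simp]: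
  "U \<in> carrier_mat n n \<Longrightarrow> A \<in> carrier_mat n n \<Longrightarrow> conj_by U A \<in> carrier_mat n n"
  by (auto simp: conj_by_def intro!: mult_carrier_mat[where n = n])

lemma conj_by_conj_by:
  assumes "U \<in> carrier_mat n n" "V \<in> carrier_mat n n" "A \<in> carrier_mat n n"
  shows "conj_by V (conj_by U A) = conj_by (U * V) A"
  using assms by (simp add: conj_by_def mat_adjoint_mult[of _ n n] assoc_sq[where n = n])

lemma conj_by_one: "A \<in> carrier_mat n n \<Longrightarrow> conj_by (1\<^sub>m n) A = A"
  by (simp add: conj_by_def mat_adjoint_one)

lemma conj_by_adjoint_cancel:
  assumes "U \<in> unitary_mats n" "A \<in> carrier_mat n n"
  shows "conj_by (mat_adjoint U) (conj_by U A) = A" "conj_by U (conj_by (mat_adjoint U) A) = A"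
  using assms by (auto simp: unitary_mats_def conj_by_conj_by[of _ n] conj_by_one)

lemma conj_by_inject:
  assumes "U \<in> unitary_mats n" "A \<in> carrier_mat n n" "B \<in> carrier_mat n n"
  shows "conj_by U A = conj_by U B \<longleftrightarrow> A = B"
  using conj_by_adjoint_cancel[OF assms(1)] assms(2,3) by metis

lemma conj_by_mult:
  assumes U: "U \<in> unitary_mats n" and A: "A \<in> carrier_mat n n" and B: "B \<in> carrier_mat n n"
  shows "conj_by U (A * B) = conj_by U A * conj_by U B"
proof -
  have [simp]: "U \<in> carrier_mat n n" using U by (rule unitary_carrier)
  have "conj_by U A * conj_by U B = mat_adjoint U * (A * ((U * mat_adjoint U) * (B * U)))"
    using A B by (simp add: conj_by_def assoc_sq[where n = n])
  also have "\<dots> = conj_by U (A * B)"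
    using U A B by (simp add: unitary_mats_def conj_by_def assoc_sq[where n = n])
  finally show ?thesis by simp
qed

lemma conj_by_add:
  assumes "U \<in> carrier_mat n n" "A \<in> carrier_mat n n" "B \<in> carrier_mat n n"
  shows "conj_by U (A + B) = conj_by U A + conj_by U B"
  using assms by (simp add: conj_by_def mult_add_distrib_mat[of _ n n _ n] add_mult_distrib_mat[of _ n n _ _ n])

lemma conj_by_minus:
  assumes "U \<in> carrier_mat n n" "A \<in> carrier_mat n n" "B \<in> carrier_mat n n"
  shows "conj_by U (A - B) = conj_by U A - conj_by U B"
  using assms by (simp add: conj_by_def mult_minus_distrib_mat[of _ n n _ n] minus_mult_distrib_mat[of _ n n _ _ n])

lemma conj_by_smult:
  assumes "U \<in> carrier_mat n n" "A \<in> carrier_mat n n"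
  shows "conj_by U (c \<cdot>\<^sub>m A) = c \<cdot>\<^sub>m conj_by U A"
  using assms by (simp add: conj_by_def mult_smult_distrib[of _ n n _ n] mult_smult_assoc_mat[of _ n n _ n])

lemma conj_by_zero: "U \<in> carrier_mat n n \<Longrightarrow> conj_by U (0\<^sub>m n n) = 0\<^sub>m n n"
  by (simp add: conj_by_def)

lemma mat_adjoint_conj_by:
  assumes "U \<in> carrier_mat n n" "A \<in> carrier_mat n n"
  shows "mat_adjoint (conj_by U A) = conj_by U (mat_adjoint A)"
  using assms by (simp add: conj_by_def mat_adjoint_mult[of _ n n _ n] assoc_sq[where n = n])

lemma hermitian_conj_by:
  "U \<in> carrier_mat n n \<Longrightarrow> A \<in> carrier_mat n n \<Longrightarrow> hermitian_mat A \<Longrightarrow> hermitian_mat (conj_by U A)"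
  by (simp add: hermitian_mat_def mat_adjoint_conj_by[of _ n])

lemma mat_trace_conj_by:
  assumes U: "U \<in> unitary_mats n" and A: "A \<in> carrier_mat n n"
  shows "mat_trace (conj_by U A) = mat_trace A"
proof -
  have [simp]: "U \<in> carrier_mat n n" using U by (rule unitary_carrier)
  have "mat_trace (conj_by U A) = mat_trace (U * (mat_adjoint U * A))"
    using A unfolding conj_by_def by (intro mat_trace_commute[of _ n n]) auto
  also have "U * (mat_adjoint U * A) = (U * mat_adjoint U) * A"
    using A by (simp add: assoc_sq[where n = n])
  finally show ?thesis using U A by (simp add: unitary_mats_def)
qed

lemma conj_by_commute_iff:
  assumes "U \<in> unitary_mats n" "A \<in> carrier_mat n n" "B \<in> carrier_mat n n"
  shows "conj_by U A * conj_by U B = conj_by U B * conj_by U A \<longleftrightarrow> A * B = B * A"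
  using assms
  by (simp add: conj_by_mult[symmetric] conj_by_inject[of _ n] mult_carrier_mat[of _ n n _ n])

section \<open>The spectral theorem for Hermitian matrices\<close>

abbreviation real_diag :: "nat \<Rightarrow> (nat \<Rightarrow> real) \<Rightarrow> complex mat" where
  "real_diag n h \<equiv> mat_diag n (\<lambda>i. complex_of_real (h i))"

lemma similar_mat_conj_by:
  assumes U: "U \<in> unitary_mats n" and A: "A \<in> carrier_mat n n"
  shows "similar_mat (conj_by U A) A"
proof -
  have "similar_mat_wit (conj_by U A) A (mat_adjoint U) U"
    using U A by (intro similar_mat_witI[of _ _ n]) (auto simp: unitary_mats_def conj_by_def)
  then show ?thesis by (auto simp: similar_mat_def)
qed

abbreviation block_sum :: "complex mat \<Rightarrow> complex mat \<Rightarrow> complex mat" where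
  "block_sum A B \<equiv> four_block_mat A (0\<^sub>m (dim_row A) (dim_col B)) (0\<^sub>m (dim_row B) (dim_col A)) B"

lemma block_sum_mult:
  assumes "A \<in> carrier_mat m m" "A' \<in> carrier_mat m m" "B \<in> carrier_mat k k" "B' \<in> carrier_mat k k"
  shows "block_sum A B * block_sum A' B' = block_sum (A * A') (B * B')"
proof -
  have "block_sum A B * block_sum A' B' = four_block_mat (A * A' + 0\<^sub>m m k * 0\<^sub>m k m)
      (A * 0\<^sub>m m k + 0\<^sub>m m k * B') (0\<^sub>m k m * A' + B * 0\<^sub>m k m) (0\<^sub>m k m * 0\<^sub>m m k + B * B')"
    using assms
    by (subst mult_four_block_mat[of _ m m _ k _ k _ _ m _ k]) auto
  also have "\<dots> = block_sum (A * A') (B * B')" using assms by simp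
  finally show ?thesis .
qed

lemma block_sum_adjoint: "mat_adjoint (block_sum A B) = block_sum (mat_adjoint A) (mat_adjoint B)"
  by (rule eq_matI) auto

lemma unitary_block_sum:
  assumes U: "U \<in> unitary_mats m" and V: "V \<in> unitary_mats k"
  shows "block_sum U V \<in> unitary_mats (m + k)"
proof (rule unitary_matsI)
  have c: "U \<in> carrier_mat m m" "V \<in> carrier_mat k k" using U V by (auto simp: unitary_mats_def)
  then show "block_sum U V \<in> carrier_mat (m + k) (m + k)" by simp
  have "mat_adjoint (block_sum U V) * block_sum U V = block_sum (mat_adjoint U * U) (mat_adjoint V * V)"
    unfolding block_sum_adjoint using c by (intro block_sum_mult[of _ m _ _ k]) auto
  also have "\<dots> = 1\<^sub>m (m + k)" using U V by (auto simp: unitary_mats_def)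
  finally show "mat_adjoint (block_sum U V) * block_sum U V = 1\<^sub>m (m + k)" .
qed

lemma conj_by_block_sum:
  assumes "U \<in> carrier_mat m m" "A \<in> carrier_mat m m" "V \<in> carrier_mat k k" "B \<in> carrier_mat k k"
  shows "conj_by (block_sum U V) (block_sum A B) = block_sum (conj_by U A) (conj_by V B)"
proof -
  have "conj_by (block_sum U V) (block_sum A B) = (block_sum (mat_adjoint U) (mat_adjoint V) * block_sum A B) * block_sum U V"
    by (simp add: conj_by_def block_sum_adjoint)
  also have "block_sum (mat_adjoint U) (mat_adjoint V) * block_sum A B = block_sum (mat_adjoint U * A) (mat_adjoint V * B)"
    using assms by (intro block_sum_mult[of _ m _ _ k]) auto
  also have "\<dots> * block_sum U V = block_sum (conj_by U A) (conj_by V B)"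
    unfolding conj_by_def using assms by (intro block_sum_mult[of _ m _ _ k]) auto
  finally show ?thesis .
qed

text \<open>Complete an eigenvector to a basis, orthogonalize by Gram-Schmidt and normalize the columns.\<close>

lemma exists_unitary_with_eigenvector:
  assumes A: "A \<in> carrier_mat n n" and ev: "eigenvalue A e" and n: "n \<noteq> 0"
  shows "\<exists>U\<in>unitary_mats n. \<forall>i<n. conj_by U A $$ (i, 0) = (if i = 0 then e else 0)"
proof -
  define v where "v = find_eigenvector A e"
  define b where "b = basis_completion v"
  define ws where "ws = gram_schmidt n b"
  define W where "W = mat_of_cols n ws"
  from find_eigenvector[OF A ev] have evec: "eigenvector A v e" unfolding v_def .
  have v: "v \<in> carrier_vec n" and v0: "v \<noteq> 0\<^sub>v n" and Av: "A *\<^sub>v v = e \<cdot>\<^sub>v v"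
    using evec A unfolding eigenvector_def by auto
  interpret cof_vec_space n "TYPE(complex)" .
  from basis_completion[OF v v0, folded b_def]
  have b: "distinct b" "\<not> lin_dep (set b)" "set b \<subseteq> carrier_vec n" "hd b = v" "length b = n" by auto
  then obtain vs where bv: "b = v # vs" using n by (cases b) auto
  from gram_schmidt_result[OF b(3,1,2) refl, folded ws_def] b(5)
  have ws: "set ws \<subseteq> carrier_vec n" "corthogonal ws" "length ws = n" by auto
  from gram_schmidt_hd[OF v, of vs, folded bv] have hdws: "hd ws = v" unfolding ws_def .
  have W: "W \<in> carrier_mat n n" using ws unfolding W_def by auto
  have orth: "corthogonal_mat W" using orthogonal_mat_of_cols ws unfolding W_def by blast
  have W0: "W $$ (i, 0) = v $ i" if "i < n" for i
    using that ws n hdws by (cases ws) (auto simp: W_def mat_of_cols_def)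
  define ip where "ip j k = (\<Sum>l<n. cnj (W $$ (l, j)) * W $$ (l, k))" for j k
  have ip_iff: "ip j k = 0 \<longleftrightarrow> j \<noteq> k" if "j < n" "k < n" for j k
  proof -
    have "ip j k = col W k \<bullet>c col W j"
      using that W by (auto simp: ip_def scalar_prod_def atLeast0LessThan mult.commute intro!: sum.cong)
    then show ?thesis using corthogonal_matD[OF orth, of k j] W that by auto
  qed
  define N where "N j = (\<Sum>l<n. (cmod (W $$ (l, j)))\<^sup>2)" for j
  have ip_N: "ip j j = complex_of_real (N j)" for j
    by (simp add: ip_def N_def complex_norm_square mult.commute del: of_real_power)
  have N_pos: "N j > 0" if "j < n" for j
  proof -
    have "N j \<ge> 0" by (simp add: N_def sum_nonneg)
    moreover have "N j \<noteq> 0" using ip_N[of j] ip_iff[OF that that] by auto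
    ultimately show ?thesis by simp
  qed
  define U where "U = mat n n (\<lambda>(i, j). W $$ (i, j) / complex_of_real (sqrt (N j)))"
  have Uc: "U \<in> carrier_mat n n" by (simp add: U_def)
  have UU: "(mat_adjoint U * U) $$ (i, j) = (if i = j then 1 else 0)" if ij: "i < n" "j < n" for i j
  proof -
    have "(mat_adjoint U * U) $$ (i, j) = (\<Sum>l<n. mat_adjoint U $$ (i, l) * U $$ (l, j))"
      using Uc ij by (intro index_mult_mat_sum) auto
    also have "\<dots> = (\<Sum>l<n. cnj (W $$ (l, i)) * W $$ (l, j) / complex_of_real (sqrt (N i) * sqrt (N j)))"
      using ij by (auto simp: U_def intro!: sum.cong)
    also have "\<dots> = ip i j / complex_of_real (sqrt (N i) * sqrt (N j))"
      by (simp add: ip_def sum_divide_distrib)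
    also have "\<dots> = (if i = j then 1 else 0)"
      using ip_iff[OF ij] ip_N[of i] N_pos[OF ij(1)] by (auto simp flip: of_real_mult)
    finally show ?thesis .
  qed
  have U: "U \<in> unitary_mats n"
    by (rule unitary_matsI[OF Uc], rule eq_matI) (use UU Uc in auto)
  have AU: "(A * U) $$ (i, 0) = e * U $$ (i, 0)" if i: "i < n" for i
  proof -
    have "(A * U) $$ (i, 0) = (\<Sum>l<n. A $$ (i, l) * (v $ l / complex_of_real (sqrt (N 0))))"
      using A Uc i n by (subst index_mult_mat_sum[of _ n n _ n]) (auto simp: U_def W0 intro!: sum.cong)
    also have "\<dots> = (A *\<^sub>v v) $ i / complex_of_real (sqrt (N 0))"
      using A v i by (simp add: scalar_prod_def atLeast0LessThan sum_divide_distrib cong: sum.cong_simp)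
    also have "\<dots> = e * U $$ (i, 0)"
      using Av v i n by (simp add: U_def W0)
    finally show ?thesis .
  qed
  have "conj_by U A $$ (i, 0) = (if i = 0 then e else 0)" if i: "i < n" for i
  proof -
    have "conj_by U A = mat_adjoint U * (A * U)" using A Uc by (simp add: conj_by_def assoc_sq[where n = n])
    then have "conj_by U A $$ (i, 0) = (\<Sum>l<n. mat_adjoint U $$ (i, l) * (A * U) $$ (l, 0))"
      using A Uc i n by (simp add: index_mult_mat_sum[of _ n n _ n] del: index_mult_mat)
    also have "\<dots> = e * (\<Sum>l<n. mat_adjoint U $$ (i, l) * U $$ (l, 0))"
      by (auto simp: AU sum_distrib_left mult_ac simp del: index_mult_mat intro!: sum.cong)
    also have "\<dots> = e * (mat_adjoint U * U) $$ (i, 0)"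
      using Uc i n by (subst index_mult_mat_sum[of _ n n _ n]) auto
    finally show ?thesis using UU[OF i] n by (auto simp del: index_mult_mat)
  qed
  with U show ?thesis by blast
qed

text \<open>The eigenvalues appear on the diagonal in the order in which they are listed in the factorization
  of the characteristic polynomial. This makes it possible to prescribe a decreasing order, and to
  use the very sequence that witnesses a gap in the spectrum. A Hermitian matrix whose first column
  is a multiple of the first unit vector splits off a block of size one; the rest is induction.\<close>

theorem hermitian_spectral_list:
  assumes "A \<in> carrier_mat n n" "hermitian_mat A" "char_poly A = (\<Prod>e\<leftarrow>es. [:- e, 1:])"
  shows "\<exists>U\<in>unitary_mats n. conj_by U A = mat_diag n (\<lambda>i. es ! i)"
  using assms
proof (induction es arbitrary: n A)
  case Nil
  then have "n = 0" using degree_monic_char_poly[of A n] by simp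
  with Nil show ?case
    by (intro bexI[OF _ unitary_mats_one] eq_matI) (auto simp: conj_by_def mat_diag_def)
next
  case (Cons e es n A)
  have A: "A \<in> carrier_mat n n" by fact
  have mon: "monic (\<Prod>e\<leftarrow>es. [:- e, 1:])" by (rule monic_prod_list) auto
  have cp: "char_poly A = [:- e, 1:] * (\<Prod>e\<leftarrow>es. [:- e, 1:])" using Cons.prems by simp
  have "degree (char_poly A) = Suc (degree (\<Prod>e\<leftarrow>es. [:- e, 1:]))"
    unfolding cp by (subst degree_mult_eq) (use mon in auto)
  with degree_monic_char_poly[OF A] have n: "n \<noteq> 0" by auto
  have ev: "eigenvalue A e" unfolding eigenvalue_root_char_poly[OF A] cp by simp
  obtain U where U: "U \<in> unitary_mats n"
    and col: "\<forall>i<n. conj_by U A $$ (i, 0) = (if i = 0 then e else 0)"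
    using exists_unitary_with_eigenvector[OF A ev n] by blast
  have Uc: "U \<in> carrier_mat n n" by (rule unitary_carrier[OF U])
  define m where "m = n - 1"
  have nm: "n = 1 + m" using n by (simp add: m_def)
  define A' where "A' = conj_by U A"
  have A'c: "A' \<in> carrier_mat n n" using Uc A by (simp add: A'_def)
  have A'h: "A' $$ (i, j) = cnj (A' $$ (j, i))" if "i < n" "j < n" for i j
    using hermitian_entry[OF _ A'c that] hermitian_conj_by[OF Uc A Cons.prems(2)] unfolding A'_def by blast
  define E where "E = mat 1 1 (\<lambda>_. e)"
  define A3 where "A3 = mat m m (\<lambda>(i, j). A' $$ (Suc i, Suc j))"
  have E: "E \<in> carrier_mat 1 1" and A3: "A3 \<in> carrier_mat m m" by (simp_all add: E_def A3_def)
  have row0: "A' $$ (0, j) = (if j = 0 then e else 0)" if "j < n" for j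
  proof -
    have "A' $$ (0, j) = cnj (A' $$ (j, 0))" using A'h[of 0 j] that n by blast
    also have "A' $$ (j, 0) = (if j = 0 then e else 0)" using col that by (simp add: A'_def)
    finally have *: "A' $$ (0, j) = cnj (if j = 0 then e else 0)" .
    moreover have "A' $$ (0, 0) = e" using col n by (simp add: A'_def)
    ultimately show ?thesis by auto
  qed
  have A'_block: "A' = block_sum E A3"
  proof (rule eq_matI)
    fix i j assume "i < dim_row (block_sum E A3)" "j < dim_col (block_sum E A3)"
    then have "i < n" "j < n" using nm by (auto simp: E_def A3_def)
    then show "A' $$ (i, j) = block_sum E A3 $$ (i, j)"
      using col[rule_format, of i] row0[of j] nm
      by (cases i; cases j) (auto simp: A'_def[symmetric] E_def A3_def)
  qed (use A'c nm in \<open>auto simp: E_def A3_def\<close>)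
  have "hermitian_mat A3"
    unfolding hermitian_iff_entries[OF A3]
  proof (intro allI impI)
    fix i j assume "i < m" "j < m"
    then show "A3 $$ (i, j) = cnj (A3 $$ (j, i))" using A'h[of "Suc i" "Suc j"] nm by (simp add: A3_def)
  qed
  moreover have "char_poly A3 = (\<Prod>e\<leftarrow>es. [:- e, 1:])"
  proof -
    have "char_poly A' = char_poly A"
      unfolding A'_def by (rule char_poly_similar[OF similar_mat_conj_by[OF U A]])
    moreover have "char_poly A' = char_poly E * char_poly A3"
      unfolding A'_block using E A3 char_poly_four_block_zeros_col[OF E, of "0\<^sub>m 1 m" m A3] by auto
    moreover have "char_poly E = [:- e, 1:]"
      by (simp add: E_def char_poly_defs det_def sign_def)
    ultimately show ?thesis using cp by (metis mult_cancel_left pCons_eq_0_iff zero_neq_one)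
  qed
  ultimately obtain V where V: "V \<in> unitary_mats m" "conj_by V A3 = mat_diag m (\<lambda>i. es ! i)"
    using Cons.IH[OF A3] by blast
  have Vc: "V \<in> carrier_mat m m" by (rule unitary_carrier[OF V(1)])
  define V' where "V' = block_sum (1\<^sub>m 1) V"
  have V': "V' \<in> unitary_mats n"
    unfolding V'_def nm by (rule unitary_block_sum[OF unitary_mats_one V(1)])
  have "conj_by (U * V') A = conj_by V' A'"
    unfolding A'_def using conj_by_conj_by[OF Uc unitary_carrier[OF V'] A] by simp
  also have "\<dots> = block_sum (conj_by (1\<^sub>m 1) E) (conj_by V A3)"
    unfolding V'_def A'_block using Vc A3 E by (intro conj_by_block_sum) auto
  also have "\<dots> = mat_diag n (\<lambda>i. (e # es) ! i)"
    unfolding V(2) conj_by_one[OF E] nm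
    by (rule eq_matI) (auto simp: E_def mat_diag_def nth_Cons')
  finally show ?case using unitary_mats_mult[OF U V'] by blast
qed

theorem hermitian_spectral:
  assumes A: "A \<in> carrier_mat n n" and herm: "hermitian_mat A"
  obtains U h where "U \<in> unitary_mats n" "antimono_on {..<n} h" "conj_by U A = real_diag n h"
proof -
  obtain es where es: "char_poly A = (\<Prod>e\<leftarrow>es. [:- e, 1:])" "length es = n"
    using char_poly_factorized[OF A] by blast
  obtain U where U: "U \<in> unitary_mats n" "conj_by U A = mat_diag n (\<lambda>i. es ! i)"
    using hermitian_spectral_list[OF A herm es(1)] by blast
  have "es ! i = complex_of_real (Re (es ! i))" if "i < n" for i
  proof -
    have "hermitian_mat (mat_diag n (\<lambda>i. es ! i))"
      using hermitian_conj_by[OF unitary_carrier[OF U(1)] A herm] U(2) by simp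
    then have "es ! i = cnj (es ! i)"
      using that hermitian_iff_entries[of "mat_diag n (\<lambda>i. es ! i)" n]
      by (fastforce simp: mat_diag_def)
    then show ?thesis by (metis Reals_cnj_iff of_real_Re)
  qed
  then have es_real: "es = map (complex_of_real \<circ> Re) es"
    using es(2) by (intro nth_equalityI) auto
  define hs where "hs = rev (sort (map Re es))"
  have len: "length hs = n" using es(2) by (simp add: hs_def)
  have "mset (map complex_of_real hs) = mset (map (complex_of_real \<circ> Re) es)"
    by (simp add: hs_def multiset.map_comp)
  then have "mset (map complex_of_real hs) = mset es" by (simp only: es_real[symmetric])
  then have "(\<Prod>e\<in>#mset (map complex_of_real hs). [:- e, 1:]) = (\<Prod>e\<in>#mset es. [:- e, 1:])"
    by (rule arg_cong)
  then have "(\<Prod>e\<leftarrow>map complex_of_real hs. [:- e, 1:]) = (\<Prod>e\<leftarrow>es. [:- e, 1:])"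
    by (simp only: prod_mset_prod_list flip: mset_map)
  then obtain V where V: "V \<in> unitary_mats n" "conj_by V A = mat_diag n (\<lambda>i. map complex_of_real hs ! i)"
    using hermitian_spectral_list[OF A herm] es(1) by metis
  have "sorted_wrt (\<ge>) hs" by (simp add: hs_def sorted_wrt_rev)
  then have "antimono_on {..<n} (\<lambda>i. hs ! i)"
    using len by (auto simp: monotone_on_def sorted_wrt_iff_nth_less le_less)
  moreover have "conj_by V A = real_diag n (\<lambda>i. hs ! i)"
    unfolding V(2) using len by (intro eq_matI) (auto simp: mat_diag_def)
  ultimately show ?thesis using that V(1) by blast
qed

lemma ordered_eigenvalues_diagonalize:
  assumes C: "C \<in> carrier_mat n n" "hermitian_mat C" and c: "ordered_eigenvalues n C c"
  obtains W where "W \<in> unitary_mats n" "conj_by W C = real_diag n (\<lambda>i. c (Suc i))"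
    "antimono_on {..<n} (\<lambda>i. c (Suc i))"
proof -
  define es where "es = map (\<lambda>i. complex_of_real (c (Suc i))) [0..<n]"
  have "char_poly C = (\<Prod>i\<in>{1..n}. [:- complex_of_real (c i), 1:])"
    using c by (simp add: ordered_eigenvalues_def)
  also have "\<dots> = (\<Prod>i\<in>{0..<n}. [:- complex_of_real (c (Suc i)), 1:])"
    by (rule prod.reindex_bij_witness[of _ Suc "\<lambda>i. i - 1"]) auto
  also have "\<dots> = (\<Prod>e\<leftarrow>es. [:- e, 1:])"
    by (simp add: es_def prod.distinct_set_conv_list[symmetric] o_def)
  finally obtain W where W: "W \<in> unitary_mats n" "conj_by W C = mat_diag n (\<lambda>i. es ! i)"
    using hermitian_spectral_list[OF C] by blast
  have "conj_by W C = real_diag n (\<lambda>i. c (Suc i))"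
    unfolding W(2) by (rule eq_matI) (auto simp: mat_diag_def es_def)
  moreover have "c (Suc j) \<le> c (Suc i)" if "i \<le> j" "j < n" for i j
    using that
  proof (induction j rule: dec_induct)
    case (step j)
    have "c (Suc (Suc j)) \<le> c (Suc j)" using c step.prems by (auto simp: ordered_eigenvalues_def)
    with step show ?case by simp
  qed simp
  ultimately show ?thesis using that[OF W(1)] by (auto simp: monotone_on_def)
qed

section \<open>Majorization\<close>

text \<open>Subtracting an arbitrary level \<open>l\<close> from all values displays the deficit of a weighted sum against
  the sum of the \<open>m\<close> leading values as a sum of separate contributions. For weights in \<open>[0, 1]\<close> with
  total \<open>m\<close> and a level between the \<open>m\<close>-th value and the next one, all contributions are non-negative.\<close>

lemma top_sum_minus_weighted_sum:
  fixes h p :: "nat \<Rightarrow> real"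
  assumes "m \<le> n"
  shows "(\<Sum>a<m. h a) - (\<Sum>a<n. p a * h a) =
    (\<Sum>a<m. (1 - p a) * (h a - l)) + (\<Sum>a=m..<n. p a * (l - h a)) + l * (real m - (\<Sum>a<n. p a))"
proof -
  have split: "(\<Sum>a<n. f a) = (\<Sum>a<m. f a) + (\<Sum>a=m..<n. f a)" for f :: "nat \<Rightarrow> real"
    using sum.atLeastLessThan_concat[of 0 m n f] assms by (simp add: atLeast0LessThan)
  show ?thesis
    unfolding split[of p] split[of "\<lambda>a. p a * h a"]
    by (simp add: algebra_simps sum.distrib sum_subtractf sum_distrib_left)
qed

lemma weighted_sum_le_top_sum:
  fixes h p :: "nat \<Rightarrow> real"
  assumes h: "antimono_on {..<n} h" and p: "\<And>a. a < n \<Longrightarrow> 0 \<le> p a \<and> p a \<le> 1"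
    and m: "m \<le> n" "(\<Sum>a<n. p a) = real m"
  shows "(\<Sum>a<n. p a * h a) \<le> (\<Sum>a<m. h a)"
proof (cases "m = 0")
  case True
  then have "(\<Sum>a<n. p a) = 0" using m by simp
  then have "\<And>a. a < n \<Longrightarrow> p a = 0" using p by (subst (asm) sum_nonneg_eq_0_iff) auto
  then show ?thesis using True by simp
next
  case False
  have "0 \<le> (\<Sum>a<m. (1 - p a) * (h a - h (m - 1))) + (\<Sum>a=m..<n. p a * (h (m - 1) - h a))"
    using p m(1) False
    by (intro add_nonneg_nonneg sum_nonneg mult_nonneg_nonneg)
       (auto intro!: monotone_onD[OF h])
  then show ?thesis
    using top_sum_minus_weighted_sum[OF m(1), of h p "h (m - 1)"] m(2) by simp
qed

text \<open>Equality in the preceding estimate forces every contribution to vanish, for each admissible level.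
  The level \<open>h k\<close> shows that the weights above it are one, and the level \<open>h (k - 1)\<close> that the weights
  below it are zero. Indices start at zero, so these are the two values next to the gap at \<open>k\<close>.\<close>

lemma weighted_sum_eq_top_sum:
  fixes h p :: "nat \<Rightarrow> real"
  assumes h: "antimono_on {..<n} h" and p: "\<And>a. a < n \<Longrightarrow> 0 \<le> p a \<and> p a \<le> 1"
    and k: "0 < k" "k < n" and sum: "(\<Sum>a<n. p a) = real k"
    and ge: "(\<Sum>a<n. p a * h a) \<ge> (\<Sum>a<k. h a)" and i: "i < n"
  shows "h i > h k \<Longrightarrow> p i = 1" "h i < h (k - 1) \<Longrightarrow> p i = 0"
proof -
  have hmono: "h b \<le> h a" if "a \<le> b" "b < n" for a b
    using monotone_onD[OF h, of a b] that by auto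
  have zero: "(\<forall>a<k. (1 - p a) * (h a - l) = 0) \<and> (\<forall>a\<in>{k..<n}. p a * (l - h a) = 0)"
    if l: "h k \<le> l" "l \<le> h (k - 1)" for l
  proof -
    have n1: "\<forall>a\<in>{..<k}. 0 \<le> (1 - p a) * (h a - l)"
    proof
      fix a assume "a \<in> {..<k}"
      then have "h (k - 1) \<le> h a" "p a \<le> 1" using k p[of a] by (auto intro!: hmono)
      then show "0 \<le> (1 - p a) * (h a - l)" using l by simp
    qed
    have n2: "\<forall>a\<in>{k..<n}. 0 \<le> p a * (l - h a)"
    proof
      fix a assume "a \<in> {k..<n}"
      then have "h a \<le> h k" "0 \<le> p a" using k p[of a] by (auto intro!: hmono)
      then show "0 \<le> p a * (l - h a)" using l by simp
    qed
    have "(\<Sum>a<k. (1 - p a) * (h a - l)) + (\<Sum>a=k..<n. p a * (l - h a)) \<le> 0"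
      using top_sum_minus_weighted_sum[of k n h p l] k sum ge by simp
    moreover have "(\<Sum>a<k. (1 - p a) * (h a - l)) \<ge> 0" "(\<Sum>a=k..<n. p a * (l - h a)) \<ge> 0"
      using n1 n2 by (auto intro: sum_nonneg)
    ultimately have "(\<Sum>a<k. (1 - p a) * (h a - l)) = 0" "(\<Sum>a=k..<n. p a * (l - h a)) = 0"
      by auto
    then have "\<forall>a\<in>{..<k}. (1 - p a) * (h a - l) = 0" "\<forall>a\<in>{k..<n}. p a * (l - h a) = 0"
      using sum_nonneg_0[of "{..<k}" "\<lambda>a. (1 - p a) * (h a - l)"]
        sum_nonneg_0[of "{k..<n}" "\<lambda>a. p a * (l - h a)"] n1 n2 by blast+
    then show ?thesis by blast
  qed
  have kk: "h k \<le> h (k - 1)" using hmono[of "k - 1" k] k by simp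
  show "p i = 1" if "h i > h k"
  proof -
    have "i < k" using that hmono[of k i] i by (meson leD leI)
    then show ?thesis using zero[of "h k"] kk that by auto
  qed
  show "p i = 0" if "h i < h (k - 1)"
  proof -
    have "k \<le> i"
    proof (rule ccontr)
      assume "\<not> k \<le> i"
      then have "h (k - 1) \<le> h i" using k by (intro hmono) auto
      with that show False by simp
    qed
    then show ?thesis using zero[of "h (k - 1)"] kk that i by auto
  qed
qed

text \<open>Abel summation: the partial sums of \<open>c - x\<close> are non-negative and the weights \<open>h\<close> decrease.\<close>

lemma sum_mult_le_of_partial_sums:
  fixes x c h :: "nat \<Rightarrow> real"
  assumes h: "antimono_on {..<n} h"
    and le: "\<And>m. m < n \<Longrightarrow> (\<Sum>i<m. x i) \<le> (\<Sum>i<m. c i)"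
    and eq: "(\<Sum>i<n. x i) = (\<Sum>i<n. c i)"
  shows "(\<Sum>i<n. x i * h i) \<le> (\<Sum>i<n. c i * h i)"
proof (cases n)
  case (Suc N)
  define d where "d i = c i - x i" for i
  have pos: "(\<Sum>i<m. d i) \<ge> 0" if "m \<le> n" for m
    using that le[of m] eq by (cases "m = n") (auto simp: d_def sum_subtractf)
  have "m < n \<Longrightarrow> (\<Sum>i<Suc m. d i * h i) \<ge> (\<Sum>i<Suc m. d i) * h m" for m
  proof (induction m)
    case (Suc m)
    have "(\<Sum>i<Suc m. d i) * h (Suc m) \<le> (\<Sum>i<Suc m. d i) * h m"
      using Suc.prems by (intro mult_left_mono pos monotone_onD[OF h]) auto
    also have "\<dots> \<le> (\<Sum>i<Suc m. d i * h i)" using Suc by simp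
    finally show ?case by (simp add: algebra_simps)
  qed simp
  from this[of N] Suc have "(\<Sum>i<n. d i * h i) \<ge> (\<Sum>i<n. d i) * h N" by simp
  also have "(\<Sum>i<n. d i) = 0" using eq by (simp add: d_def sum_subtractf)
  finally show ?thesis by (simp add: d_def algebra_simps sum_subtractf)
qed simp

definition doubly_stochastic :: "nat \<Rightarrow> (nat \<Rightarrow> nat \<Rightarrow> real) \<Rightarrow> bool" where
  "doubly_stochastic n S \<longleftrightarrow> (\<forall>i<n. \<forall>a<n. 0 \<le> S i a) \<and>
    (\<forall>i<n. (\<Sum>a<n. S i a) = 1) \<and> (\<forall>a<n. (\<Sum>i<n. S i a) = 1)"

text \<open>Bounding the sums over all index sets, instead of the partial sums of the rearrangement of \<open>x\<close>, avoids
  sorting \<open>x\<close>. The sequence \<open>c\<close> is always decreasing where this notion is used.\<close>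

definition majorized :: "nat \<Rightarrow> (nat \<Rightarrow> real) \<Rightarrow> (nat \<Rightarrow> real) \<Rightarrow> bool" where
  "majorized n x c \<longleftrightarrow> (\<forall>I\<subseteq>{..<n}. (\<Sum>i\<in>I. x i) \<le> (\<Sum>a<card I. c a)) \<and>
    (\<Sum>i<n. x i) = (\<Sum>a<n. c a)"

lemma majorized_doubly_stochastic:
  assumes S: "doubly_stochastic n S" and c: "antimono_on {..<n} c"
  shows "majorized n (\<lambda>i. \<Sum>a<n. S i a * c a) c"
  unfolding majorized_def
proof (intro conjI allI impI)
  fix I assume I: "I \<subseteq> {..<n}"
  have fin: "finite I" using I finite_subset by blast
  have "(\<Sum>i\<in>I. \<Sum>a<n. S i a * c a) = (\<Sum>a<n. (\<Sum>i\<in>I. S i a) * c a)"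
    by (subst sum.swap) (simp add: sum_distrib_right)
  also have "\<dots> \<le> (\<Sum>a<card I. c a)"
  proof (rule weighted_sum_le_top_sum[OF c])
    fix a assume a: "a < n"
    have "(\<Sum>i\<in>I. S i a) \<le> (\<Sum>i<n. S i a)"
      using S I a by (intro sum_mono2) (auto simp: doubly_stochastic_def)
    then show "0 \<le> (\<Sum>i\<in>I. S i a) \<and> (\<Sum>i\<in>I. S i a) \<le> 1"
      using S I a by (auto simp: doubly_stochastic_def intro!: sum_nonneg)
  next
    show "card I \<le> n" using card_mono[OF _ I] by simp
    have "(\<Sum>a<n. \<Sum>i\<in>I. S i a) = (\<Sum>i\<in>I. \<Sum>a<n. S i a)" by (rule sum.swap)
    also have "\<dots> = (\<Sum>i\<in>I. 1)" using S I by (intro sum.cong) (auto simp: doubly_stochastic_def)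
    finally show "(\<Sum>a<n. \<Sum>i\<in>I. S i a) = real (card I)" by simp
  qed
  finally show "(\<Sum>i\<in>I. \<Sum>a<n. S i a * c a) \<le> (\<Sum>a<card I. c a)" .
next
  have "(\<Sum>i<n. \<Sum>a<n. S i a * c a) = (\<Sum>a<n. (\<Sum>i<n. S i a) * c a)"
    by (subst sum.swap) (simp add: sum_distrib_right)
  also have "\<dots> = (\<Sum>a<n. c a)" using S by (intro sum.cong) (auto simp: doubly_stochastic_def)
  finally show "(\<Sum>i<n. \<Sum>a<n. S i a * c a) = (\<Sum>a<n. c a)" .
qed

lemma doubly_stochastic_sum_le:
  assumes S: "doubly_stochastic n S" and c: "antimono_on {..<n} c" and h: "antimono_on {..<n} h"
  shows "(\<Sum>i<n. (\<Sum>a<n. S i a * c a) * h i) \<le> (\<Sum>i<n. c i * h i)"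
proof (rule sum_mult_le_of_partial_sums[OF h])
  note m = majorized_doubly_stochastic[OF S c]
  show "(\<Sum>i<n. \<Sum>a<n. S i a * c a) = (\<Sum>i<n. c i)"
    using m by (simp add: majorized_def)
  show "(\<Sum>i<m. \<Sum>a<n. S i a * c a) \<le> (\<Sum>i<m. c i)" if "m < n" for m
  proof -
    have "{..<m} \<subseteq> {..<n}" using that by auto
    then have "(\<Sum>i<m. \<Sum>a<n. S i a * c a) \<le> (\<Sum>a<card {..<m}. c a)"
      using m unfolding majorized_def by blast
    then show ?thesis by simp
  qed
qed

text \<open>Lowering the first \<open>k\<close> values of \<open>c\<close> by the size of the gap keeps the sequence decreasing. A
  maximizer for \<open>c\<close> therefore cannot lose anything on the part that was removed, which is a multiple
  of the indicator of the first \<open>k\<close> indices. In this way an arbitrary spectrum with a gap at \<open>k\<close> is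
  reduced to the spectrum of a projection.\<close>

lemma doubly_stochastic_gap:
  assumes S: "doubly_stochastic n S" and c: "antimono_on {..<n} c" and h: "antimono_on {..<n} h"
    and k: "0 < k" "k < n" and gap: "c k < c (k - 1)"
    and max: "(\<Sum>i<n. (\<Sum>a<n. S i a * c a) * h i) \<ge> (\<Sum>i<n. c i * h i)"
  shows "(\<Sum>i<n. (\<Sum>a<k. S i a) * h i) \<ge> (\<Sum>i<k. h i)"
proof -
  define g where "g = c (k - 1) - c k"
  \<comment> \<open>The sequence \<open>c\<close> with the gap closed.\<close>
  define c' where "c' a = c a - (if a < k then g else 0)" for a
  have cm: "c b \<le> c a" if "a \<le> b" "b < n" for a b
    using monotone_onD[OF c, of a b] that by auto
  have "c' b \<le> c' a" if "a \<le> b" "b < n" for a b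
  proof (cases "a < k \<and> \<not> b < k")
    case True
    then have "c b \<le> c k" "c (k - 1) \<le> c a" using that k by (auto intro!: cm)
    with True show ?thesis by (simp add: c'_def g_def)
  qed (use cm[OF that] that in \<open>auto simp: c'_def\<close>)
  then have c': "antimono_on {..<n} c'" by (auto simp: monotone_on_def)
  have restr: "(\<Sum>a<n. if a < k then f a else 0) = (\<Sum>a<k. f a)" for f :: "nat \<Rightarrow> real"
    using k by (subst sum.inter_filter[symmetric]) (auto intro!: sum.cong)
  have split: "(\<Sum>a<n. f a * c a) = (\<Sum>a<n. f a * c' a) + g * (\<Sum>a<k. f a)" for f
  proof -
    have "(\<Sum>a<n. f a * c a) = (\<Sum>a<n. f a * c' a + g * (if a < k then f a else 0))"
      by (intro sum.cong) (auto simp: c'_def algebra_simps)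
    then show ?thesis by (simp only: sum.distrib sum_distrib_left[symmetric] restr)
  qed
  have lin: "(\<Sum>i<n. (A i + g * B i) * h i) = (\<Sum>i<n. A i * h i) + g * (\<Sum>i<n. B i * h i)" for A B
    by (simp add: algebra_simps sum.distrib sum_distrib_left)
  have "(\<Sum>i<n. (\<Sum>a<n. S i a * c a) * h i) =
      (\<Sum>i<n. (\<Sum>a<n. S i a * c' a) * h i) + g * (\<Sum>i<n. (\<Sum>a<k. S i a) * h i)"
    by (simp only: split lin)
  moreover have "(\<Sum>i<n. c i * h i) = (\<Sum>i<n. c' i * h i) + g * (\<Sum>i<k. h i)"
    using split[of h] by (simp add: mult.commute)
  ultimately have "g * (\<Sum>i<k. h i) \<le> g * (\<Sum>i<n. (\<Sum>a<k. S i a) * h i)"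
    using max doubly_stochastic_sum_le[OF S c' h] by linarith
  then show ?thesis using gap by (simp add: g_def)
qed

text \<open>An averaging of two coordinates; the value \<open>t = 0\<close> exchanges them.\<close>

definition t_transform :: "real \<Rightarrow> nat \<Rightarrow> nat \<Rightarrow> (nat \<Rightarrow> real) \<Rightarrow> nat \<Rightarrow> real" where
  "t_transform t i j z = z(i := t * z i + (1 - t) * z j, j := (1 - t) * z i + t * z j)"

definition t_closed :: "nat \<Rightarrow> (nat \<Rightarrow> real) set \<Rightarrow> bool" where
  "t_closed n E \<longleftrightarrow> (\<forall>z\<in>E. \<forall>i<n. \<forall>j<n. \<forall>t\<in>{0..1}. i \<noteq> j \<longrightarrow> t_transform t i j z \<in> E)"

lemma t_closed_permute:
  assumes E: "t_closed n E" and "\<pi> permutes {..<n}" "z \<in> E"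
  shows "z \<circ> \<pi> \<in> E"
proof -
  have "finite {..<n}" by simp
  from assms(2) this have "\<forall>z\<in>E. z \<circ> \<pi> \<in> E"
  proof (induction \<pi> rule: permutes_induct)
    case (swap a b p)
    show ?case
    proof
      fix z assume z: "z \<in> E"
      have "z \<circ> Transposition.transpose a b = t_transform 0 a b z" if "a \<noteq> b"
        using that by (auto simp: t_transform_def fun_eq_iff Transposition.transpose_def)
      then have "z \<circ> Transposition.transpose a b \<in> E"
        using E z swap.hyps by (cases "a = b") (auto simp: t_closed_def)
      then show "z \<circ> (Transposition.transpose a b \<circ> p) \<in> E" using swap by (metis comp_assoc)
    qed
  qed simp
  with assms(3) show ?thesis by blast
qed

text \<open>Induction on the number of coordinates that remain to be adjusted. The next coordinate \<open>x j\<close> lies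
  between two consecutive values \<open>z k\<close> and \<open>z (k + 1)\<close>. A T-transform of this pair produces \<open>x j\<close> and a
  number \<open>s\<close> that again lies between the two values, and a cyclic permutation moves \<open>x j\<close> into place. The
  remaining coordinates are still decreasing, and their leading sums either are the old ones or are
  old ones minus \<open>x j\<close>, so that the dominance of the set sums of \<open>x\<close> is inherited.\<close>

lemma t_closed_reaches_from_prefix:
  assumes E: "t_closed n E"
  shows "j \<le> n \<Longrightarrow> z \<in> E \<Longrightarrow> \<forall>i<j. z i = x i \<Longrightarrow> antimono_on {j..<n} z \<Longrightarrow>
    \<forall>I\<subseteq>{j..<n}. (\<Sum>i\<in>I. x i) \<le> (\<Sum>a=j..<j + card I. z a) \<Longrightarrow>
    (\<Sum>i=j..<n. x i) = (\<Sum>i=j..<n. z i) \<Longrightarrow> \<exists>z'\<in>E. \<forall>i<n. z' i = x i"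
proof (induction "n - j" arbitrary: j z)
  case 0
  then show ?case by auto
next
  case (Suc d j z)
  have j: "j < n" using Suc.hyps(2) by simp
  have zm: "z b \<le> z a" if "j \<le> a" "a \<le> b" "b < n" for a b
    using monotone_onD[OF Suc.prems(4), of a b] that by auto
  show ?case
  proof (cases "Suc j = n")
    case True
    then have "{j..<n} = {j}" by auto
    then have "x j = z j" using Suc.prems(6) by simp
    then have "\<forall>i<n. z i = x i" using Suc.prems(3) True less_Suc_eq by metis
    then show ?thesis using Suc.prems(2) by blast
  next
    case False
    have xj: "x j \<le> z j"
      using Suc.prems(5)[rule_format, of "{j}"] j by simp
    have "(\<Sum>i=Suc j..<n. x i) \<le> (\<Sum>a=j..<n - 1. z a)"
      using Suc.prems(5)[rule_format, of "{Suc j..<n}"] j by simp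
    moreover have "(\<Sum>i=j..<n. z i) = (\<Sum>a=j..<n - 1. z a) + z (n - 1)"
      using sum.atLeastLessThan_Suc[of j "n - 1" z] j False by simp
    moreover have "(\<Sum>i=j..<n. x i) = x j + (\<Sum>i=Suc j..<n. x i)"
      using sum.atLeast_Suc_lessThan[OF j] by blast
    ultimately have zn: "z (n - 1) \<le> x j" using Suc.prems(6) by linarith
    \<comment> \<open>The last place, before the final one, where \<open>z\<close> is still at least \<open>x j\<close>.\<close>
    define k where "k = Max {i \<in> {j..n - 2}. x j \<le> z i}"
    have "j \<in> {i \<in> {j..n - 2}. x j \<le> z i}" using xj j False by auto
    then have ne: "{i \<in> {j..n - 2}. x j \<le> z i} \<noteq> {}" by blast
    have k: "k \<in> {i \<in> {j..n - 2}. x j \<le> z i}" unfolding k_def by (rule Max_in) (use ne in auto)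
    then have kb: "j \<le> k" "Suc k < n" and zk: "x j \<le> z k" using j False by auto
    have zk': "z (Suc k) \<le> x j"
    proof (cases "Suc k = n - 1")
      case True
      then show ?thesis using zn by simp
    next
      case False
      have "\<not> x j \<le> z (Suc k)"
      proof
        assume "x j \<le> z (Suc k)"
        then have "Suc k \<in> {i \<in> {j..n - 2}. x j \<le> z i}" using kb False by auto
        then have "Suc k \<le> k" unfolding k_def by (intro Max_ge) auto
        then show False by simp
      qed
      then show ?thesis by simp
    qed
    define s where "s = z k + z (Suc k) - x j"
    obtain t where t: "t \<in> {0..1}" "x j = t * z k + (1 - t) * z (Suc k)"
    proof (cases "z k = z (Suc k)")
      case True
      then show ?thesis using that[of 1] zk zk' by auto
    next
      case False
      then have pos: "z k - z (Suc k) > 0" using zk zk' by simp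
      define t where "t = (x j - z (Suc k)) / (z k - z (Suc k))"
      have "t * (z k - z (Suc k)) = x j - z (Suc k)" using pos by (simp add: t_def)
      moreover have "t * z k + (1 - t) * z (Suc k) = t * (z k - z (Suc k)) + z (Suc k)"
        by (simp add: algebra_simps)
      moreover have "t \<in> {0..1}" using pos zk zk' by (simp add: t_def)
      ultimately show ?thesis using that[of t] by simp
    qed
    define z1 where "z1 = t_transform t k (Suc k) z"
    have z1E: "z1 \<in> E" unfolding z1_def using E Suc.prems(2) kb t(1) by (auto simp: t_closed_def)
    have z1: "z1 i = (if i = k then x j else if i = Suc k then s else z i)" for i
      using t(2) by (simp add: z1_def t_transform_def s_def algebra_simps)
    \<comment> \<open>The cycle that shifts \<open>z j, \<dots>, z (k - 1)\<close> one place to the right and brings \<open>x j\<close> to place \<open>j\<close>.\<close>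
    define \<pi> where "\<pi> i = (if i = j then k else if j < i \<and> i \<le> k then i - 1 else i)" for i
    have "bij_betw \<pi> {..<n} {..<n}"
    proof (rule bij_betw_byWitness[where f' = "\<lambda>i. if i = k then j else if j \<le> i \<and> i < k then Suc i else i"])
    qed (use kb in \<open>auto simp: \<pi>_def\<close>)
    then have "\<pi> permutes {..<n}"
      by (rule bij_imp_permutes) (use kb in \<open>auto simp: \<pi>_def\<close>)
    then have z2E: "z1 \<circ> \<pi> \<in> E" using t_closed_permute[OF E _ z1E] by blast
    define z2 where "z2 = z1 \<circ> \<pi>"
    have z2: "z2 i = (if i = j then x j else if j < i \<and> i \<le> k then z (i - 1) else if i = Suc k then s else z i)" for i
      using kb by (auto simp: z2_def \<pi>_def z1)
    have sb: "z (Suc k) \<le> s" "s \<le> z k" using zk zk' by (auto simp: s_def)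
    have part: "(\<Sum>a=Suc j..<q. z2 a) = (if q \<le> Suc k then (\<Sum>a=j..<q - 1. z a) else (\<Sum>a=j..<q. z a) - x j)"
      if "Suc j \<le> q" for q
      using that
    proof (induction q rule: dec_induct)
      case base
      then show ?case using kb by simp
    next
      case (step q)
      consider "Suc q \<le> Suc k" | "q = Suc k" | "q > Suc k" by linarith
      then show ?case
      proof cases
        case 1
        have "(\<Sum>a=j..<q. z a) = (\<Sum>a=j..<q - 1. z a) + z (q - 1)"
          using sum.atLeastLessThan_Suc[of j "q - 1" z] step.hyps by simp
        then show ?thesis using 1 step by (simp add: z2)
      next
        case 2
        have "(\<Sum>a=j..<Suc q. z a) = (\<Sum>a=j..<k. z a) + z k + z (Suc k)"
          using 2 kb by simp
        then show ?thesis using 2 step by (simp add: z2 s_def)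
      next
        case 3
        then show ?thesis using step by (simp add: z2)
      qed
    qed
    have "\<exists>z'\<in>E. \<forall>i<n. z' i = x i"
    proof (rule Suc.hyps(1)[of "Suc j" z2])
      show "d = n - Suc j" using Suc.hyps(2) by simp
      show "Suc j \<le> n" using j by simp
      show "z2 \<in> E" using z2E by (simp add: z2_def)
      show "\<forall>i<Suc j. z2 i = x i" using Suc.prems(3) kb by (auto simp: z2 less_Suc_eq)
      have "z2 b \<le> z2 a" if "Suc j \<le> a" "a \<le> b" "b < n" for a b
      proof -
        consider "b \<le> k" | "b = Suc k" | "Suc k < b" by linarith
        then show ?thesis
        proof cases
          case 1
          have "z (b - 1) \<le> z (a - 1)" using that 1 by (intro zm) auto
          then show ?thesis using that 1 by (simp add: z2)
        next
          case 2
          show ?thesis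
          proof (cases "a \<le> k")
            case True
            have "z k \<le> z (a - 1)" using that True kb by (intro zm) auto
            then show ?thesis using that True 2 sb kb by (simp add: z2)
          next
            case False
            then have "a = b" using that 2 by simp
            then show ?thesis by simp
          qed
        next
          case 3
          consider "a \<le> k" | "a = Suc k" | "Suc k < a" by linarith
          then show ?thesis
          proof cases
            case 1
            have "z b \<le> z (a - 1)" using that kb by (intro zm) auto
            then show ?thesis using that 1 3 kb by (simp add: z2)
          next
            case 2
            have "z b \<le> z (Suc k)" using that 2 kb by (intro zm) auto
            then show ?thesis using that 2 3 sb kb by (simp add: z2)
          next
            case c: 3
            have "z b \<le> z a" using that by (intro zm) auto
            then show ?thesis using that c 3 by (simp add: z2)
          qed
        qed
      qed
      then show "antimono_on {Suc j..<n} z2" by (auto simp: monotone_on_def)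
      show "\<forall>I\<subseteq>{Suc j..<n}. sum x I \<le> sum z2 {Suc j..<Suc j + card I}"
      proof (intro allI impI)
        fix I assume I: "I \<subseteq> {Suc j..<n}"
        then have fin: "finite I" and jI: "j \<notin> I" using finite_subset by auto
        show "sum x I \<le> sum z2 {Suc j..<Suc j + card I}"
        proof (cases "j + card I \<le> k")
          case True
          have "I \<subseteq> {j..<n}" using I by auto
          then show ?thesis using Suc.prems(5) True part[of "Suc j + card I"] by simp
        next
          case False
          have "insert j I \<subseteq> {j..<n}" using I j by auto
          then have "sum x (insert j I) \<le> (\<Sum>a=j..<j + card (insert j I). z a)"
            using Suc.prems(5) by blast
          then have "x j + sum x I \<le> (\<Sum>a=j..<Suc (j + card I). z a)"
            using fin jI by simp
          then show ?thesis using False part[of "Suc j + card I"] by simp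
        qed
      qed
      have "(\<Sum>i=j..<n. x i) = x j + (\<Sum>i=Suc j..<n. x i)"
        using sum.atLeast_Suc_lessThan[OF j] by blast
      then show "sum x {Suc j..<n} = sum z2 {Suc j..<n}"
        using part[of n] kb Suc.prems(6) j by simp
    qed
    then show ?thesis .
  qed
qed

text \<open>The Hardy-Littlewood-Polya theorem in the form needed for the Schur-Horn theorem: it is applied
  both to the set of diagonals of a unitary orbit and to the set of vectors whose images lie in
  a given convex hull.\<close>

lemma t_closed_reaches_majorized:
  assumes E: "t_closed n E" and c: "c \<in> E" "antimono_on {..<n} c" and x: "majorized n x c"
  shows "\<exists>z\<in>E. \<forall>i<n. z i = x i"
  by (rule t_closed_reaches_from_prefix[OF E, of 0 c])
     (use c x in \<open>auto simp: majorized_def atLeast0LessThan lessThan_def\<close>)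

section \<open>Projections and extremal traces\<close>

text \<open>The squared moduli of the entries of a unitary matrix link the spectrum of a Hermitian matrix to its
  diagonal in another orthonormal basis.\<close>

lemma doubly_stochastic_unitary:
  assumes V: "V \<in> unitary_mats n"
  shows "doubly_stochastic n (\<lambda>i a. (cmod (V $$ (i, a)))\<^sup>2)"
proof -
  have Vc: "V \<in> carrier_mat n n" by (rule unitary_carrier[OF V])
  have rows: "(\<Sum>a<n. (cmod (U $$ (i, a)))\<^sup>2) = 1" if "U \<in> unitary_mats n" "i < n" for U i
  proof -
    have Uc: "U \<in> carrier_mat n n" using that(1) by (rule unitary_carrier)
    have "complex_of_real (\<Sum>a<n. (cmod (U $$ (i, a)))\<^sup>2) = (\<Sum>a<n. U $$ (i, a) * mat_adjoint U $$ (a, i))"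
      using Uc that(2) by (simp add: complex_norm_square del: of_real_power)
    also have "\<dots> = (U * mat_adjoint U) $$ (i, i)"
      using Uc that(2) by (intro index_mult_mat_sum[symmetric]) auto
    also have "\<dots> = 1" using that by (simp add: unitary_mats_def del: index_mult_mat)
    finally show ?thesis by (metis of_real_eq_1_iff)
  qed
  have "(\<Sum>i<n. (cmod (V $$ (i, a)))\<^sup>2) = 1" if "a < n" for a
    using rows[OF unitary_mats_adjoint[OF V] that] Vc that by simp
  with rows[OF V] show ?thesis by (simp add: doubly_stochastic_def)
qed

lemma conj_by_adjoint_diag_entry:
  assumes "X \<in> carrier_mat n n" "i < n" "j < n"
  shows "conj_by (mat_adjoint X) (mat_diag n f) $$ (i, j) = (\<Sum>a<n. X $$ (i, a) * f a * cnj (X $$ (j, a)))"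
proof -
  have "conj_by (mat_adjoint X) (mat_diag n f) = (X * mat_diag n f) * mat_adjoint X"
    by (simp add: conj_by_def)
  also have "\<dots> $$ (i, j) = (\<Sum>a<n. (X * mat_diag n f) $$ (i, a) * mat_adjoint X $$ (a, j))"
    using assms by (intro index_mult_mat_sum) auto
  also have "\<dots> = (\<Sum>a<n. X $$ (i, a) * f a * cnj (X $$ (j, a)))"
    using assms by (intro sum.cong) (auto simp: mat_diag_mult_right[of _ n n] simp del: index_mult_mat(1))
  finally show ?thesis .
qed

lemma trace_diag_conj_by_diag:
  assumes X: "X \<in> carrier_mat n n"
  shows "mat_trace (real_diag n c * conj_by X (real_diag n h)) =
    complex_of_real (\<Sum>i<n. (\<Sum>a<n. (cmod (X $$ (i, a)))\<^sup>2 * c a) * h i)"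
proof -
  have "real_diag n c * conj_by X (real_diag n h) =
      (real_diag n c * (mat_adjoint X * real_diag n h)) * X"
    using X by (simp add: conj_by_def assoc_sq[where n = n])
  also have "mat_trace \<dots> = mat_trace (X * (real_diag n c * (mat_adjoint X * real_diag n h)))"
    using X by (intro mat_trace_commute[of _ n n]) auto
  also have "X * (real_diag n c * (mat_adjoint X * real_diag n h)) =
      conj_by (mat_adjoint X) (real_diag n c) * real_diag n h"
    using X by (simp add: conj_by_def assoc_sq[where n = n])
  also have "mat_trace \<dots> = (\<Sum>i<n. conj_by (mat_adjoint X) (real_diag n c) $$ (i, i) * h i)"
    using X by (subst mat_diag_mult_right[of _ n]) (auto simp: mat_trace_def)
  also have "\<dots> = complex_of_real (\<Sum>i<n. (\<Sum>a<n. (cmod (X $$ (i, a)))\<^sup>2 * c a) * h i)"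
    using X by (simp add: conj_by_adjoint_diag_entry complex_norm_square mult_ac del: of_real_power cong: sum.cong_simp)
  finally show ?thesis .
qed

definition projection_mat :: "nat \<Rightarrow> nat \<Rightarrow> complex mat \<Rightarrow> bool" where
  "projection_mat n k P \<longleftrightarrow>
    P \<in> carrier_mat n n \<and> hermitian_mat P \<and> P * P = P \<and> mat_trace P = of_nat k"

definition coord_projection :: "nat \<Rightarrow> nat \<Rightarrow> complex mat" where
  "coord_projection n k = mat_diag n (\<lambda>i. if i < k then 1 else 0)"

text \<open>The orthogonal projection onto the span of the first \<open>k\<close> columns of \<open>V\<close>.\<close>

definition leading_projection :: "nat \<Rightarrow> nat \<Rightarrow> complex mat \<Rightarrow> complex mat" where
  "leading_projection n k V = conj_by (mat_adjoint V) (coord_projection n k)"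

lemma projection_mat_coord:
  assumes "k \<le> n"
  shows "projection_mat n k (coord_projection n k)"
proof -
  have "(\<Sum>i<n. if i < k then 1 else (0::complex)) = of_nat k"
  proof -
    have "{..<n} \<inter> {i. i < k} = {..<k}" using assms by auto
    then show ?thesis by (simp add: sum.If_cases)
  qed
  then have "mat_trace (coord_projection n k) = of_nat k"
    by (simp add: mat_trace_def coord_projection_def mat_diag_def)
  moreover have "coord_projection n k * coord_projection n k = coord_projection n k"
    unfolding coord_projection_def mat_diag_diag by (rule arg_cong[of _ _ "mat_diag n"]) auto
  moreover have "hermitian_mat (coord_projection n k)"
    unfolding hermitian_mat_def coord_projection_def mat_adjoint_diag
    by (rule arg_cong[of _ _ "mat_diag n"]) auto
  ultimately show ?thesis by (simp add: projection_mat_def coord_projection_def)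
qed

lemma projection_mat_conj_by:
  assumes U: "U \<in> unitary_mats n" and P: "projection_mat n k P"
  shows "projection_mat n k (conj_by U P)"
  using P unitary_carrier[OF U] hermitian_conj_by[of U n P] conj_by_mult[OF U, of P P] mat_trace_conj_by[OF U]
  by (simp add: projection_mat_def)

lemma projection_mat_leading:
  "V \<in> unitary_mats n \<Longrightarrow> k \<le> n \<Longrightarrow> projection_mat n k (leading_projection n k V)"
  unfolding leading_projection_def
  by (intro projection_mat_conj_by projection_mat_coord unitary_mats_adjoint)

lemma projection_mat_row_norm:
  assumes P: "projection_mat n k P" and i: "i < n"
  shows "P $$ (i, i) = complex_of_real (\<Sum>j<n. (cmod (P $$ (i, j)))\<^sup>2)"
proof -
  have Pc: "P \<in> carrier_mat n n" and Ph: "hermitian_mat P" and PP: "P * P = P"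
    using P by (auto simp: projection_mat_def)
  have "P $$ (i, i) = (P * P) $$ (i, i)" using PP by simp
  also have "\<dots> = (\<Sum>j<n. P $$ (i, j) * P $$ (j, i))" using Pc i by (intro index_mult_mat_sum) auto
  also have "\<dots> = (\<Sum>j<n. P $$ (i, j) * cnj (P $$ (i, j)))"
  proof (intro sum.cong refl)
    fix j assume "j \<in> {..<n}"
    then have "P $$ (j, i) = cnj (P $$ (i, j))" using hermitian_entry[OF Ph Pc _ i] by blast
    then show "P $$ (i, j) * P $$ (j, i) = P $$ (i, j) * cnj (P $$ (i, j))" by simp
  qed
  finally show ?thesis by (simp add: complex_norm_square del: of_real_power)
qed

lemma hermitian_trace_square_zero:
  assumes N: "N \<in> carrier_mat n n" "hermitian_mat N" and tr: "mat_trace (N * N) = 0"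
  shows "N = 0\<^sub>m n n"
proof -
  have "complex_of_real (\<Sum>i<n. \<Sum>j<n. (cmod (N $$ (i, j)))\<^sup>2) = (\<Sum>i<n. \<Sum>j<n. N $$ (i, j) * cnj (N $$ (i, j)))"
    by (simp add: complex_norm_square del: of_real_power)
  also have "\<dots> = (\<Sum>i<n. \<Sum>j<n. N $$ (i, j) * N $$ (j, i))"
  proof (intro sum.cong refl)
    fix i j assume "i \<in> {..<n}" "j \<in> {..<n}"
    then have "N $$ (j, i) = cnj (N $$ (i, j))" using hermitian_entry[OF N(2,1), of j i] by auto
    then show "N $$ (i, j) * cnj (N $$ (i, j)) = N $$ (i, j) * N $$ (j, i)" by simp
  qed
  also have "\<dots> = 0" using tr mat_trace_mult[OF N(1) N(1)] by simp
  finally have "(\<Sum>i<n. \<Sum>j<n. (cmod (N $$ (i, j)))\<^sup>2) = 0" by (metis of_real_eq_0_iff)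
  then have "\<forall>i<n. \<forall>j<n. N $$ (i, j) = 0"
    by (simp add: sum_nonneg_eq_0_iff sum_nonneg)
  then show ?thesis using N(1) by (intro eq_matI) auto
qed

text \<open>A projection of trace one has rank one, so all its two-by-two minors vanish. If \<open>T\<close> has a nonzero
  diagonal entry at \<open>j\<close>, subtracting the normalized square of its \<open>j\<close>-th column leaves a Hermitian
  idempotent of trace zero, which is zero.\<close>

lemma projection_trace_one_entries:
  assumes T: "projection_mat n 1 T" and abcd: "a < n" "b < n" "c < n" "d < n"
  shows "T $$ (a, c) * T $$ (d, b) = T $$ (a, b) * T $$ (d, c)"
proof -
  have Tc: "T \<in> carrier_mat n n" and Th: "hermitian_mat T" and TT: "T * T = T" and tr: "mat_trace T = 1"
    using T by (auto simp: projection_mat_def)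
  have "\<exists>j<n. T $$ (j, j) \<noteq> 0"
  proof (rule ccontr)
    assume "\<not> (\<exists>j<n. T $$ (j, j) \<noteq> 0)"
    then have "mat_trace T = 0" using Tc by (simp add: mat_trace_def)
    with tr show False by simp
  qed
  then obtain j where j: "j < n" "T $$ (j, j) \<noteq> 0" by blast
  define N where "N = mat n n (\<lambda>(a, b). T $$ (a, b) - T $$ (a, j) * T $$ (j, b) / T $$ (j, j))"
  have Nc: "N \<in> carrier_mat n n" by (simp add: N_def)
  have Tsq: "(\<Sum>l<n. T $$ (a, l) * T $$ (l, b)) = T $$ (a, b)" if "a < n" "b < n" for a b
    using index_mult_mat_sum[OF Tc Tc that] TT by simp
  have "hermitian_mat N"
    unfolding hermitian_iff_entries[OF Nc]
  proof (intro allI impI)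
    fix a b assume ab: "a < n" "b < n"
    have e: "T $$ (x, y) = cnj (T $$ (y, x))" if "x < n" "y < n" for x y
      by (rule hermitian_entry[OF Th Tc that])
    show "N $$ (a, b) = cnj (N $$ (b, a))"
      using ab j e[of a b] e[of a j] e[of j b] e[of j j] by (simp add: N_def)
  qed
  moreover have "mat_trace (N * N) = 0"
  proof -
    have NN: "(N * N) $$ (a, a) = N $$ (a, a)" if a: "a < n" for a
    proof -
      define \<alpha> where "\<alpha> = T $$ (j, a) / T $$ (j, j)"
      define \<beta> where "\<beta> = T $$ (a, j) / T $$ (j, j)"
      have "(N * N) $$ (a, a) = (\<Sum>l<n. N $$ (a, l) * N $$ (l, a))"
        by (rule index_mult_mat_sum[OF Nc Nc a a])
      also have "\<dots> = (\<Sum>l<n. T $$ (a, l) * T $$ (l, a) - (T $$ (a, l) * T $$ (l, j)) * \<alpha>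
          - (T $$ (j, l) * T $$ (l, a)) * \<beta> + (T $$ (j, l) * T $$ (l, j)) * (\<alpha> * \<beta>))"
      proof (intro sum.cong refl)
        fix l assume "l \<in> {..<n}"
        then have e: "N $$ (a, l) = T $$ (a, l) - \<beta> * T $$ (j, l)" "N $$ (l, a) = T $$ (l, a) - T $$ (l, j) * \<alpha>"
          using a by (simp_all add: N_def \<alpha>_def \<beta>_def)
        show "N $$ (a, l) * N $$ (l, a) = T $$ (a, l) * T $$ (l, a) - (T $$ (a, l) * T $$ (l, j)) * \<alpha>
          - (T $$ (j, l) * T $$ (l, a)) * \<beta> + (T $$ (j, l) * T $$ (l, j)) * (\<alpha> * \<beta>)"
          unfolding e by (simp add: algebra_simps)
      qed
      also have "\<dots> = T $$ (a, a) - T $$ (a, j) * \<alpha> - T $$ (j, a) * \<beta> + T $$ (j, j) * (\<alpha> * \<beta>)"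
        using a j(1) by (simp only: sum.distrib sum_subtractf sum_distrib_right[symmetric] Tsq)
      also have "\<dots> = N $$ (a, a)"
        using a j by (simp add: N_def \<alpha>_def \<beta>_def)
      finally show ?thesis .
    qed
    have "mat_trace (N * N) = (\<Sum>a<n. N $$ (a, a))"
      using Nc NN by (simp add: mat_trace_def del: index_mult_mat(1))
    also have "\<dots> = (\<Sum>a<n. T $$ (a, a)) - (\<Sum>a<n. T $$ (j, a) * T $$ (a, j)) / T $$ (j, j)"
      by (simp add: N_def sum_subtractf sum_divide_distrib mult.commute)
    also have "\<dots> = 0" using tr Tc j by (simp add: Tsq mat_trace_def)
    finally show ?thesis .
  qed
  ultimately have N0: "N = 0\<^sub>m n n" using hermitian_trace_square_zero[OF Nc] by blast
  have rank1: "T $$ (a, b) = T $$ (a, j) * T $$ (j, b) / T $$ (j, j)" if "a < n" "b < n" for a b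
  proof -
    have "N $$ (a, b) = 0" using N0 that by simp
    then show ?thesis using that by (simp add: N_def)
  qed
  show ?thesis
    using rank1[of a c] rank1[of d b] rank1[of a b] rank1[of d c] abcd by (simp only:) (simp add: mult_ac)
qed

lemma projection_trace_one_sandwich:
  assumes T: "projection_mat n 1 T" and M: "M \<in> carrier_mat n n"
  shows "T * M * T = mat_trace (M * T) \<cdot>\<^sub>m T"
proof (rule eq_matI)
  have Tc: "T \<in> carrier_mat n n" using T by (simp add: projection_mat_def)
  fix a b assume "a < dim_row (mat_trace (M * T) \<cdot>\<^sub>m T)" "b < dim_col (mat_trace (M * T) \<cdot>\<^sub>m T)"
  then have a: "a < n" and b: "b < n" using Tc by auto
  have "(T * M * T) $$ (a, b) = (\<Sum>d<n. (T * M) $$ (a, d) * T $$ (d, b))"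
    using Tc M a b by (intro index_mult_mat_sum) auto
  also have "\<dots> = (\<Sum>d<n. \<Sum>c<n. T $$ (a, c) * M $$ (c, d) * T $$ (d, b))"
    using Tc M a by (intro sum.cong) (auto simp: index_mult_mat_sum[of _ n n _ n] sum_distrib_right simp del: index_mult_mat(1))
  also have "\<dots> = (\<Sum>c<n. \<Sum>d<n. M $$ (c, d) * T $$ (d, c) * T $$ (a, b))"
    by (subst sum.swap) (use projection_trace_one_entries[OF T a b] in \<open>auto intro!: sum.cong simp: mult_ac\<close>)
  also have "\<dots> = mat_trace (M * T) * T $$ (a, b)"
    unfolding mat_trace_mult[OF M Tc] by (simp add: sum_distrib_right)
  finally show "(T * M * T) $$ (a, b) = (mat_trace (M * T) \<cdot>\<^sub>m T) $$ (a, b)" using Tc a b by simp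
qed (use T in \<open>auto simp: projection_mat_def\<close>)


section \<open>Spectral projections in eigencoordinates\<close>

text \<open>For a Hermitian idempotent \<open>P\<close>, a unit row at \<open>i\<close> says that the \<open>i\<close>-th basis vector lies in the range
  of \<open>P\<close>, and a zero row that it is orthogonal to the range.\<close>

definition unit_row :: "nat \<Rightarrow> complex mat \<Rightarrow> nat \<Rightarrow> bool" where
  "unit_row n P i \<longleftrightarrow> (\<forall>j<n. P $$ (i, j) = (if i = j then 1 else 0))"

definition zero_row :: "nat \<Rightarrow> complex mat \<Rightarrow> nat \<Rightarrow> bool" where
  "zero_row n P i \<longleftrightarrow> (\<forall>j<n. P $$ (i, j) = 0)"

text \<open>The condition that characterizes the projections of rank \<open>k\<close> with maximal trace against the diagonal
  matrix with decreasing entries \<open>h\<close>: the range contains all eigenvectors for eigenvalues above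
  \<open>h k\<close> and is orthogonal to those for eigenvalues below \<open>h (k - 1)\<close>. Only if the two values agree does
  it leave some freedom, inside the eigenspace of the common value. The companion \<open>bottom_rows\<close> is the same condition
  for minimal trace.\<close>

definition top_rows :: "nat \<Rightarrow> nat \<Rightarrow> (nat \<Rightarrow> real) \<Rightarrow> complex mat \<Rightarrow> bool" where
  "top_rows n k h P \<longleftrightarrow>
    (\<forall>i<n. (h k < h i \<longrightarrow> unit_row n P i) \<and> (h i < h (k - 1) \<longrightarrow> zero_row n P i))"

definition bottom_rows :: "nat \<Rightarrow> nat \<Rightarrow> (nat \<Rightarrow> real) \<Rightarrow> complex mat \<Rightarrow> bool" where
  "bottom_rows n k h P \<longleftrightarrow>
    (\<forall>i<n. (h i < h (n - 1 - k) \<longrightarrow> unit_row n P i) \<and> (h (n - k) < h i \<longrightarrow> zero_row n P i))"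

text \<open>A maximizer of the trace against \<open>h\<close> over the unitary orbit of \<open>c\<close> yields, by the gap at \<open>k\<close>, a
  maximizing projection. The diagonal of this projection then consists of ones and zeros outside the
  critical eigenvalue, and the diagonal entry of a projection is the squared norm of the row.\<close>

lemma leading_projection_top_rows:
  assumes X: "X \<in> unitary_mats n" and c: "antimono_on {..<n} c" and h: "antimono_on {..<n} h"
    and k: "0 < k" "k < n" and gap: "c k < c (k - 1)"
    and max: "(\<Sum>i<n. (\<Sum>a<n. (cmod (X $$ (i, a)))\<^sup>2 * c a) * h i) \<ge> (\<Sum>i<n. c i * h i)"
  shows "top_rows n k h (leading_projection n k X)"
proof -
  define P where "P = leading_projection n k X"
  define p where "p i = (\<Sum>a<k. (cmod (X $$ (i, a)))\<^sup>2)" for i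
  have Xc: "X \<in> carrier_mat n n" by (rule unitary_carrier[OF X])
  have S: "doubly_stochastic n (\<lambda>i a. (cmod (X $$ (i, a)))\<^sup>2)" by (rule doubly_stochastic_unitary[OF X])
  have proj: "projection_mat n k P" unfolding P_def by (rule projection_mat_leading[OF X]) (use k in simp)
  have Pii: "P $$ (i, i) = complex_of_real (p i)" if "i < n" for i
  proof -
    have "P $$ (i, i) = (\<Sum>a<n. if a < k then X $$ (i, a) * cnj (X $$ (i, a)) else 0)"
      unfolding P_def leading_projection_def coord_projection_def
      using conj_by_adjoint_diag_entry[OF Xc that that] by (auto intro!: sum.cong)
    also have "\<dots> = (\<Sum>a<k. X $$ (i, a) * cnj (X $$ (i, a)))"
    proof -
      have "{..<n} \<inter> {a. a < k} = {..<k}" using k by auto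
      then show ?thesis by (simp add: sum.If_cases)
    qed
    finally show ?thesis by (simp add: p_def complex_norm_square del: of_real_power)
  qed
  have row: "(\<Sum>j<n. (cmod (P $$ (i, j)))\<^sup>2) = p i" if "i < n" for i
    using projection_mat_row_norm[OF proj that] Pii[OF that] by (metis of_real_eq_iff)
  have p01: "0 \<le> p i \<and> p i \<le> 1" if "i < n" for i
  proof -
    have "p i \<le> (\<Sum>a<n. (cmod (X $$ (i, a)))\<^sup>2)" unfolding p_def using k by (intro sum_mono2) auto
    also have "\<dots> = 1" using S that by (simp add: doubly_stochastic_def)
    finally show ?thesis by (simp add: p_def sum_nonneg)
  qed
  have "(\<Sum>i<n. P $$ (i, i)) = of_nat k"
    using proj by (auto simp: projection_mat_def mat_trace_def)
  then have "complex_of_real (\<Sum>i<n. p i) = complex_of_real (real k)" using Pii by simp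
  then have sum_p: "(\<Sum>i<n. p i) = real k" by (simp only: of_real_eq_iff)
  have ge: "(\<Sum>i<n. p i * h i) \<ge> (\<Sum>i<k. h i)"
    unfolding p_def by (rule doubly_stochastic_gap[OF S c h k gap max])
  note extreme = weighted_sum_eq_top_sum[OF h p01 k sum_p ge]
  have "unit_row n P i" if i: "i < n" and "h k < h i" for i
  proof -
    have pi: "p i = 1" using extreme(1)[OF _ i] that by blast
    have "(\<Sum>j<n. (cmod (P $$ (i, j)))\<^sup>2) = (cmod (P $$ (i, i)))\<^sup>2 + (\<Sum>j\<in>{..<n} - {i}. (cmod (P $$ (i, j)))\<^sup>2)"
      using i by (intro sum.remove) auto
    then have "(\<Sum>j\<in>{..<n} - {i}. (cmod (P $$ (i, j)))\<^sup>2) = 0"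
      using row[OF i] Pii[OF i] pi by simp
    then have "\<forall>j\<in>{..<n} - {i}. (cmod (P $$ (i, j)))\<^sup>2 = 0"
      by (subst (asm) sum_nonneg_eq_0_iff) auto
    then show ?thesis using Pii[OF i] pi by (auto simp: unit_row_def)
  qed
  moreover have "zero_row n P i" if i: "i < n" and "h i < h (k - 1)" for i
  proof -
    have "(\<Sum>j<n. (cmod (P $$ (i, j)))\<^sup>2) = 0" using row[OF i] extreme(2)[OF _ i] that by simp
    then have "\<forall>j\<in>{..<n}. (cmod (P $$ (i, j)))\<^sup>2 = 0"
      by (subst (asm) sum_nonneg_eq_0_iff) auto
    then show ?thesis by (auto simp: zero_row_def)
  qed
  ultimately show ?thesis by (auto simp: top_rows_def P_def)
qed

lemma unit_row_mult:
  assumes P: "P \<in> carrier_mat n n" and Q: "Q \<in> carrier_mat n n" and u: "unit_row n P i" and ij: "i < n" "j < n"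
  shows "(P * Q) $$ (i, j) = Q $$ (i, j)"
proof -
  have "(P * Q) $$ (i, j) = (\<Sum>l<n. P $$ (i, l) * Q $$ (l, j))" by (rule index_mult_mat_sum[OF P Q ij])
  also have "\<dots> = (\<Sum>l<n. if i = l then Q $$ (l, j) else 0)"
    using u by (intro sum.cong) (auto simp: unit_row_def)
  also have "\<dots> = Q $$ (i, j)" using ij by simp
  finally show ?thesis .
qed

lemma zero_row_mult:
  assumes P: "P \<in> carrier_mat n n" and Q: "Q \<in> carrier_mat n n" and u: "zero_row n P i" and ij: "i < n" "j < n"
  shows "(P * Q) $$ (i, j) = 0"
  using u by (simp add: index_mult_mat_sum[OF P Q ij] zero_row_def)

lemma real_diag_mult_entry:
  assumes "A \<in> carrier_mat n n" "i < n" "j < n"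
  shows "(real_diag n h * A) $$ (i, j) = h i * A $$ (i, j)" "(A * real_diag n h) $$ (i, j) = A $$ (i, j) * h j"
  using assms by (simp_all add: mat_diag_mult_left[of A n n] mat_diag_mult_right[of A n n])

lemma top_rows_trichotomy:
  assumes "top_rows n k h P" "antimono_on {..<n} h" "0 < k" "k < n" "i < n"
  obtains "h k < h i" "unit_row n P i" | "h i < h (k - 1)" "zero_row n P i"
    | "h i = h k" "h i = h (k - 1)"
proof -
  have "h k \<le> h (k - 1)" using assms(3,4) by (intro monotone_onD[OF assms(2)]) auto
  then show ?thesis using that assms(1,5) unfolding top_rows_def by (metis antisym not_less order_trans)
qed

lemma top_rows_commute:
  assumes P: "P \<in> carrier_mat n n" "hermitian_mat P" and top: "top_rows n k h P"
    and h: "antimono_on {..<n} h" and k: "0 < k" "k < n"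
  shows "real_diag n h * P = P * real_diag n h"
proof (rule eq_matI)
  fix i j assume "i < dim_row (P * real_diag n h)" "j < dim_col (P * real_diag n h)"
  then have ij: "i < n" "j < n" using P by (auto simp: mat_diag_def)
  have "P $$ (i, j) = 0" if "h i \<noteq> h j"
  proof (rule top_rows_trichotomy[OF top h k ij(1)])
    assume "unit_row n P i" then show ?thesis using that ij by (auto simp: unit_row_def)
  next
    assume "zero_row n P i" then show ?thesis using ij by (auto simp: zero_row_def)
  next
    assume hi: "h i = h k" "h i = h (k - 1)"
    have e: "P $$ (i, j) = cnj (P $$ (j, i))" by (rule hermitian_entry[OF P(2,1) ij])
    show ?thesis
    proof (rule top_rows_trichotomy[OF top h k ij(2)])
      assume "unit_row n P j" then show ?thesis using e that ij by (auto simp: unit_row_def)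
    next
      assume "zero_row n P j" then show ?thesis using e ij by (auto simp: zero_row_def)
    next
      assume "h j = h k" then show ?thesis using hi that by simp
    qed
  qed
  then show "(real_diag n h * P) $$ (i, j) = (P * real_diag n h) $$ (i, j)"
    using real_diag_mult_entry[OF P(1) ij] by (cases "h i = h j") auto
qed (use P in \<open>auto simp: mat_diag_def\<close>)

lemma real_diag_acts_as_scalar:
  assumes A: "A \<in> carrier_mat n n" and "\<And>i j. i < n \<Longrightarrow> j < n \<Longrightarrow> h i = \<mu> \<or> A $$ (i, j) = 0"
  shows "real_diag n h * A = complex_of_real \<mu> \<cdot>\<^sub>m A"
proof (rule eq_matI)
  fix i j assume "i < dim_row (complex_of_real \<mu> \<cdot>\<^sub>m A)" "j < dim_col (complex_of_real \<mu> \<cdot>\<^sub>m A)"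
  then have ij: "i < n" "j < n" using A by auto
  then show "(real_diag n h * A) $$ (i, j) = (complex_of_real \<mu> \<cdot>\<^sub>m A) $$ (i, j)"
    using real_diag_mult_entry(1)[OF A ij] assms(2)[OF ij] A by auto
qed (use A in \<open>auto simp: mat_diag_def\<close>)

text \<open>Two maximizing projections can differ only inside the eigenspace of the critical eigenvalue.\<close>

lemma top_rows_difference:
  assumes P: "P \<in> carrier_mat n n" "Q \<in> carrier_mat n n" and top: "top_rows n k h P" "top_rows n k h Q"
    and h: "antimono_on {..<n} h" and k: "0 < k" "k < n"
  shows "real_diag n h * (P - Q) = complex_of_real (h k) \<cdot>\<^sub>m (P - Q)"
proof (rule real_diag_acts_as_scalar)
  fix i j assume ij: "i < n" "j < n"
  show "h i = h k \<or> (P - Q) $$ (i, j) = 0"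
  proof (rule top_rows_trichotomy[OF top(1) h k ij(1)])
    assume "h k < h i" "unit_row n P i"
    moreover from this have "unit_row n Q i" using top(2) ij by (auto simp: top_rows_def)
    ultimately show ?thesis using ij P by (auto simp: unit_row_def)
  next
    assume "h i < h (k - 1)" "zero_row n P i"
    moreover from this have "zero_row n Q i" using top(2) ij by (auto simp: top_rows_def)
    ultimately show ?thesis using ij P by (auto simp: zero_row_def)
  qed simp
qed (use P in auto)

text \<open>For \<open>2 * k \<le> n\<close> the \<open>k\<close> largest and the \<open>k\<close> smallest eigenvalues can only overlap in the critical one,
  so the product of a maximizing and a minimizing projection lives in a single eigenspace.\<close>

lemma top_bottom_product:
  assumes P: "P \<in> carrier_mat n n" "Q \<in> carrier_mat n n" and top: "top_rows n k h P" and bot: "bottom_rows n k h Q"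
    and h: "antimono_on {..<n} h" and k: "0 < k" "2 * k \<le> n"
  shows "real_diag n h * (P * Q) = complex_of_real (h k) \<cdot>\<^sub>m (P * Q)"
proof (rule real_diag_acts_as_scalar)
  fix i j assume ij: "i < n" "j < n"
  have kn: "k < n" using k by simp
  show "h i = h k \<or> (P * Q) $$ (i, j) = 0"
  proof (rule top_rows_trichotomy[OF top h k(1) kn ij(1)])
    assume "h k < h i" "unit_row n P i"
    moreover have "h (n - k) \<le> h k" using k by (intro monotone_onD[OF h]) auto
    ultimately have "zero_row n Q i" using bot ij by (auto simp: bottom_rows_def)
    then show ?thesis using unit_row_mult[OF P \<open>unit_row n P i\<close> ij] ij by (simp add: zero_row_def)
  next
    assume "zero_row n P i"
    then show ?thesis using zero_row_mult[OF P _ ij] by simp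
  qed simp
qed (use P in auto)

text \<open>The range of such a nonzero projection contains an eigenvector whose eigenvalue belongs both to the \<open>k\<close>
  largest and to the \<open>k\<close> smallest ones. Hence the eigenvalues from the \<open>k\<close>-th largest to the \<open>k\<close>-th
  smallest agree, and any other eigenvalue would make some row both a unit row and a zero row.\<close>

lemma top_and_bottom_imp_constant:
  assumes P: "projection_mat n k P" and top: "top_rows n k h P" and bot: "bottom_rows n k h P"
    and h: "antimono_on {..<n} h" and k: "0 < k" "2 * k \<le> n" and i: "i < n"
  shows "h i = h k"
proof -
  have hm: "h b \<le> h a" if "a \<le> b" "b < n" for a b
    using monotone_onD[OF h, of a b] that by auto
  have "\<exists>r<n. \<not> zero_row n P r"
  proof (rule ccontr)
    assume "\<not> (\<exists>r<n. \<not> zero_row n P r)"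
    then have "mat_trace P = 0" using P by (auto simp: mat_trace_def zero_row_def projection_mat_def)
    with P k show False by (simp add: projection_mat_def)
  qed
  then obtain r where r: "r < n" "\<not> zero_row n P r" by blast
  have "h (k - 1) \<le> h r" "h r \<le> h (n - k)" using r top bot by (auto simp: top_rows_def bottom_rows_def not_less)
  then have le: "h (k - 1) \<le> h (n - k)" by simp
  have eq: "h a = h k" if "k - 1 \<le> a" "a \<le> n - k" for a
  proof -
    have "h a \<le> h (k - 1)" "h (n - k) \<le> h a" "h k \<le> h (k - 1)" "h (n - k) \<le> h k"
      using that k by (auto intro!: hm)
    then show ?thesis using le by simp
  qed
  have not_both: "\<not> (unit_row n P i \<and> zero_row n P i)"
  proof
    assume a: "unit_row n P i \<and> zero_row n P i"
    show False
      using a[THEN conjunct1, unfolded unit_row_def, rule_format, OF i]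
        a[THEN conjunct2, unfolded zero_row_def, rule_format, OF i] by simp
  qed
  have e: "h (k - 1) = h k" "h (n - k) = h k" "h (n - 1 - k) = h k" using k by (auto intro!: eq)
  show ?thesis
    using top bot i not_both e unfolding top_rows_def bottom_rows_def by (metis linorder_neqE_linordered_idom)
qed


text \<open>On the range of \<open>R\<close>, which \<open>K\<close> respects, the matrix \<open>A\<close> is a scalar and commutes with everything.\<close>

lemma commutator_annihilates:
  fixes A K R :: "complex mat"
  assumes c: "A \<in> carrier_mat n n" "K \<in> carrier_mat n n" "R \<in> carrier_mat n n"
    and AR: "A * R = \<mu> \<cdot>\<^sub>m R" and KR: "K * R = R * K"
  shows "(A * K - K * A) * R = 0\<^sub>m n n"
proof -
  have "(A * K) * R = A * (R * K)" using c KR by (simp add: assoc_sq[where n = n])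
  also have "\<dots> = (A * R) * K" using c by (simp add: assoc_sq[where n = n])
  also have "\<dots> = \<mu> \<cdot>\<^sub>m (R * K)" using c AR by (simp add: mult_smult_assoc_mat[of R n n K n])
  finally have 1: "(A * K) * R = \<mu> \<cdot>\<^sub>m (R * K)" .
  have "(K * A) * R = K * (A * R)" using c by (simp add: assoc_sq[where n = n])
  also have "\<dots> = \<mu> \<cdot>\<^sub>m (R * K)" using c AR KR by (simp add: mult_smult_distrib[of _ n n _ n])
  finally have 2: "(K * A) * R = \<mu> \<cdot>\<^sub>m (R * K)" .
  have "(A * K - K * A) * R = (A * K) * R - (K * A) * R"
    using c by (intro minus_mult_distrib_mat) auto
  also have "\<dots> = 0\<^sub>m n n" unfolding 1 2 using c by (intro eq_matI) auto
  finally show ?thesis .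
qed

lemma unit_row_annihilated_column:
  assumes Z: "Z \<in> carrier_mat n n" and P: "P \<in> carrier_mat n n" "hermitian_mat P"
    and ZP: "Z * P = 0\<^sub>m n n" and u: "unit_row n P i" and ij: "i < n" "j < n"
  shows "Z $$ (j, i) = 0"
proof -
  have "0 = (\<Sum>l<n. Z $$ (j, l) * P $$ (l, i))"
    using index_mult_mat_sum[OF Z P(1) ij(2,1)] ZP ij by simp
  also have "\<dots> = (\<Sum>l<n. if l = i then Z $$ (j, l) else 0)"
  proof (intro sum.cong refl)
    fix l assume "l \<in> {..<n}"
    then have l: "l < n" by simp
    have "P $$ (l, i) = cnj (P $$ (i, l))" by (rule hermitian_entry[OF P(2,1) l ij(1)])
    also have "P $$ (i, l) = (if i = l then 1 else 0)" using u l by (simp add: unit_row_def)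
    finally show "Z $$ (j, l) * P $$ (l, i) = (if l = i then Z $$ (j, l) else 0)" by auto
  qed
  also have "\<dots> = Z $$ (j, i)" using ij by simp
  finally show ?thesis by simp
qed

text \<open>The entries of the commutator are \<open>(h i - h j) * K $$ (i, j)\<close>, so they vanish inside an eigenspace of
  the diagonal matrix; by symmetry rows vanish together with columns.\<close>

lemma diag_commutator_zero:
  assumes K: "K \<in> carrier_mat n n" "hermitian_mat K" and Z: "Z = real_diag n h * K - K * real_diag n h"
    and col: "\<And>i j. i < n \<Longrightarrow> j < n \<Longrightarrow> h i = \<mu> \<or> Z $$ (j, i) = 0"
  shows "Z = 0\<^sub>m n n"
proof (rule eq_matI)
  fix i j assume "i < dim_row (0\<^sub>m n n :: complex mat)" "j < dim_col (0\<^sub>m n n :: complex mat)"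
  then have ij: "i < n" "j < n" by auto
  have entry: "Z $$ (a, b) = (h a - h b) * K $$ (a, b)" if "a < n" "b < n" for a b
    unfolding Z using real_diag_mult_entry[OF K(1) that] K(1) that
    by (simp add: algebra_simps del: index_mult_mat(1))
  have "K $$ (j, i) = cnj (K $$ (i, j))" by (rule hermitian_entry[OF K(2,1) ij(2,1)])
  then have "Z $$ (j, i) = 0 \<Longrightarrow> Z $$ (i, j) = 0" using entry ij by auto
  then show "Z $$ (i, j) = 0\<^sub>m n n $$ (i, j)"
    using col[OF ij] col[OF ij(2,1)] entry[OF ij] ij by auto
qed (use K Z in \<open>auto simp: mat_diag_def\<close>)

lemma projections_equal_if_full_overlap:
  assumes P: "projection_mat n k P" and Q: "projection_mat n k Q" and tr: "mat_trace (P * Q) = of_nat k"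
  shows "P = Q"
proof -
  have c: "P \<in> carrier_mat n n" "Q \<in> carrier_mat n n" using P Q by (auto simp: projection_mat_def)
  have PP: "P * P = P" "Q * Q = Q" using P Q by (auto simp: projection_mat_def)
  have herm: "hermitian_mat (P - Q)"
    using P Q c by (simp add: projection_mat_def hermitian_mat_def mat_adjoint_minus[of _ n n])
  have "mat_trace ((P - Q) * (P - Q)) = mat_trace ((P - P * Q) - (Q * P - Q))"
    unfolding diff_mult_diff[OF c c] PP ..
  also have "\<dots> = mat_trace P - mat_trace (P * Q) - (mat_trace (Q * P) - mat_trace Q)"
    using c by (auto simp: mat_trace_def sum_subtractf simp del: index_mult_mat(1))
  also have "\<dots> = 0" using P Q tr mat_trace_commute[OF c(2,1)] by (simp add: projection_mat_def)
  finally have "P - Q = 0\<^sub>m n n"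
    using hermitian_trace_square_zero[OF _ herm] c by simp
  then show ?thesis by (simp only: minus_mat_eq_zero_iff[OF c])
qed

lemma distinct_top_rows_imp_equal_values:
  assumes P: "P \<in> carrier_mat n n" "Q \<in> carrier_mat n n" and top: "top_rows n k h P" "top_rows n k h Q"
    and h: "antimono_on {..<n} h" and k: "0 < k" "k < n" and ne: "P \<noteq> Q"
  shows "h (k - 1) = h k"
proof (rule ccontr)
  assume neq: "h (k - 1) \<noteq> h k"
  have "P $$ (i, j) = Q $$ (i, j)" if ij: "i < n" "j < n" for i j
  proof (rule top_rows_trichotomy[OF top(1) h k ij(1)])
    assume "h k < h i" "unit_row n P i"
    moreover from this have "unit_row n Q i" using top(2) ij by (auto simp: top_rows_def)
    ultimately show ?thesis using ij by (auto simp: unit_row_def)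
  next
    assume "h i < h (k - 1)" "zero_row n P i"
    moreover from this have "zero_row n Q i" using top(2) ij by (auto simp: top_rows_def)
    ultimately show ?thesis using ij by (auto simp: zero_row_def)
  qed (use neq in simp)
  then have "P = Q" using P by (intro eq_matI) auto
  with ne show False by simp
qed

text \<open>This is where the centrality of \<open>k\<close> enters. Since \<open>P1\<close> and \<open>P2\<close> differ, the values next to the gap
  agree: \<open>h (k - 1) = h k\<close>. The commutator \<open>Z\<close> vanishes on the ranges of the three projections, that is, on
  all eigenvectors above \<open>h k\<close> and on all those below \<open>h (n - 1 - k)\<close>. If \<open>n \<le> 2 * k + 1\<close>, only the
  eigenvalue \<open>h k\<close> is left. If \<open>n = 2 * k + 2\<close>, there may be one more, \<open>h (k + 1)\<close>. Then the eigenvectors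
  from \<open>h k\<close> upwards span a space of dimension \<open>k + 1\<close>, which is the sum of the ranges of \<open>P1\<close> and \<open>P2\<close>;
  so \<open>Z\<close> vanishes on this space as well, and again only one eigenvalue is left.\<close>

lemma commutator_zero_of_edge:
  assumes K: "K \<in> carrier_mat n n" "hermitian_mat K" and Z_def: "Z = real_diag n h * K - K * real_diag n h"
    and h: "antimono_on {..<n} h" and k: "0 < k" "2 * k \<le> n" "n \<le> 2 * k + 2"
    and proj: "projection_mat n k P1" "projection_mat n k P2" "projection_mat n k Q"
    and top: "top_rows n k h P1" "top_rows n k h P2" and bot: "bottom_rows n k h Q"
    and Z: "Z * P1 = 0\<^sub>m n n" "Z * P2 = 0\<^sub>m n n" "Z * Q = 0\<^sub>m n n"
    and ne: "P1 \<noteq> P2"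
  shows "Z = 0\<^sub>m n n"
proof -
  have c [simp]: "P1 \<in> carrier_mat n n" "P2 \<in> carrier_mat n n" "Q \<in> carrier_mat n n" "Z \<in> carrier_mat n n"
    using proj K by (auto simp: projection_mat_def Z_def)
  have herm: "hermitian_mat P1" "hermitian_mat P2" "hermitian_mat Q"
    using proj by (auto simp: projection_mat_def)
  have kn: "k < n" using k by simp
  have hm: "h b \<le> h a" if "a \<le> b" "b < n" for a b
    using monotone_onD[OF h, of a b] that by auto
  have eq: "h (k - 1) = h k"
    by (rule distinct_top_rows_imp_equal_values[OF c(1,2) top h k(1) kn ne])
  have colP: "Z $$ (j, i) = 0" if "h k < h i" "i < n" "j < n" for i j
    using unit_row_annihilated_column[OF c(4,1) herm(1) Z(1) _ that(2,3)] top(1) that by (simp add: top_rows_def)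
  have colQ: "Z $$ (j, i) = 0" if "h i < h (n - 1 - k)" "i < n" "j < n" for i j
    using unit_row_annihilated_column[OF c(4,3) herm(3) Z(3) _ that(2,3)] bot that by (simp add: bottom_rows_def)
  show ?thesis
  proof (cases "h k \<le> h (n - 1 - k)")
    case True
    show ?thesis
    proof (rule diag_commutator_zero[OF K Z_def])
      fix i j assume ij: "i < n" "j < n"
      show "h i = h k \<or> Z $$ (j, i) = 0"
        using colP[of i j] colQ[of i j] ij True by (cases "h i" "h k" rule: linorder_cases) auto
    qed
  next
    case False
    have "\<not> n - 1 - k \<le> k" using False hm[of "n - 1 - k" k] kn by auto
    then have nk: "n - 1 - k = k + 1" "k + 1 < n" using k by auto
    have lt: "h (k + 1) < h k" using False nk by simp
    define E where "E = coord_projection n (k + 1)"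
    have E: "projection_mat n (k + 1) E" unfolding E_def by (rule projection_mat_coord) (use nk in simp)
    have Ec [simp]: "E \<in> carrier_mat n n" using E by (simp add: projection_mat_def)
    have EP: "E * P = P \<and> P * E = P" if P: "projection_mat n k P" "top_rows n k h P" for P
    proof -
      have Pc [simp]: "P \<in> carrier_mat n n" and Ph: "mat_adjoint P = P"
        using P by (auto simp: projection_mat_def hermitian_mat_def)
      have "E * P = P"
      proof (rule eq_matI)
        fix i j assume "i < dim_row P" "j < dim_col P"
        then have ij: "i < n" "j < n" using Pc by auto
        have "(E * P) $$ (i, j) = (if i < k + 1 then P $$ (i, j) else 0)"
          using ij unfolding E_def coord_projection_def by (simp add: mat_diag_mult_left[OF Pc])
        moreover have "P $$ (i, j) = 0" if "\<not> i < k + 1"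
        proof -
          have "h i \<le> h (k + 1)" using that ij by (intro hm) auto
          then have "zero_row n P i" using lt eq P(2) ij by (simp add: top_rows_def)
          then show ?thesis using ij by (simp add: zero_row_def)
        qed
        ultimately show "(E * P) $$ (i, j) = P $$ (i, j)" by auto
      qed (use Pc Ec in \<open>simp_all only: carrier_matD index_mult_mat\<close>)
      moreover have "P * E = mat_adjoint (E * P)"
        using E Ph by (simp add: mat_adjoint_mult[of E n n P n] projection_mat_def hermitian_mat_def)
      ultimately show ?thesis using Ph by simp
    qed
    note EP1 = EP[OF proj(1) top(1)] and EP2 = EP[OF proj(2) top(2)]
    \<comment> \<open>The projection onto the orthogonal complement of the range of \<open>P1\<close> in the \<open>(k + 1)\<close>-dimensional space; it has rank one.\<close>
    define T where "T = E - P1"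
    have Tc [simp]: "T \<in> carrier_mat n n" by (simp add: T_def minus_carrier_mat)
    have T: "projection_mat n 1 T"
    proof -
      have "T * T = (E - P1) - (P1 - P1)"
        unfolding T_def diff_mult_diff[OF Ec c(1) Ec c(1)] using EP1 E proj(1) by (simp add: projection_mat_def)
      also have "(E - P1) - (P1 - P1) = T"
        unfolding T_def by (intro eq_matI) (auto simp: carrier_matD[OF c(1)] carrier_matD[OF Ec])
      finally have "T * T = T" .
      moreover have "hermitian_mat T"
        using E herm(1) by (simp add: T_def hermitian_mat_def mat_adjoint_minus[of _ n n] projection_mat_def)
      moreover have "mat_trace T = mat_trace E - mat_trace P1"
        by (simp add: T_def mat_trace_def sum_subtractf carrier_matD[OF c(1)] carrier_matD[OF Ec])
      ultimately show ?thesis using E proj(1) by (simp add: projection_mat_def)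
    qed
    have "P2 * T = P2 - P2 * P1"
      unfolding T_def using EP2 by (simp add: mult_minus_distrib_mat[of _ n n _ n])
    then have "mat_trace (P2 * T) = mat_trace P2 - mat_trace (P2 * P1)"
      by (simp add: mat_trace_def sum_subtractf carrier_matD[OF c(1)] carrier_matD[OF c(2)] del: index_mult_mat(1))
    then have tau: "mat_trace (P2 * T) \<noteq> 0"
      using projections_equal_if_full_overlap[OF proj(2,1)] ne proj(2) by (auto simp: projection_mat_def)
    \<comment> \<open>The product \<open>T * P2 * T\<close> is a nonzero multiple of \<open>T\<close>, but \<open>Z\<close> kills it.\<close>
    have "T * P2 = P2 - P1 * P2"
      unfolding T_def using EP2 by (simp add: minus_mult_distrib_mat[of _ n n _ _ n])
    then have "Z * (T * P2) = Z * P2 - (Z * P1) * P2"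
      by (simp add: mult_minus_distrib_mat[of _ n n _ n] assoc_sq[where n = n])
    then have ZTP: "Z * (T * P2) = 0\<^sub>m n n" using Z by (intro eq_matI) (simp_all add: Z)
    have "mat_trace (P2 * T) \<cdot>\<^sub>m (Z * T) = Z * (T * P2 * T)"
      unfolding projection_trace_one_sandwich[OF T c(2)] by (simp add: mult_smult_distrib[of _ n n _ n])
    also have "\<dots> = (Z * (T * P2)) * T" by (simp add: assoc_sq[where n = n])
    also have "\<dots> = 0\<^sub>m n n" unfolding ZTP by simp
    finally have "mat_trace (P2 * T) \<cdot>\<^sub>m (Z * T) = 0\<^sub>m n n" .
    then have "Z * T = 0\<^sub>m n n" using smult_mat_eq_zero_iff[OF mult_carrier_sq[OF c(4) Tc] tau] by blast
    moreover have "Z * T = Z * E - Z * P1" by (simp add: T_def mult_minus_distrib_mat[of _ n n _ n])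
    ultimately have ZE: "Z * E = 0\<^sub>m n n"
      using minus_mat_eq_zero_iff[OF mult_carrier_sq[OF c(4) Ec] mult_carrier_sq[OF c(4) c(1)]] Z(1) by simp
    have Eh: "hermitian_mat E" using E by (simp add: projection_mat_def)
    have colE: "Z $$ (j, i) = 0" if "i < k + 1" "i < n" "j < n" for i j
    proof (rule unit_row_annihilated_column[OF c(4) Ec Eh ZE _ that(2,3)])
      show "unit_row n E i" using that by (auto simp: unit_row_def E_def coord_projection_def mat_diag_def)
    qed
    show ?thesis
    proof (rule diag_commutator_zero[OF K Z_def])
      fix i j assume ij: "i < n" "j < n"
      show "h i = h (k + 1) \<or> Z $$ (j, i) = 0"
      proof (cases "i < k + 1")
        case False
        then have "h i \<le> h (k + 1)" using ij by (intro hm) auto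
        then show ?thesis using colQ[of i j] ij nk by (cases "h i < h (k + 1)") auto
      qed (use colE ij in blast)
    qed
  qed
qed

section \<open>Normal cones of a polygon\<close>

lemma finite_closed_cover_constant:
  fixes A :: "'i \<Rightarrow> 'a::topological_space set"
  assumes S: "connected S" and I: "finite I" "\<And>i. i \<in> I \<Longrightarrow> closed (A i)" and cover: "S \<subseteq> (\<Union>i\<in>I. A i)"
    and agree: "\<And>x i j. x \<in> S \<Longrightarrow> i \<in> I \<Longrightarrow> j \<in> I \<Longrightarrow> x \<in> A i \<Longrightarrow> x \<in> A j \<Longrightarrow> f i = f j"
    and x: "i \<in> I" "x \<in> S" "x \<in> A i" and y: "j \<in> I" "y \<in> S" "y \<in> A j"
  shows "f i = f j"
proof -
  define F where "F z = f (SOME i. i \<in> I \<and> z \<in> A i)" for z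
  have F: "F z = f i" if "z \<in> S" "i \<in> I" "z \<in> A i" for z i
  proof -
    have "(SOME i. i \<in> I \<and> z \<in> A i) \<in> I \<and> z \<in> A (SOME i. i \<in> I \<and> z \<in> A i)"
      using that by (intro someI[of "\<lambda>i. i \<in> I \<and> z \<in> A i" i]) auto
    then show ?thesis unfolding F_def using agree[OF that(1)] that by blast
  qed
  have "F constant_on S"
  proof (rule locally_constant_imp_constant[OF S])
    fix a assume a: "a \<in> S"
    define T where "T = S \<inter> - (\<Union>i\<in>{i \<in> I. a \<notin> A i}. A i)"
    have "closed (\<Union>i\<in>{i \<in> I. a \<notin> A i}. A i)" using I by (intro closed_UN) auto
    then have "openin (top_of_set S) T" unfolding T_def by (intro openin_open_Int open_Compl)
    moreover have "a \<in> T" using a by (auto simp: T_def)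
    moreover have "F z = F a" if "z \<in> T" for z
    proof -
      have z: "z \<in> S" using that by (simp add: T_def)
      then obtain i where i: "i \<in> I" "z \<in> A i" using cover by blast
      then have "a \<in> A i" using that by (auto simp: T_def)
      then show ?thesis using F[OF z i] F[OF a i(1)] by simp
    qed
    ultimately show "\<exists>T. openin (top_of_set S) T \<and> a \<in> T \<and> (\<forall>x\<in>T. F x = F a)" by blast
  qed
  then have "F x = F y" using x y by (auto simp: constant_on_def)
  then show ?thesis using F[OF x(2,1,3)] F[OF y(2,1,3)] by simp
qed

definition normal_cone :: "complex set \<Rightarrow> complex \<Rightarrow> complex set" where
  "normal_cone V v = {d. \<forall>w\<in>V. d \<bullet> w \<le> d \<bullet> v}"

lemma closed_normal_cone: "closed (normal_cone V v)"
proof -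
  have "normal_cone V v = (\<Inter>w\<in>V. {d. (w - v) \<bullet> d \<le> 0})"
    by (auto simp: normal_cone_def inner_diff_left inner_diff_right inner_commute)
  then show ?thesis by (auto intro!: closed_INT closed_halfspace_le)
qed

text \<open>The cones with two independent directions are those with nonempty interior.\<close>

definition full_normal_cone :: "complex set \<Rightarrow> complex \<Rightarrow> bool" where
  "full_normal_cone V v \<longleftrightarrow>
    (\<exists>d\<in>normal_cone V v. \<exists>e\<in>normal_cone V v. Re d * Im e - Im d * Re e \<noteq> 0)"

text \<open>Turn the direction \<open>d\<close> slightly. Infinitely many of the turned directions belong to the cone of the same
  vertex; two of them are independent, and \<open>d\<close> is their limit.\<close>

lemma full_normal_cones_cover:
  assumes V: "finite V" "V \<noteq> {}" and d: "d \<noteq> 0"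
  shows "\<exists>v\<in>V. d \<in> normal_cone V v \<and> full_normal_cone V v"
proof -
  define e where "e m = d + (1 / real (Suc m)) *\<^sub>R (\<i> * d)" for m
  have ex: "\<exists>v\<in>V. e m \<in> normal_cone V v" for m
  proof -
    have "Max ((\<lambda>w. e m \<bullet> w) ` V) \<in> (\<lambda>w. e m \<bullet> w) ` V" using V by (intro Max_in) auto
    then obtain v where "v \<in> V" "e m \<bullet> v = Max ((\<lambda>w. e m \<bullet> w) ` V)" by auto
    then show ?thesis using V by (intro bexI[of _ v]) (auto simp: normal_cone_def)
  qed
  obtain v where v: "v \<in> V" and inf: "infinite {m. e m \<in> normal_cone V v}"
    using pigeonhole_infinite_rel[of "UNIV :: nat set" V "\<lambda>m v. e m \<in> normal_cone V v"] V ex by auto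
  have "d \<bullet> w \<le> d \<bullet> v" if w: "w \<in> V" for w
  proof (rule ccontr)
    assume "\<not> d \<bullet> w \<le> d \<bullet> v"
    then have pos: "d \<bullet> (w - v) > 0" by (simp add: inner_diff_right)
    define b where "b = \<bar>(\<i> * d) \<bullet> (w - v)\<bar>"
    obtain N where N: "b / (d \<bullet> (w - v)) < real N" using reals_Archimedean2 by blast
    have "m < N" if "e m \<in> normal_cone V v" for m
    proof (rule ccontr)
      assume "\<not> m < N"
      then have "b / (d \<bullet> (w - v)) < real (Suc m)" using N by simp
      then have "b / real (Suc m) < d \<bullet> (w - v)" using pos by (simp add: field_simps)
      moreover have "e m \<bullet> (w - v) = d \<bullet> (w - v) + ((\<i> * d) \<bullet> (w - v)) / real (Suc m)"
        by (simp add: e_def inner_add_left)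
      moreover have "- (b / real (Suc m)) \<le> ((\<i> * d) \<bullet> (w - v)) / real (Suc m)"
        unfolding b_def minus_divide_left by (intro divide_right_mono) auto
      moreover have "e m \<bullet> (w - v) \<le> 0" using that w by (simp add: normal_cone_def inner_diff_right)
      ultimately show False by linarith
    qed
    then have "{m. e m \<in> normal_cone V v} \<subseteq> {..<N}" by auto
    then show False using inf finite_subset by blast
  qed
  then have "d \<in> normal_cone V v" by (simp add: normal_cone_def)
  moreover have "full_normal_cone V v"
  proof -
    obtain m1 where m1: "e m1 \<in> normal_cone V v" using inf by (metis empty_Collect_eq finite.emptyI)
    have "{m. e m \<in> normal_cone V v} - {m1} \<noteq> {}"
      using infinite_remove[OF inf, of m1] by (metis finite.emptyI)
    then obtain m2 where m2: "e m2 \<in> normal_cone V v" "m2 \<noteq> m1" by blast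
    have "Re (e m1) * Im (e m2) - Im (e m1) * Re (e m2) = (cmod d)\<^sup>2 * (1 / real (Suc m2) - 1 / real (Suc m1))"
      unfolding e_def cmod_power2 by (simp add: power2_eq_square algebra_simps)
    also have "\<dots> \<noteq> 0" using d m2(2) by simp
    finally show ?thesis unfolding full_normal_cone_def using m1 m2(1) by blast
  qed
  ultimately show ?thesis using v by blast
qed

section \<open>Directions and reversal\<close>

lemma conj_by_entry:
  assumes "U \<in> carrier_mat n n" "A \<in> carrier_mat n n" "i < n" "j < n"
  shows "conj_by U A $$ (i, j) = (\<Sum>l<n. \<Sum>m<n. cnj (U $$ (l, i)) * A $$ (l, m) * U $$ (m, j))"
proof -
  have "conj_by U A = mat_adjoint U * (A * U)" using assms by (simp add: conj_by_def assoc_sq[where n = n])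
  also have "\<dots> $$ (i, j) = (\<Sum>l<n. mat_adjoint U $$ (i, l) * (A * U) $$ (l, j))"
    using assms by (intro index_mult_mat_sum) auto
  also have "\<dots> = (\<Sum>l<n. cnj (U $$ (l, i)) * (\<Sum>m<n. A $$ (l, m) * U $$ (m, j)))"
    using assms by (intro sum.cong) (auto simp: index_mult_mat_sum[of _ n n _ n] simp del: index_mult_mat(1))
  finally show ?thesis by (simp add: sum_distrib_left mult.assoc)
qed

text \<open>Reversing the order of an orthonormal basis turns the decreasing eigenvalues of a matrix into those
  of its negative.\<close>

definition reverse_cols :: "nat \<Rightarrow> complex mat \<Rightarrow> complex mat" where
  "reverse_cols n U = mat n n (\<lambda>(i, j). U $$ (i, n - 1 - j))"

lemma conj_by_reverse_cols:
  assumes "U \<in> carrier_mat n n" "A \<in> carrier_mat n n" "i < n" "j < n"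
  shows "conj_by (reverse_cols n U) A $$ (i, j) = conj_by U A $$ (n - 1 - i, n - 1 - j)"
proof -
  have c: "reverse_cols n U \<in> carrier_mat n n" by (simp add: reverse_cols_def)
  have "conj_by (reverse_cols n U) A $$ (i, j) =
      (\<Sum>l<n. \<Sum>m<n. cnj (U $$ (l, n - 1 - i)) * A $$ (l, m) * U $$ (m, n - 1 - j))"
    unfolding conj_by_entry[OF c assms(2-4)] using assms(3,4)
    by (intro sum.cong refl) (simp add: reverse_cols_def)
  also have "\<dots> = conj_by U A $$ (n - 1 - i, n - 1 - j)"
    using assms by (intro conj_by_entry[symmetric]) auto
  finally show ?thesis .
qed

lemma unitary_reverse_cols:
  assumes U: "U \<in> unitary_mats n"
  shows "reverse_cols n U \<in> unitary_mats n"
proof (rule unitary_matsI)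
  show c: "reverse_cols n U \<in> carrier_mat n n" by (simp add: reverse_cols_def)
  have Uc: "U \<in> carrier_mat n n" by (rule unitary_carrier[OF U])
  have one: "mat_adjoint X * X = conj_by X (1\<^sub>m n)" if "X \<in> carrier_mat n n" for X
    using that by (simp add: conj_by_def)
  have "conj_by (reverse_cols n U) (1\<^sub>m n) = 1\<^sub>m n"
  proof (rule eq_matI)
    fix i j assume "i < dim_row (1\<^sub>m n :: complex mat)" "j < dim_col (1\<^sub>m n :: complex mat)"
    then have ij: "i < n" "j < n" by auto
    have "conj_by U (1\<^sub>m n) = 1\<^sub>m n" using U one[OF Uc] by (simp add: unitary_mats_def)
    then show "conj_by (reverse_cols n U) (1\<^sub>m n) $$ (i, j) = 1\<^sub>m n $$ (i, j)"
      unfolding conj_by_reverse_cols[OF Uc one_carrier_mat ij] using ij by auto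
  qed (use carrier_conj_by[OF c, of "1\<^sub>m n"] in auto)
  then show "mat_adjoint (reverse_cols n U) * reverse_cols n U = 1\<^sub>m n" by (simp add: one[OF c])
qed

text \<open>Planar directions are complex numbers, and the support function of the planar joint range in
  direction \<open>d\<close> is governed by the Hermitian matrix \<open>Re d H + Im d K\<close>.\<close>

definition direction_mat :: "complex mat \<Rightarrow> complex mat \<Rightarrow> complex \<Rightarrow> complex mat" where
  "direction_mat H K d = complex_of_real (Re d) \<cdot>\<^sub>m H + complex_of_real (Im d) \<cdot>\<^sub>m K"

lemma carrier_direction_mat [simp]:
  "H \<in> carrier_mat n n \<Longrightarrow> K \<in> carrier_mat n n \<Longrightarrow> direction_mat H K d \<in> carrier_mat n n"
  by (simp add: direction_mat_def)

lemma hermitian_direction_mat: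
  assumes "H \<in> carrier_mat n n" "K \<in> carrier_mat n n" "hermitian_mat H" "hermitian_mat K"
  shows "hermitian_mat (direction_mat H K d)"
  using assms by (simp add: hermitian_mat_def direction_mat_def mat_adjoint_add[of _ n n] mat_adjoint_smult)

lemma lincomb_mult:
  fixes A B C D :: "complex mat"
  assumes c: "A \<in> carrier_mat n n" "B \<in> carrier_mat n n" "C \<in> carrier_mat n n" "D \<in> carrier_mat n n"
  shows "(a \<cdot>\<^sub>m A + b \<cdot>\<^sub>m B) * (c \<cdot>\<^sub>m C + d \<cdot>\<^sub>m D) =
    (a * c) \<cdot>\<^sub>m (A * C) + (a * d) \<cdot>\<^sub>m (A * D) + (b * c) \<cdot>\<^sub>m (B * C) + (b * d) \<cdot>\<^sub>m (B * D)"
proof (rule eq_matI)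
  let ?R = "(a * c) \<cdot>\<^sub>m (A * C) + (a * d) \<cdot>\<^sub>m (A * D) + (b * c) \<cdot>\<^sub>m (B * C) + (b * d) \<cdot>\<^sub>m (B * D)"
  fix i j assume "i < dim_row ?R" "j < dim_col ?R"
  then have ij: "i < n" "j < n" using c by auto
  have "((a \<cdot>\<^sub>m A + b \<cdot>\<^sub>m B) * (c \<cdot>\<^sub>m C + d \<cdot>\<^sub>m D)) $$ (i, j) =
      (\<Sum>l<n. (a \<cdot>\<^sub>m A + b \<cdot>\<^sub>m B) $$ (i, l) * (c \<cdot>\<^sub>m C + d \<cdot>\<^sub>m D) $$ (l, j))"
    using c ij by (intro index_mult_mat_sum) auto
  also have "\<dots> = (\<Sum>l<n. (a * c) * (A $$ (i, l) * C $$ (l, j)) + (a * d) * (A $$ (i, l) * D $$ (l, j))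
      + (b * c) * (B $$ (i, l) * C $$ (l, j)) + (b * d) * (B $$ (i, l) * D $$ (l, j)))"
    using c ij by (intro sum.cong) (auto simp: algebra_simps)
  also have "\<dots> = (a * c) * (A * C) $$ (i, j) + (a * d) * (A * D) $$ (i, j)
      + (b * c) * (B * C) $$ (i, j) + (b * d) * (B * D) $$ (i, j)"
    using c ij by (simp add: sum.distrib sum_distrib_left index_mult_mat_sum[of _ n n _ n] del: index_mult_mat(1))
  also have "\<dots> = ?R $$ (i, j)" using c ij by (simp del: index_mult_mat(1))
  finally show "((a \<cdot>\<^sub>m A + b \<cdot>\<^sub>m B) * (c \<cdot>\<^sub>m C + d \<cdot>\<^sub>m D)) $$ (i, j) = ?R $$ (i, j)" .
qed (use c in auto)

text \<open>The direction \<open>\<i> * d\<close> is orthogonal to \<open>d\<close> and has the same length, so the change of coordinates from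
  \<open>(H, K)\<close> has determinant \<open>(cmod d)\<^sup>2\<close>.\<close>

lemma direction_commutator:
  assumes c: "H \<in> carrier_mat n n" "K \<in> carrier_mat n n"
  shows "direction_mat H K d * direction_mat H K (\<i> * d) - direction_mat H K (\<i> * d) * direction_mat H K d =
    complex_of_real ((cmod d)\<^sup>2) \<cdot>\<^sub>m (H * K - K * H)"
  unfolding direction_mat_def lincomb_mult[OF c c] cmod_power2
  by (rule eq_matI) (use c in \<open>auto simp: algebra_simps power2_eq_square simp del: index_mult_mat(1)\<close>)

lemma commute_lincomb:
  fixes P A B :: "complex mat"
  assumes c: "P \<in> carrier_mat n n" "A \<in> carrier_mat n n" "B \<in> carrier_mat n n"
    and comm: "P * A = A * P" "P * B = B * P"
  shows "P * (a \<cdot>\<^sub>m A + b \<cdot>\<^sub>m B) = (a \<cdot>\<^sub>m A + b \<cdot>\<^sub>m B) * P"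
  using c comm
  by (simp add: mult_add_distrib_mat[of _ n n _ n] add_mult_distrib_mat[of _ n n _ _ n]
      mult_smult_distrib[of _ n n _ n] mult_smult_assoc_mat[of _ n n _ n])

lemma commute_with_two_directions:
  assumes c: "P \<in> carrier_mat n n" "H \<in> carrier_mat n n" "K \<in> carrier_mat n n"
    and comm: "P * direction_mat H K d = direction_mat H K d * P" "P * direction_mat H K e = direction_mat H K e * P"
    and indep: "Re d * Im e - Im d * Re e \<noteq> 0"
  shows "P * H = H * P" "P * K = K * P"
proof -
  define \<delta> where "\<delta> = complex_of_real (Re d * Im e - Im d * Re e)"
  have \<delta>: "\<delta> \<noteq> 0" using indep unfolding \<delta>_def by (metis of_real_eq_0_iff)
  have \<delta>': "\<delta> = complex_of_real (Re d) * complex_of_real (Im e) - complex_of_real (Im d) * complex_of_real (Re e)"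
    by (simp add: \<delta>_def)
  have "(Im e / \<delta>) \<cdot>\<^sub>m direction_mat H K d + (- Im d / \<delta>) \<cdot>\<^sub>m direction_mat H K e = H"
    by (rule eq_matI) (use c \<delta> in \<open>auto simp: direction_mat_def field_simps\<close>, simp add: \<delta>' algebra_simps)
  then show "P * H = H * P"
    using commute_lincomb[OF c(1) _ _ comm, of "Im e / \<delta>" "- Im d / \<delta>"] c by simp
  have "(- Re e / \<delta>) \<cdot>\<^sub>m direction_mat H K d + (Re d / \<delta>) \<cdot>\<^sub>m direction_mat H K e = K"
    by (rule eq_matI) (use c \<delta> in \<open>auto simp: direction_mat_def field_simps\<close>, simp add: \<delta>' algebra_simps)
  then show "P * K = K * P"
    using commute_lincomb[OF c(1) _ _ comm, of "- Re e / \<delta>" "Re d / \<delta>"] c by simp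
qed


section \<open>Polygonal joint ranges force commutation\<close>

definition trace_point :: "nat \<Rightarrow> (nat \<Rightarrow> real) \<Rightarrow> complex mat \<Rightarrow> complex mat \<Rightarrow> complex mat \<Rightarrow> complex" where
  "trace_point n c H K U = Complex (Re (mat_trace (real_diag n c * conj_by U H)))
    (Re (mat_trace (real_diag n c * conj_by U K)))"

lemma inner_trace_point:
  assumes "H \<in> carrier_mat n n" "K \<in> carrier_mat n n" "U \<in> carrier_mat n n"
  shows "d \<bullet> trace_point n c H K U = Re (mat_trace (real_diag n c * conj_by U (direction_mat H K d)))"
proof -
  have "real_diag n c * conj_by U (direction_mat H K d) =
      complex_of_real (Re d) \<cdot>\<^sub>m (real_diag n c * conj_by U H) + complex_of_real (Im d) \<cdot>\<^sub>m (real_diag n c * conj_by U K)"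
    using assms by (simp add: direction_mat_def conj_by_add[of _ n] conj_by_smult[of _ n]
        mult_add_distrib_mat[of _ n n _ n] mult_smult_distrib[of _ n n _ n])
  then show ?thesis
    using assms by (simp add: trace_point_def inner_complex_def mat_trace_add[of _ n] mat_trace_smult[of _ n])
qed

lemma conj_by_real_diag_swap:
  assumes U: "U \<in> unitary_mats n" and B: "B \<in> unitary_mats n" and A: "A \<in> carrier_mat n n"
    and diag: "conj_by B A = real_diag n h"
  shows "conj_by U A = conj_by (mat_adjoint B * U) (real_diag n h)"
proof -
  have c [simp]: "U \<in> carrier_mat n n" "B \<in> carrier_mat n n" using U B by (auto intro: unitary_carrier)
  have "conj_by (mat_adjoint B * U) (real_diag n h) = conj_by U (conj_by (mat_adjoint B) (conj_by B A))"
    unfolding diag by (intro conj_by_conj_by[symmetric, of _ n]) auto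
  then show ?thesis using conj_by_adjoint_cancel(1)[OF B A] by simp
qed

text \<open>The maximum over the orbit is at least the value at an eigenbasis of the direction matrix, where both
  spectra are aligned.\<close>

lemma maximizer_top_rows:
  assumes HK: "H \<in> carrier_mat n n" "K \<in> carrier_mat n n"
    and c: "antimono_on {..<n} c" and k: "0 < k" "k < n" and gap: "c k < c (k - 1)"
    and U: "U \<in> unitary_mats n"
    and max: "\<And>U'. U' \<in> unitary_mats n \<Longrightarrow> d \<bullet> trace_point n c H K U' \<le> d \<bullet> trace_point n c H K U"
    and B: "B \<in> unitary_mats n" and h: "antimono_on {..<n} h"
    and diag: "conj_by B (direction_mat H K d) = real_diag n h"
  shows "top_rows n k h (conj_by B (leading_projection n k U))"
proof -
  define X where "X = mat_adjoint B * U"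
  have cc [simp]: "U \<in> carrier_mat n n" "B \<in> carrier_mat n n" using U B by (auto intro: unitary_carrier)
  have X: "X \<in> unitary_mats n" unfolding X_def by (intro unitary_mats_mult unitary_mats_adjoint U B)
  have D: "direction_mat H K d \<in> carrier_mat n n" using HK by simp
  have val: "d \<bullet> trace_point n c H K V =
      (\<Sum>i<n. (\<Sum>a<n. (cmod ((mat_adjoint B * V) $$ (i, a)))\<^sup>2 * c a) * h i)" if V: "V \<in> unitary_mats n" for V
  proof -
    have "mat_adjoint B * V \<in> carrier_mat n n"
      using unitary_carrier[OF V] by simp
    then show ?thesis
      unfolding inner_trace_point[OF HK unitary_carrier[OF V]] conj_by_real_diag_swap[OF V B D diag]
      by (simp only: trace_diag_conj_by_diag Re_complex_of_real)
  qed
  have "mat_adjoint B * B = 1\<^sub>m n" using B by (simp add: unitary_mats_def)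
  then have "d \<bullet> trace_point n c H K B = (\<Sum>i<n. (\<Sum>a<n. (cmod ((1\<^sub>m n :: complex mat) $$ (i, a)))\<^sup>2 * c a) * h i)"
    using val[OF B] by simp
  also have "\<dots> = (\<Sum>i<n. c i * h i)"
  proof (intro sum.cong refl)
    fix i assume i: "i \<in> {..<n}"
    have "(\<Sum>a<n. (cmod ((1\<^sub>m n :: complex mat) $$ (i, a)))\<^sup>2 * c a) = (\<Sum>a<n. if i = a then c a else 0)"
      using i by (intro sum.cong) auto
    then show "(\<Sum>a<n. (cmod ((1\<^sub>m n :: complex mat) $$ (i, a)))\<^sup>2 * c a) * h i = c i * h i" using i by simp
  qed
  finally have "(\<Sum>i<n. c i * h i) \<le> (\<Sum>i<n. (\<Sum>a<n. (cmod (X $$ (i, a)))\<^sup>2 * c a) * h i)"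
    using max[OF B] val[OF U] by (simp add: X_def)
  then have "top_rows n k h (leading_projection n k X)"
    by (intro leading_projection_top_rows[OF X c h k gap])
  moreover have "leading_projection n k X = conj_by B (leading_projection n k U)"
    unfolding leading_projection_def X_def
    by (subst conj_by_conj_by[of _ n]) (auto simp: mat_adjoint_mult[of _ n n _ n] coord_projection_def)
  ultimately show ?thesis by simp
qed

lemma maximizer_opposite_bottom_rows:
  assumes HK: "H \<in> carrier_mat n n" "K \<in> carrier_mat n n"
    and c: "antimono_on {..<n} c" and k: "0 < k" "k < n" and gap: "c k < c (k - 1)"
    and U: "U \<in> unitary_mats n"
    and max: "\<And>U'. U' \<in> unitary_mats n \<Longrightarrow> (- d) \<bullet> trace_point n c H K U' \<le> (- d) \<bullet> trace_point n c H K U"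
    and B: "B \<in> unitary_mats n" and h: "antimono_on {..<n} h"
    and diag: "conj_by B (direction_mat H K d) = real_diag n h"
  shows "bottom_rows n k h (conj_by B (leading_projection n k U))"
proof -
  define P where "P = leading_projection n k U"
  define B' where "B' = reverse_cols n B"
  define h' where "h' i = - h (n - 1 - i)" for i
  have Bc: "B \<in> carrier_mat n n" by (rule unitary_carrier[OF B])
  have B': "B' \<in> unitary_mats n" unfolding B'_def by (rule unitary_reverse_cols[OF B])
  have Pc: "P \<in> carrier_mat n n"
    using projection_mat_leading[OF U, of k] k by (simp add: P_def projection_mat_def)
  have h': "antimono_on {..<n} h'"
    unfolding monotone_on_def h'_def using monotone_onD[OF h] by auto
  have "conj_by B' (direction_mat H K (- d)) = real_diag n h'"
  proof (rule eq_matI)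
    fix i j assume "i < dim_row (real_diag n h')" "j < dim_col (real_diag n h')"
    then have ij: "i < n" "j < n" by auto
    have "conj_by B (direction_mat H K (- d)) = (- 1) \<cdot>\<^sub>m conj_by B (direction_mat H K d)"
    proof -
      have "direction_mat H K (- d) = (- 1) \<cdot>\<^sub>m direction_mat H K d"
        using HK by (intro eq_matI) (auto simp: direction_mat_def)
      then show ?thesis using Bc HK by (simp add: conj_by_smult[of _ n])
    qed
    moreover have "conj_by B' (direction_mat H K (- d)) $$ (i, j) = conj_by B (direction_mat H K (- d)) $$ (n - 1 - i, n - 1 - j)"
      unfolding B'_def by (rule conj_by_reverse_cols[OF Bc _ ij]) (use HK in simp)
    ultimately show "conj_by B' (direction_mat H K (- d)) $$ (i, j) = real_diag n h' $$ (i, j)"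
      unfolding diag using ij by (auto simp: mat_diag_def h'_def)
  qed (use carrier_conj_by[OF unitary_carrier[OF B'], of "direction_mat H K (- d)"] HK in auto)
  then have top: "top_rows n k h' (conj_by B' P)"
    unfolding P_def by (intro maximizer_top_rows[OF HK c k gap U max B' h'])
  have rev: "conj_by B P $$ (i, j) = conj_by B' P $$ (n - 1 - i, n - 1 - j)" if "i < n" "j < n" for i j
    unfolding B'_def using that by (subst conj_by_reverse_cols[OF Bc Pc]) auto
  have unit: "unit_row n (conj_by B P) i" if "unit_row n (conj_by B' P) (n - 1 - i)" "i < n" for i
    unfolding unit_row_def
  proof (intro allI impI)
    fix j assume j: "j < n"
    then have "n - 1 - j < n" by simp
    then show "conj_by B P $$ (i, j) = (if i = j then 1 else 0)"
      using that rev[OF that(2) j] j by (auto simp: unit_row_def)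
  qed
  have zero: "zero_row n (conj_by B P) i" if "zero_row n (conj_by B' P) (n - 1 - i)" "i < n" for i
    unfolding zero_row_def
  proof (intro allI impI)
    fix j assume j: "j < n"
    then have "n - 1 - j < n" by simp
    then show "conj_by B P $$ (i, j) = 0"
      using that rev[OF that(2) j] by (auto simp: zero_row_def)
  qed
  show ?thesis
    unfolding bottom_rows_def P_def[symmetric]
  proof (intro allI impI conjI)
    fix i assume i: "i < n"
    then have i': "n - 1 - i < n" "n - 1 - (n - 1 - i) = i" by auto
    have k': "n - 1 - (k - 1) = n - k" using k by auto
    show "unit_row n (conj_by B P) i" if "h i < h (n - 1 - k)"
      using top i' that i by (intro unit) (auto simp: top_rows_def h'_def)
    show "zero_row n (conj_by B P) i" if "h (n - k) < h i"
      using top i' k' that i by (intro zero) (auto simp: top_rows_def h'_def)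
  qed
qed

text \<open>Choose for each vertex \<open>v\<close> a unitary matrix \<open>u v\<close> that attains it, with leading projection \<open>P v\<close>. If \<open>d\<close>
  lies in the normal cone of \<open>v\<close>, then \<open>P v\<close> maximizes the trace against the direction matrix \<open>D d\<close> and
  commutes with it. A cone with two independent directions thus puts \<open>P v\<close> into the commutant of \<open>H\<close> and
  \<open>K\<close>, and these cones cover the plane.

  Let \<open>Z\<close> be the commutator of \<open>H\<close> and \<open>K\<close>. Two projections that are maximal in a common
  direction differ only inside one eigenspace of \<open>D d\<close>, so \<open>Z * P v = Z * P w\<close>. As the punctured plane is
  connected, \<open>Z * P v\<close> does not depend on \<open>v\<close>. For opposite directions the product \<open>P v * P w\<close> lives in
  one eigenspace too, and \<open>Z * P v = Z * P w = Z * (P w * P w) = Z * (P v * P w) = 0\<close>.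

  Finally, either the projections differ across some common direction, which is normal to an edge, and
  \<open>commutator_zero_of_edge\<close> applies; or there is only one projection, which is both maximal and
  minimal, so that a direction matrix is scalar.\<close>

theorem polygonal_trace_range_imp_commute_low_gap:
  assumes HK: "H \<in> carrier_mat n n" "K \<in> carrier_mat n n" and herm: "hermitian_mat H" "hermitian_mat K"
    and c: "antimono_on {..<n} c" and k: "0 < k" "2 * k \<le> n" "n \<le> 2 * k + 2" and gap: "c k < c (k - 1)"
    and poly: "polytope (trace_point n c H K ` unitary_mats n)"
  shows "H * K = K * H"
proof -
  have kn: "k < n" using k by simp
  obtain V where V: "finite V" "trace_point n c H K ` unitary_mats n = convex hull V"
    using poly unfolding polytope_def by blast
  have V_ne: "V \<noteq> {}" using V(2) unitary_mats_one[of n] by auto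
  have "\<forall>v\<in>V. \<exists>U\<in>unitary_mats n. trace_point n c H K U = v"
    using V(2) hull_subset[of V convex] by (metis (no_types, lifting) imageE subsetD)
  then obtain u where u: "\<And>v. v \<in> V \<Longrightarrow> u v \<in> unitary_mats n" "\<And>v. v \<in> V \<Longrightarrow> trace_point n c H K (u v) = v"
    by metis
  define P where "P v = leading_projection n k (u v)" for v
  have P: "projection_mat n k (P v)" if "v \<in> V" for v
    unfolding P_def using u(1)[OF that] kn by (intro projection_mat_leading) auto
  have Pc: "P v \<in> carrier_mat n n" if "v \<in> V" for v using P[OF that] by (simp add: projection_mat_def)
  define D where "D d = direction_mat H K d" for d
  have Dc [simp]: "D d \<in> carrier_mat n n" for d using HK by (simp add: D_def)
  have max: "d \<bullet> trace_point n c H K U \<le> d \<bullet> trace_point n c H K (u v)"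
    if "v \<in> V" "d \<in> normal_cone V v" "U \<in> unitary_mats n" for d v U
  proof -
    have "V \<subseteq> {x. d \<bullet> x \<le> d \<bullet> v}" using that(2) by (auto simp: normal_cone_def)
    then have "convex hull V \<subseteq> {x. d \<bullet> x \<le> d \<bullet> v}" by (intro hull_minimal convex_halfspace_le)
    moreover have "trace_point n c H K U \<in> convex hull V" using V(2) that(3) by blast
    ultimately show ?thesis using u(2)[OF that(1)] by auto
  qed
  have "\<exists>B h. B \<in> unitary_mats n \<and> antimono_on {..<n} h \<and> conj_by B (D d) = real_diag n h" for d
    using hermitian_spectral[OF Dc, of d] hermitian_direction_mat[OF HK herm, of d] unfolding D_def by metis
  then obtain B h where B: "\<And>d. B d \<in> unitary_mats n" and h: "\<And>d. antimono_on {..<n} (h d)"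
    and diag: "\<And>d. conj_by (B d) (D d) = real_diag n (h d)"
    by metis
  have Bc [simp]: "B d \<in> carrier_mat n n" for d by (rule unitary_carrier[OF B])
  define P' where "P' d v = conj_by (B d) (P v)" for d v
  have P': "projection_mat n k (P' d v)" if "v \<in> V" for d v
    unfolding P'_def by (rule projection_mat_conj_by[OF B P[OF that]])
  have P'c: "P' d v \<in> carrier_mat n n" if "v \<in> V" for d v using P'[OF that] by (simp add: projection_mat_def)
  have top: "top_rows n k (h d) (P' d v)" if "v \<in> V" "d \<in> normal_cone V v" for d v
    unfolding P'_def P_def
    by (rule maximizer_top_rows[OF HK c k(1) kn gap u(1)[OF that(1)] max[OF that] B h diag[unfolded D_def]])
  have bottom: "bottom_rows n k (h d) (P' d v)" if "v \<in> V" "- d \<in> normal_cone V v" for d v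
    unfolding P'_def P_def
    by (rule maximizer_opposite_bottom_rows[OF HK c k(1) kn gap u(1)[OF that(1)] max[OF that] B h diag[unfolded D_def]])
  have comm_max: "P v * D d = D d * P v" if "v \<in> V" "d \<in> normal_cone V v" for d v
  proof -
    have "hermitian_mat (P' d v)" using P'[OF that(1)] by (simp add: projection_mat_def)
    then have "real_diag n (h d) * P' d v = P' d v * real_diag n (h d)"
      by (intro top_rows_commute[OF P'c[OF that(1)] _ top[OF that] h k(1) kn])
    then have "conj_by (B d) (P v) * conj_by (B d) (D d) = conj_by (B d) (D d) * conj_by (B d) (P v)"
      by (simp add: diag P'_def)
    then show ?thesis using conj_by_commute_iff[OF B Pc[OF that(1)] Dc] by blast
  qed
  \<comment> \<open>The vertices whose normal cones have interior points; only these are used.\<close>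
  define I where "I = {v \<in> V. full_normal_cone V v}"
  have IV: "v \<in> V" if "v \<in> I" for v using that by (simp add: I_def)
  have commHK: "P v * H = H * P v" "P v * K = K * P v" if v: "v \<in> I" for v
  proof -
    obtain d e where de: "d \<in> normal_cone V v" "e \<in> normal_cone V v" "Re d * Im e - Im d * Re e \<noteq> 0"
      using v by (auto simp: I_def full_normal_cone_def)
    show "P v * H = H * P v" "P v * K = K * P v"
      using commute_with_two_directions[OF Pc[OF IV[OF v]] HK _ _ de(3)]
        comm_max[OF IV[OF v] de(1)] comm_max[OF IV[OF v] de(2)] by (auto simp: D_def)
  qed
  have commD: "P v * D d = D d * P v" if v: "v \<in> I" for v d
    unfolding D_def direction_mat_def by (rule commute_lincomb[OF Pc[OF IV[OF v]] HK commHK[OF v]])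
  define Z where "Z = H * K - K * H"
  have Zc [simp]: "Z \<in> carrier_mat n n" using HK by (simp add: Z_def)
  have comm_D: "D d * D (\<i> * d) - D (\<i> * d) * D d = complex_of_real ((cmod d)\<^sup>2) \<cdot>\<^sub>m Z" for d
    unfolding D_def Z_def by (rule direction_commutator[OF HK])
  have unscale: "A = 0\<^sub>m n n" if "complex_of_real ((cmod d)\<^sup>2) \<cdot>\<^sub>m A = 0\<^sub>m n n" "d \<noteq> 0" "A \<in> carrier_mat n n" for d A
    using smult_mat_eq_zero_iff[OF that(3), of "complex_of_real ((cmod d)\<^sup>2)"] that(1,2) by simp
  \<comment> \<open>A matrix in the commutant on whose range a direction acts as a scalar is killed by the commutator.\<close>
  have kill: "Z * R = 0\<^sub>m n n"
    if R: "R \<in> carrier_mat n n" "R * D (\<i> * d) = D (\<i> * d) * R" and d: "d \<noteq> 0"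
      and scal: "real_diag n (h d) * conj_by (B d) R = \<mu> \<cdot>\<^sub>m conj_by (B d) R" for R d \<mu>
  proof -
    have "conj_by (B d) (D d * R) = conj_by (B d) (\<mu> \<cdot>\<^sub>m R)"
      using R scal by (simp add: conj_by_mult[OF B Dc] conj_by_smult[of _ n] diag)
    then have "D d * R = \<mu> \<cdot>\<^sub>m R" using conj_by_inject[OF B, of "D d * R" "\<mu> \<cdot>\<^sub>m R"] R by simp
    then have "(complex_of_real ((cmod d)\<^sup>2) \<cdot>\<^sub>m Z) * R = 0\<^sub>m n n"
      unfolding comm_D[symmetric] using R by (intro commutator_annihilates[where \<mu> = \<mu>]) auto
    then have "complex_of_real ((cmod d)\<^sup>2) \<cdot>\<^sub>m (Z * R) = 0\<^sub>m n n"
      using R by (simp add: mult_smult_assoc_mat[of _ n n _ n])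
    then show ?thesis using unscale[OF _ d] R by simp
  qed
  have cover: "\<exists>v\<in>I. d \<in> normal_cone V v" if "d \<noteq> 0" for d
    using full_normal_cones_cover[OF V(1) V_ne that] by (auto simp: I_def)
  have fin: "finite I" using V(1) by (simp add: I_def)
  have conn: "connected (- {0 :: complex})" by (rule connected_punctured_universe) simp
  have cover': "- {0} \<subseteq> (\<Union>v\<in>I. normal_cone V v)" using cover by auto
  have nonzero_dir: "\<exists>d. d \<noteq> 0 \<and> d \<in> normal_cone V v" if vI: "v \<in> I" for v
  proof -
    obtain d e where de: "d \<in> normal_cone V v" "Re d * Im e - Im d * Re e \<noteq> 0"
      using vI unfolding I_def full_normal_cone_def by blast
    then have "d \<noteq> 0" by auto
    then show ?thesis using de(1) by blast
  qed
  have global: "f v = f w"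
    if agree: "\<And>d v w. d \<noteq> 0 \<Longrightarrow> v \<in> I \<Longrightarrow> w \<in> I \<Longrightarrow> d \<in> normal_cone V v \<Longrightarrow> d \<in> normal_cone V w \<Longrightarrow> f v = f w"
      and vw: "v \<in> I" "w \<in> I" for v w and f :: "complex \<Rightarrow> complex mat"
  proof -
    obtain d where d: "d \<noteq> 0" "d \<in> normal_cone V v" using nonzero_dir[OF vw(1)] by blast
    obtain e where e: "e \<noteq> 0" "e \<in> normal_cone V w" using nonzero_dir[OF vw(2)] by blast
    show ?thesis
    proof (rule finite_closed_cover_constant[OF conn fin closed_normal_cone cover' _ vw(1) _ d(2) vw(2) _ e(2)])
      show "f a = f b" if "x \<in> - {0}" "a \<in> I" "b \<in> I" "x \<in> normal_cone V a" "x \<in> normal_cone V b" for x a b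
        using agree[OF _ that(2-5)] that(1) by simp
    qed (use d e in auto)
  qed
  have ZP_agree: "Z * P v = Z * P w"
    if "d \<noteq> 0" "v \<in> I" "w \<in> I" "d \<in> normal_cone V v" "d \<in> normal_cone V w" for d v w
  proof -
    note [simp] = Pc[OF IV[OF that(2)]] Pc[OF IV[OF that(3)]]
    have "conj_by (B d) (P v - P w) = P' d v - P' d w" by (simp add: P'_def conj_by_minus[of _ n])
    moreover have "real_diag n (h d) * (P' d v - P' d w) = complex_of_real (h d k) \<cdot>\<^sub>m (P' d v - P' d w)"
      using that by (intro top_rows_difference[OF _ _ _ _ h k(1) kn] P'c top IV)
    ultimately have "real_diag n (h d) * conj_by (B d) (P v - P w) = complex_of_real (h d k) \<cdot>\<^sub>m conj_by (B d) (P v - P w)"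
      by simp
    moreover have "(P v - P w) * D (\<i> * d) = D (\<i> * d) * (P v - P w)"
      using commD[OF that(2)] commD[OF that(3)]
      by (simp add: mult_minus_distrib_mat[of _ n n _ n] minus_mult_distrib_mat[of _ n n _ _ n])
    ultimately have "Z * (P v - P w) = 0\<^sub>m n n" by (intro kill[OF _ _ that(1)]) auto
    then have "Z * P v - Z * P w = 0\<^sub>m n n" by (simp add: mult_minus_distrib_mat[of _ n n _ n])
    then show ?thesis by (simp only: minus_mat_eq_zero_iff[OF mult_carrier_sq mult_carrier_sq] Zc Pc[OF IV] that)
  qed
  have ZP: "Z * P v = 0\<^sub>m n n" if v: "v \<in> I" for v
  proof -
    obtain d where d: "d \<noteq> 0" "d \<in> normal_cone V v" using nonzero_dir[OF v] by blast
    then obtain w where w: "w \<in> I" "- d \<in> normal_cone V w" using cover[of "- d"] by auto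
    note [simp] = Pc[OF IV[OF v]] Pc[OF IV[OF w(1)]]
    have eq: "Z * P v = Z * P w" by (rule global[OF ZP_agree v w(1)])
    have "real_diag n (h d) * (P' d v * P' d w) = complex_of_real (h d k) \<cdot>\<^sub>m (P' d v * P' d w)"
      using v w d by (intro top_bottom_product[OF _ _ _ _ h k(1,2)] P'c top bottom IV)
    moreover have "conj_by (B d) (P v * P w) = P' d v * P' d w" by (simp add: P'_def conj_by_mult[OF B])
    ultimately have "real_diag n (h d) * conj_by (B d) (P v * P w) = complex_of_real (h d k) \<cdot>\<^sub>m conj_by (B d) (P v * P w)"
      by simp
    moreover have "(P v * P w) * D (\<i> * d) = D (\<i> * d) * (P v * P w)"
    proof -
      have "(P v * P w) * D (\<i> * d) = P v * (D (\<i> * d) * P w)"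
        using commD[OF w(1)] by (simp add: assoc_sq[where n = n])
      also have "\<dots> = (P v * D (\<i> * d)) * P w" by (simp add: assoc_sq[where n = n])
      also have "\<dots> = D (\<i> * d) * (P v * P w)" using commD[OF v] by (simp add: assoc_sq[where n = n])
      finally show ?thesis .
    qed
    ultimately have "Z * (P v * P w) = 0\<^sub>m n n" by (intro kill[OF _ _ d(1)]) auto
    moreover have "Z * (P v * P w) = (Z * P v) * P w" by (simp add: assoc_sq[where n = n])
    moreover have "\<dots> = Z * (P w * P w)" unfolding eq by (simp add: assoc_sq[where n = n])
    moreover have "P w * P w = P w" using P[OF IV[OF w(1)]] by (simp add: projection_mat_def)
    ultimately show ?thesis using eq by simp
  qed
  have Z0: "Z = 0\<^sub>m n n"
  proof (cases "\<exists>d v w. d \<noteq> 0 \<and> v \<in> I \<and> w \<in> I \<and> d \<in> normal_cone V v \<and> d \<in> normal_cone V w \<and> P v \<noteq> P w")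
    case True
    then obtain d v w where e: "d \<noteq> 0" "v \<in> I" "w \<in> I" "d \<in> normal_cone V v" "d \<in> normal_cone V w" "P v \<noteq> P w"
      by blast
    obtain q where q: "q \<in> I" "- d \<in> normal_cone V q" using cover[of "- d"] e(1) by auto
    define L where "L = conj_by (B d) (D (\<i> * d))"
    define Z' where "Z' = conj_by (B d) (complex_of_real ((cmod d)\<^sup>2) \<cdot>\<^sub>m Z)"
    have Lc: "L \<in> carrier_mat n n" by (simp add: L_def)
    have Lh: "hermitian_mat L"
      unfolding L_def D_def using HK herm by (intro hermitian_conj_by[of _ n] hermitian_direction_mat[of _ n]) auto
    have Z'_eq: "Z' = real_diag n (h d) * L - L * real_diag n (h d)"
      unfolding Z'_def comm_D[symmetric] L_def by (simp add: conj_by_minus[of _ n] conj_by_mult[OF B] diag)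
    have Z'P: "Z' * P' d x = 0\<^sub>m n n" if x: "x \<in> I" for x
    proof -
      have "Z' * P' d x = conj_by (B d) (complex_of_real ((cmod d)\<^sup>2) \<cdot>\<^sub>m (Z * P x))"
        unfolding Z'_def P'_def using Pc[OF IV[OF x]]
        by (simp add: conj_by_mult[OF B, symmetric] mult_smult_assoc_mat[of _ n n _ n])
      also have "\<dots> = 0\<^sub>m n n" unfolding ZP[OF x] by (simp add: conj_by_zero)
      finally show ?thesis .
    qed
    have ne: "P' d v \<noteq> P' d w"
      unfolding P'_def using conj_by_inject[OF B Pc[OF IV[OF e(2)]] Pc[OF IV[OF e(3)]]] e(6) by blast
    have "Z' = 0\<^sub>m n n"
      by (rule commutator_zero_of_edge[OF Lc Lh Z'_eq h k P'[OF IV[OF e(2)]] P'[OF IV[OF e(3)]] P'[OF IV[OF q(1)]]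
          top[OF IV[OF e(2)] e(4)] top[OF IV[OF e(3)] e(5)] bottom[OF IV[OF q(1)] q(2)]
          Z'P[OF e(2)] Z'P[OF e(3)] Z'P[OF q(1)] ne])
    then have "conj_by (B d) (complex_of_real ((cmod d)\<^sup>2) \<cdot>\<^sub>m Z) = conj_by (B d) (0\<^sub>m n n)"
      by (simp add: Z'_def conj_by_zero)
    then have "complex_of_real ((cmod d)\<^sup>2) \<cdot>\<^sub>m Z = 0\<^sub>m n n"
      using conj_by_inject[OF B, of "complex_of_real ((cmod d)\<^sup>2) \<cdot>\<^sub>m Z" "0\<^sub>m n n" d] by simp
    then show ?thesis using unscale[OF _ e(1)] by simp
  next
    case False
    obtain v where v: "v \<in> I" "1 \<in> normal_cone V v" using cover[of 1] by auto
    obtain w where w: "w \<in> I" "- 1 \<in> normal_cone V w" using cover[of "- 1"] by auto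
    have "P v = P w" by (rule global[OF _ v(1) w(1)]) (use False in blast)
    then have "P' 1 v = P' 1 w" by (simp add: P'_def)
    then have bot: "bottom_rows n k (h 1) (P' 1 v)" using bottom[OF IV[OF w(1)] w(2)] by simp
    have const: "h 1 i = h 1 k" if "i < n" for i
      by (rule top_and_bottom_imp_constant[OF P'[OF IV[OF v(1)]] top[OF IV[OF v(1)] v(2)] bot h k(1,2) that])
    have "real_diag n (h 1) * conj_by (B 1) (1\<^sub>m n) = complex_of_real (h 1 k) \<cdot>\<^sub>m conj_by (B 1) (1\<^sub>m n)"
      by (rule real_diag_acts_as_scalar) (use const in auto)
    then have "Z * 1\<^sub>m n = 0\<^sub>m n n" by (intro kill[where d = 1]) auto
    then show ?thesis by simp
  qed
  show ?thesis using Z0 HK by (simp add: Z_def minus_mat_eq_zero_iff)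
qed

lemma trace_real_diag_mult:
  "A \<in> carrier_mat n n \<Longrightarrow> mat_trace (real_diag n c * A) = (\<Sum>i<n. complex_of_real (c i) * A $$ (i, i))"
  by (simp add: mat_diag_mult_left[of A n n] mat_trace_def)

lemma trace_point_reverse:
  assumes HK: "H \<in> carrier_mat n n" "K \<in> carrier_mat n n" and U: "U \<in> carrier_mat n n"
  shows "trace_point n (\<lambda>i. - c (n - 1 - i)) H K (reverse_cols n U) = - trace_point n c H K U"
proof -
  have Rc: "reverse_cols n U \<in> carrier_mat n n" by (simp add: reverse_cols_def)
  have "mat_trace (real_diag n (\<lambda>i. - c (n - 1 - i)) * conj_by (reverse_cols n U) A) =
      - mat_trace (real_diag n c * conj_by U A)" if A: "A \<in> carrier_mat n n" for A
  proof -
    have "mat_trace (real_diag n (\<lambda>i. - c (n - 1 - i)) * conj_by (reverse_cols n U) A) =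
        (\<Sum>i<n. complex_of_real (- c (n - 1 - i)) * conj_by U A $$ (n - 1 - i, n - 1 - i))"
      unfolding trace_real_diag_mult[OF carrier_conj_by[OF Rc A]]
      by (intro sum.cong refl) (simp add: conj_by_reverse_cols[OF U A])
    also have "\<dots> = (\<Sum>i<n. complex_of_real (- c i) * conj_by U A $$ (i, i))"
      using sum.nat_diff_reindex[of "\<lambda>i. complex_of_real (- c i) * conj_by U A $$ (i, i)" n] by simp
    also have "\<dots> = - mat_trace (real_diag n c * conj_by U A)"
      unfolding trace_real_diag_mult[OF carrier_conj_by[OF U A]] by (simp add: sum_negf)
    finally show ?thesis .
  qed
  then show ?thesis using HK by (simp add: trace_point_def complex_eq_iff)
qed

text \<open>Replacing \<open>c\<close> by its reversed negative reflects the joint range in the origin and turns a gap at \<open>k\<close> into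
  one at \<open>n - k\<close>, so the gap may be assumed to lie in the lower half.\<close>

theorem polygonal_trace_range_imp_commute:
  assumes HK: "H \<in> carrier_mat n n" "K \<in> carrier_mat n n" and herm: "hermitian_mat H" "hermitian_mat K"
    and c: "antimono_on {..<n} c" and k: "central_index n k" and gap: "c k < c (k - 1)"
    and poly: "polytope (trace_point n c H K ` unitary_mats n)"
  shows "H * K = K * H"
proof -
  have k': "0 < k" "k < n" "n \<le> 2 * k + 2" "2 * k \<le> n + 2"
    using k by (auto simp: central_index_def)
  show ?thesis
  proof (cases "2 * k \<le> n")
    case True
    then show ?thesis
      using polygonal_trace_range_imp_commute_low_gap[OF HK herm c k'(1) _ k'(3) gap poly] by simp
  next
    case False
    define c' where "c' i = - c (n - 1 - i)" for i
    have c'_mono: "antimono_on {..<n} c'"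
      unfolding monotone_on_def c'_def using monotone_onD[OF c] by auto
    have rev_rev: "reverse_cols n (reverse_cols n U) = U" if "U \<in> carrier_mat n n" for U
      using that by (intro eq_matI) (auto simp: reverse_cols_def)
    have "trace_point n c' H K ` unitary_mats n = uminus ` (trace_point n c H K ` unitary_mats n)"
    proof (intro equalityI subsetI)
      fix z assume "z \<in> trace_point n c' H K ` unitary_mats n"
      then obtain U where U: "U \<in> unitary_mats n" "z = trace_point n c' H K U" by blast
      then have "z = - trace_point n c H K (reverse_cols n U)"
        using trace_point_reverse[OF HK, of "reverse_cols n U" c] rev_rev[OF unitary_carrier[OF U(1)]]
        by (simp add: c'_def[abs_def] reverse_cols_def)
      then show "z \<in> uminus ` (trace_point n c H K ` unitary_mats n)"
        using unitary_reverse_cols[OF U(1)] by blast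
    next
      fix z assume "z \<in> uminus ` (trace_point n c H K ` unitary_mats n)"
      then obtain U where U: "U \<in> unitary_mats n" "z = - trace_point n c H K U" by blast
      then have "z = trace_point n c' H K (reverse_cols n U)"
        using trace_point_reverse[OF HK unitary_carrier[OF U(1)], of c] by (simp add: c'_def[abs_def])
      then show "z \<in> trace_point n c' H K ` unitary_mats n" using unitary_reverse_cols[OF U(1)] by blast
    qed
    moreover have "polytope (uminus ` (trace_point n c H K ` unitary_mats n))"
      using poly by (intro polytope_linear_image) (auto intro: linearI)
    ultimately have poly': "polytope (trace_point n c' H K ` unitary_mats n)" by simp
    have "c' (n - k) < c' (n - k - 1)"
      using gap k' by (simp add: c'_def)
    then show ?thesis
      using polygonal_trace_range_imp_commute_low_gap[OF HK herm c'_mono _ _ _ _ poly', of "n - k"] k' False by simp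
  qed
qed

section \<open>Simultaneous diagonalization and Fuglede's theorem\<close>

lemma scalar_conj_by:
  assumes U: "U \<in> unitary_mats n"
  shows "conj_by U (a \<cdot>\<^sub>m 1\<^sub>m n) = a \<cdot>\<^sub>m 1\<^sub>m n"
proof -
  have "conj_by U (a \<cdot>\<^sub>m 1\<^sub>m n) = a \<cdot>\<^sub>m conj_by U (1\<^sub>m n)"
    by (rule conj_by_smult[OF unitary_carrier[OF U]]) simp
  also have "conj_by U (1\<^sub>m n) = 1\<^sub>m n" using U by (simp add: conj_by_def unitary_mats_def)
  finally show ?thesis .
qed

lemma constant_real_diag: "mat_diag n (\<lambda>i. a) = a \<cdot>\<^sub>m (1\<^sub>m n :: complex mat)"
  by (intro eq_matI) (auto simp: mat_diag_def)

lemma nonscalar_hermitian_split: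
  assumes A: "A \<in> carrier_mat n n" "hermitian_mat A" and ns: "\<And>a. A \<noteq> a \<cdot>\<^sub>m 1\<^sub>m n"
  obtains U h m where "U \<in> unitary_mats n" "conj_by U A = real_diag n h" "0 < m" "m < n"
    "\<And>i j. i < m \<Longrightarrow> m \<le> j \<Longrightarrow> j < n \<Longrightarrow> h j < h i"
proof -
  obtain U h where U: "U \<in> unitary_mats n" and h: "antimono_on {..<n} h" and d: "conj_by U A = real_diag n h"
    by (rule hermitian_spectral[OF A])
  have hm: "h b \<le> h a" if "a \<le> b" "b < n" for a b
    using monotone_onD[OF h, of a b] that by auto
  have "\<exists>m. m < n \<and> h m \<noteq> h 0"
  proof (rule ccontr)
    assume "\<not> (\<exists>m. m < n \<and> h m \<noteq> h 0)"
    then have eq: "h i = h 0" if "i < n" for i using that by blast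
    have "real_diag n h = mat_diag n (\<lambda>i. complex_of_real (h 0))"
      by (intro eq_matI) (auto simp: mat_diag_def intro: eq)
    then have "conj_by U A = conj_by U (complex_of_real (h 0) \<cdot>\<^sub>m 1\<^sub>m n)"
      using d scalar_conj_by[OF U] by (simp add: constant_real_diag)
    then have "A = complex_of_real (h 0) \<cdot>\<^sub>m 1\<^sub>m n" using conj_by_inject[OF U A(1)] by simp
    with ns show False by blast
  qed
  then obtain m where m: "m < n" "h m \<noteq> h 0" "\<And>i. i < m \<Longrightarrow> \<not> (i < n \<and> h i \<noteq> h 0)"
    using exists_least_iff[of "\<lambda>m. m < n \<and> h m \<noteq> h 0"] by blast
  have "0 < m" using m(2) by (cases m) auto
  moreover have "h j < h i" if "i < m" "m \<le> j" "j < n" for i j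
  proof -
    have "h j \<le> h m" "h m \<le> h 0" using that m(1) by (auto intro!: hm)
    moreover have "h i = h 0" using m(3)[OF that(1)] that by simp
    ultimately show ?thesis using m(2) by simp
  qed
  ultimately show ?thesis using that[OF U d] m(1) by blast
qed

lemma mult_block_entries_zero:
  assumes B: "B \<in> carrier_mat n n" and comm: "B * real_diag n h = real_diag n h * B"
    and ij: "i < n" "j < n" and neq: "h i \<noteq> h j"
  shows "B $$ (i, j) = 0"
proof -
  have "B $$ (i, j) * h j = h i * B $$ (i, j)"
    using real_diag_mult_entry[OF B ij, of h] comm by (metis (no_types))
  then have "(h i - h j) * B $$ (i, j) = 0" by (simp add: left_diff_distrib mult.commute) auto
  then show ?thesis using neq by auto
qed

lemma block_sum_entries:
  assumes B: "B \<in> carrier_mat n n" and m: "m \<le> n"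
    and zero: "\<And>i j. i < m \<Longrightarrow> m \<le> j \<Longrightarrow> j < n \<Longrightarrow> B $$ (i, j) = 0 \<and> B $$ (j, i) = 0"
  shows "B = block_sum (mat m m (\<lambda>(i, j). B $$ (i, j))) (mat (n - m) (n - m) (\<lambda>(i, j). B $$ (i + m, j + m)))"
  using B m zero by (intro eq_matI) auto

lemma block_sum_inject:
  assumes "A \<in> carrier_mat m m" "A' \<in> carrier_mat m m" "B \<in> carrier_mat k k" "B' \<in> carrier_mat k k"
    and eq: "block_sum A B = block_sum A' B'"
  shows "A = A'" "B = B'"
proof -
  show "A = A'"
  proof (rule eq_matI)
    fix i j assume "i < dim_row A'" "j < dim_col A'"
    then show "A $$ (i, j) = A' $$ (i, j)"
      using arg_cong[OF eq, of "\<lambda>M. M $$ (i, j)"] assms by auto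
  qed (use assms in auto)
  show "B = B'"
  proof (rule eq_matI)
    fix i j assume "i < dim_row B'" "j < dim_col B'"
    then show "B $$ (i, j) = B' $$ (i, j)"
      using arg_cong[OF eq, of "\<lambda>M. M $$ (m + i, m + j)"] assms by auto
  qed (use assms in auto)
qed

text \<open>If some member is not scalar, its eigenvalues fall into two separated groups, all members
  respect the corresponding splitting of the space, and induction applies to both blocks.\<close>

theorem simultaneous_diagonalization:
  assumes "T \<subseteq> carrier_mat n n" "\<And>A. A \<in> T \<Longrightarrow> hermitian_mat A" "\<And>A B. A \<in> T \<Longrightarrow> B \<in> T \<Longrightarrow> A * B = B * A"
  shows "\<exists>U\<in>unitary_mats n. \<forall>A\<in>T. \<exists>f. conj_by U A = mat_diag n f"
  using assms
proof (induction n arbitrary: T rule: less_induct)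
  case (less n T)
  show ?case
  proof (cases "\<forall>A\<in>T. \<exists>a. A = a \<cdot>\<^sub>m 1\<^sub>m n")
    case True
    have "\<exists>f. conj_by (1\<^sub>m n) A = mat_diag n f" if A: "A \<in> T" for A
    proof -
      obtain a where "A = a \<cdot>\<^sub>m 1\<^sub>m n" using True A by blast
      then show ?thesis using less.prems(1) A constant_real_diag[of n a] by (metis conj_by_one subsetD)
    qed
    then show ?thesis using unitary_mats_one by blast
  next
    case False
    then obtain A where A: "A \<in> T" "\<And>a. A \<noteq> a \<cdot>\<^sub>m 1\<^sub>m n" by blast
    have Ac: "A \<in> carrier_mat n n" using A less.prems(1) by blast
    obtain U h m where U: "U \<in> unitary_mats n" and d: "conj_by U A = real_diag n h" and m: "0 < m" "m < n"
      and gap: "\<And>i j. i < m \<Longrightarrow> m \<le> j \<Longrightarrow> j < n \<Longrightarrow> h j < h i"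
      by (rule nonscalar_hermitian_split[OF Ac less.prems(2)[OF A(1)] A(2)]) blast
    have Uc: "U \<in> carrier_mat n n" by (rule unitary_carrier[OF U])
    define B1 where "B1 B = mat m m (\<lambda>(i, j). conj_by U B $$ (i, j))" for B
    define B2 where "B2 B = mat (n - m) (n - m) (\<lambda>(i, j). conj_by U B $$ (i + m, j + m))" for B
    have Bc: "B1 B \<in> carrier_mat m m" "B2 B \<in> carrier_mat (n - m) (n - m)" for B
      by (simp_all add: B1_def B2_def)
    have Tc: "B \<in> carrier_mat n n" if "B \<in> T" for B using that less.prems(1) by blast
    have block: "conj_by U B = block_sum (B1 B) (B2 B)" if B: "B \<in> T" for B
      unfolding B1_def B2_def
    proof (rule block_sum_entries)
      show c: "conj_by U B \<in> carrier_mat n n" using Uc Tc[OF B] by simp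
      show "m \<le> n" using m by simp
      have comm: "conj_by U B * real_diag n h = real_diag n h * conj_by U B"
        unfolding d[symmetric] using conj_by_commute_iff[OF U Tc[OF B] Ac] less.prems(3)[OF B A(1)] by blast
      show "conj_by U B $$ (i, j) = 0 \<and> conj_by U B $$ (j, i) = 0" if "i < m" "m \<le> j" "j < n" for i j
        using mult_block_entries_zero[OF c comm, of i j] mult_block_entries_zero[OF c comm, of j i]
          gap[OF that] that m by simp
    qed
    have herm: "hermitian_mat (B1 B) \<and> hermitian_mat (B2 B)" if B: "B \<in> T" for B
    proof -
      have "hermitian_mat (conj_by U B)" by (rule hermitian_conj_by[OF Uc Tc[OF B] less.prems(2)[OF B]])
      then have "block_sum (mat_adjoint (B1 B)) (mat_adjoint (B2 B)) = block_sum (B1 B) (B2 B)"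
        unfolding hermitian_mat_def block[OF B] block_sum_adjoint .
      then show ?thesis
        unfolding hermitian_mat_def
        using block_sum_inject[OF carrier_mat_adjoint[OF Bc(1)] Bc(1) carrier_mat_adjoint[OF Bc(2)] Bc(2)] by blast
    qed
    have comm: "B1 B * B1 B' = B1 B' * B1 B \<and> B2 B * B2 B' = B2 B' * B2 B" if BB: "B \<in> T" "B' \<in> T" for B B'
    proof -
      have "conj_by U B * conj_by U B' = conj_by U B' * conj_by U B"
        using conj_by_commute_iff[OF U Tc[OF BB(1)] Tc[OF BB(2)]] less.prems(3)[OF BB] by blast
      then have "block_sum (B1 B * B1 B') (B2 B * B2 B') = block_sum (B1 B' * B1 B) (B2 B' * B2 B)"
        unfolding block[OF BB(1)] block[OF BB(2)]
        by (simp only: block_sum_mult[OF Bc(1) Bc(1) Bc(2) Bc(2)])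
      then show ?thesis
        using block_sum_inject[OF mult_carrier_sq[OF Bc(1) Bc(1)] mult_carrier_sq[OF Bc(1) Bc(1)]
            mult_carrier_sq[OF Bc(2) Bc(2)] mult_carrier_sq[OF Bc(2) Bc(2)]] by blast
    qed
    have IH1: "\<exists>V\<in>unitary_mats m. \<forall>X\<in>B1 ` T. \<exists>f. conj_by V X = mat_diag m f"
      by (rule less.IH) (use m Bc herm comm in auto)
    obtain V1 where V1: "V1 \<in> unitary_mats m" "\<forall>B\<in>T. \<exists>f. conj_by V1 (B1 B) = mat_diag m f"
      using IH1 by blast
    have IH2: "\<exists>V\<in>unitary_mats (n - m). \<forall>X\<in>B2 ` T. \<exists>f. conj_by V X = mat_diag (n - m) f"
      by (rule less.IH) (use m Bc herm comm in auto)
    obtain V2 where V2: "V2 \<in> unitary_mats (n - m)" "\<forall>B\<in>T. \<exists>f. conj_by V2 (B2 B) = mat_diag (n - m) f"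
      using IH2 by blast
    define V where "V = block_sum V1 V2"
    have nm: "m + (n - m) = n" using m by simp
    have V: "V \<in> unitary_mats n" using unitary_block_sum[OF V1(1) V2(1)] unfolding V_def nm .
    have "\<exists>f. conj_by (U * V) B = mat_diag n f" if B: "B \<in> T" for B
    proof -
      obtain f1 f2 where f: "conj_by V1 (B1 B) = mat_diag m f1" "conj_by V2 (B2 B) = mat_diag (n - m) f2"
        using V1(2) V2(2) B by blast
      have "conj_by (U * V) B = conj_by V (conj_by U B)"
        by (rule conj_by_conj_by[symmetric, OF Uc unitary_carrier[OF V] Tc[OF B]])
      also have "\<dots> = block_sum (mat_diag m f1) (mat_diag (n - m) f2)"
        unfolding V_def block[OF B] f[symmetric]
        by (rule conj_by_block_sum[OF unitary_carrier[OF V1(1)] Bc(1) unitary_carrier[OF V2(1)] Bc(2)])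
      also have "\<dots> = mat_diag n (\<lambda>i. if i < m then f1 i else f2 (i - m))"
        using m by (intro eq_matI) (auto simp: mat_diag_def)
      finally show ?thesis by blast
    qed
    then show ?thesis using unitary_mats_mult[OF U V] by blast
  qed
qed

definition re_part :: "complex mat \<Rightarrow> complex mat" where
  "re_part X = (1 / 2) \<cdot>\<^sub>m X + (1 / 2) \<cdot>\<^sub>m mat_adjoint X"

definition im_part :: "complex mat \<Rightarrow> complex mat" where
  "im_part X = (- \<i> / 2) \<cdot>\<^sub>m X + (\<i> / 2) \<cdot>\<^sub>m mat_adjoint X"

lemma carrier_parts [simp]:
  assumes "X \<in> carrier_mat n n"
  shows "re_part X \<in> carrier_mat n n" "im_part X \<in> carrier_mat n n"
  using assms by (simp_all add: re_part_def im_part_def)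

lemma hermitian_parts:
  assumes "X \<in> carrier_mat n n"
  shows "hermitian_mat (re_part X)" "hermitian_mat (im_part X)"
  using assms by (auto simp: hermitian_mat_def re_part_def im_part_def intro!: eq_matI)

lemma cartesian_decomposition:
  assumes "X \<in> carrier_mat n n"
  shows "X = 1 \<cdot>\<^sub>m re_part X + \<i> \<cdot>\<^sub>m im_part X" "mat_adjoint X = 1 \<cdot>\<^sub>m re_part X + (- \<i>) \<cdot>\<^sub>m im_part X"
  using assms by (auto simp: re_part_def im_part_def algebra_simps intro!: eq_matI)

lemma normal_parts_commute:
  assumes X: "X \<in> carrier_mat n n" and N: "normal_mat X"
  shows "re_part X * im_part X = im_part X * re_part X"
  unfolding re_part_def im_part_def
    lincomb_mult[OF X carrier_mat_adjoint[OF X] X carrier_mat_adjoint[OF X]]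
  using N[unfolded normal_mat_def] X by (intro eq_matI) (auto simp: algebra_simps simp del: index_mult_mat(1))

text \<open>In an orthonormal eigenbasis of \<open>X\<close>, commuting with \<open>X\<close> means that the entries of \<open>Y\<close> vanish between
  different eigenvalues, and this condition is insensitive to conjugating the eigenvalues.\<close>

theorem fuglede:
  assumes X: "X \<in> carrier_mat n n" "normal_mat X" and Y: "Y \<in> carrier_mat n n" and comm: "X * Y = Y * X"
  shows "mat_adjoint X * Y = Y * mat_adjoint X"
proof -
  have "\<exists>U\<in>unitary_mats n. \<forall>A\<in>{re_part X, im_part X}. \<exists>f. conj_by U A = mat_diag n f"
  proof (rule simultaneous_diagonalization)
    show "{re_part X, im_part X} \<subseteq> carrier_mat n n" using X(1) by simp
    show "hermitian_mat A" if "A \<in> {re_part X, im_part X}" for A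
      using that hermitian_parts[OF X(1)] by blast
    show "A * B = B * A" if "A \<in> {re_part X, im_part X}" "B \<in> {re_part X, im_part X}" for A B
      using that normal_parts_commute[OF X] by auto
  qed
  then obtain U where U: "U \<in> unitary_mats n" "\<forall>A\<in>{re_part X, im_part X}. \<exists>f. conj_by U A = mat_diag n f"
    by blast
  then obtain f g where fg: "conj_by U (re_part X) = mat_diag n f" "conj_by U (im_part X) = mat_diag n g" by blast
  have Uc: "U \<in> carrier_mat n n" by (rule unitary_carrier[OF U(1)])
  define x where "x i = f i + \<i> * g i" for i
  have dX: "conj_by U X = mat_diag n x"
  proof -
    have "conj_by U X = 1 \<cdot>\<^sub>m conj_by U (re_part X) + \<i> \<cdot>\<^sub>m conj_by U (im_part X)"
      using Uc X by (subst cartesian_decomposition(1)[OF X(1)]) (simp add: conj_by_add[of _ n] conj_by_smult[of _ n])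
    then show ?thesis unfolding fg by (simp only:) (intro eq_matI; auto simp: mat_diag_def x_def)
  qed
  define Y' where "Y' = conj_by U Y"
  have Y'c: "Y' \<in> carrier_mat n n" using Uc Y by (simp add: Y'_def)
  have eq: "mat_diag n x * Y' = Y' * mat_diag n x"
    unfolding Y'_def dX[symmetric] using conj_by_commute_iff[OF U(1) X(1) Y] comm by blast
  have e: "x i * Y' $$ (i, j) = Y' $$ (i, j) * x j" if "i < n" "j < n" for i j
    using arg_cong[OF eq, of "\<lambda>M. M $$ (i, j)"] that
    by (simp only: mat_diag_mult_left[OF Y'c] mat_diag_mult_right[OF Y'c] index_mat split)
  have "mat_diag n (\<lambda>i. cnj (x i)) * Y' = Y' * mat_diag n (\<lambda>i. cnj (x i))"
  proof -
    have "cnj (x i) * Y' $$ (i, j) = Y' $$ (i, j) * cnj (x j)" if "i < n" "j < n" for i j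
      using e[OF that] by (cases "Y' $$ (i, j) = 0") auto
    then show ?thesis unfolding mat_diag_mult_left[OF Y'c] mat_diag_mult_right[OF Y'c] by (intro eq_matI) auto
  qed
  then have "conj_by U (mat_adjoint X) * conj_by U Y = conj_by U Y * conj_by U (mat_adjoint X)"
    unfolding mat_adjoint_conj_by[OF Uc X(1), symmetric] dX mat_adjoint_diag Y'_def .
  then show ?thesis using conj_by_commute_iff[OF U(1) carrier_mat_adjoint[OF X(1)] Y] by blast
qed

section \<open>The Schur-Horn theorem\<close>

text \<open>The diagonals of the Hermitian matrices with spectrum \<open>c\<close>, continued arbitrarily from index \<open>n\<close> on.\<close>

definition orbit_diagonals :: "nat \<Rightarrow> (nat \<Rightarrow> real) \<Rightarrow> (nat \<Rightarrow> real) set" where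
  "orbit_diagonals n c = {x. \<exists>U\<in>unitary_mats n. \<forall>i<n. complex_of_real (x i) = conj_by U (real_diag n c) $$ (i, i)}"

lemma orbit_diagonals_majorized:
  assumes c: "antimono_on {..<n} c" and x: "x \<in> orbit_diagonals n c"
  shows "majorized n x c"
proof -
  obtain U where U: "U \<in> unitary_mats n" "\<And>i. i < n \<Longrightarrow> complex_of_real (x i) = conj_by U (real_diag n c) $$ (i, i)"
    using x by (auto simp: orbit_diagonals_def)
  define V where "V = mat_adjoint U"
  have V: "V \<in> unitary_mats n" unfolding V_def by (rule unitary_mats_adjoint[OF U(1)])
  have Vc: "V \<in> carrier_mat n n" by (rule unitary_carrier[OF V])
  have xi: "x i = (\<Sum>a<n. (cmod (V $$ (i, a)))\<^sup>2 * c a)" if "i < n" for i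
  proof -
    have "complex_of_real (x i) = conj_by (mat_adjoint V) (real_diag n c) $$ (i, i)" using U(2)[OF that] by (simp add: V_def)
    also have "\<dots> = complex_of_real (\<Sum>a<n. (cmod (V $$ (i, a)))\<^sup>2 * c a)"
      by (simp add: conj_by_adjoint_diag_entry[OF Vc that that] complex_norm_square mult_ac del: of_real_power)
    finally show ?thesis by (simp only: of_real_eq_iff)
  qed
  have "majorized n (\<lambda>i. \<Sum>a<n. (cmod (V $$ (i, a)))\<^sup>2 * c a) c"
    by (rule majorized_doubly_stochastic[OF doubly_stochastic_unitary[OF V] c])
  moreover have "(\<Sum>i\<in>I. x i) = (\<Sum>i\<in>I. \<Sum>a<n. (cmod (V $$ (i, a)))\<^sup>2 * c a)" if "I \<subseteq> {..<n}" for I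
    using that xi by (intro sum.cong) auto
  ultimately show ?thesis by (simp add: majorized_def)
qed

definition plane_rotation :: "nat \<Rightarrow> nat \<Rightarrow> nat \<Rightarrow> real \<Rightarrow> real \<Rightarrow> complex \<Rightarrow> complex mat" where
  "plane_rotation n i j s r w = mat n n (\<lambda>(l, p).
    if p = i then (if l = i then of_real s else if l = j then of_real r * w else 0)
    else if p = j then (if l = i then - of_real r * cnj w else if l = j then of_real s else 0)
    else if l = p then 1 else 0)"

lemma sum_supported_pair:
  fixes f :: "nat \<Rightarrow> complex"
  assumes "i < n" "j < n" "i \<noteq> j" "\<And>l. l < n \<Longrightarrow> l \<noteq> i \<Longrightarrow> l \<noteq> j \<Longrightarrow> f l = 0"
  shows "(\<Sum>l<n. f l) = f i + f j"
proof -
  have "(\<Sum>l<n. f l) = (\<Sum>l\<in>{i, j}. f l)" using assms by (intro sum.mono_neutral_right) auto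
  then show ?thesis using assms by simp
qed

lemma sum_supported_single:
  fixes f :: "nat \<Rightarrow> complex"
  assumes "i < n" "\<And>l. l < n \<Longrightarrow> l \<noteq> i \<Longrightarrow> f l = 0"
  shows "(\<Sum>l<n. f l) = f i"
proof -
  have "(\<Sum>l<n. f l) = (\<Sum>l\<in>{i}. f l)" using assms by (intro sum.mono_neutral_right) auto
  then show ?thesis by simp
qed

lemma plane_rotation_mult_sum:
  assumes "i < n" "j < n" "i \<noteq> j" "p < n"
  shows "(\<Sum>l<n. f l * plane_rotation n i j s r w $$ (l, p)) =
    (if p = i then f i * of_real s + f j * (of_real r * w)
     else if p = j then f i * (- of_real r * cnj w) + f j * of_real s else f p)"
proof -
  consider "p = i" | "p = j" "p \<noteq> i" | "p \<noteq> i" "p \<noteq> j" by blast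
  then show ?thesis
  proof cases
    case 3
    have "(\<Sum>l<n. f l * plane_rotation n i j s r w $$ (l, p)) = f p * plane_rotation n i j s r w $$ (p, p)"
      using assms 3 by (intro sum_supported_single) (auto simp: plane_rotation_def)
    then show ?thesis using assms 3 by (simp add: plane_rotation_def)
  next
    case 1
    have "(\<Sum>l<n. f l * plane_rotation n i j s r w $$ (l, p)) =
        f i * plane_rotation n i j s r w $$ (i, p) + f j * plane_rotation n i j s r w $$ (j, p)"
      using assms 1 by (intro sum_supported_pair) (auto simp: plane_rotation_def)
    then show ?thesis using assms 1 by (simp add: plane_rotation_def)
  next
    case 2
    have "(\<Sum>l<n. f l * plane_rotation n i j s r w $$ (l, p)) =
        f i * plane_rotation n i j s r w $$ (i, p) + f j * plane_rotation n i j s r w $$ (j, p)"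
      using assms 2 by (intro sum_supported_pair) (auto simp: plane_rotation_def)
    then show ?thesis using assms 2 by (simp add: plane_rotation_def)
  qed
qed

lemma conj_by_plane_rotation_diag:
  assumes A: "A \<in> carrier_mat n n" and ij: "i < n" "j < n" "i \<noteq> j" and p: "p < n"
  shows "conj_by (plane_rotation n i j s r w) A $$ (p, p) =
    (if p = i then of_real (s\<^sup>2) * A $$ (i, i) + of_real (r\<^sup>2) * (cnj w * w) * A $$ (j, j)
        + of_real (s * r) * (w * A $$ (i, j) + cnj w * A $$ (j, i))
     else if p = j then of_real (r\<^sup>2) * (cnj w * w) * A $$ (i, i) + of_real (s\<^sup>2) * A $$ (j, j)
        - of_real (s * r) * (w * A $$ (i, j) + cnj w * A $$ (j, i))
     else A $$ (p, p))"
proof -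
  let ?G = "plane_rotation n i j s r w"
  have G: "?G \<in> carrier_mat n n" by (simp add: plane_rotation_def)
  define g where "g l = (\<Sum>m<n. A $$ (l, m) * ?G $$ (m, p))" for l
  have "conj_by ?G A $$ (p, p) = (\<Sum>l<n. cnj (?G $$ (l, p)) * g l)"
    unfolding conj_by_entry[OF G A p p] g_def by (simp add: sum_distrib_left mult.assoc)
  also have "\<dots> = cnj (\<Sum>l<n. cnj (g l) * ?G $$ (l, p))" by (simp add: mult.commute)
  finally have "conj_by ?G A $$ (p, p) = cnj (\<Sum>l<n. cnj (g l) * ?G $$ (l, p))" .
  then show ?thesis
    unfolding plane_rotation_mult_sum[OF ij p] g_def
    by (simp add: algebra_simps power2_eq_square)
qed

lemma unitary_plane_rotation:
  assumes ij: "i < n" "j < n" "i \<noteq> j" and sr: "s\<^sup>2 + r\<^sup>2 = 1" and w: "cmod w = 1"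
  shows "plane_rotation n i j s r w \<in> unitary_mats n"
proof (rule unitary_matsI)
  let ?G = "plane_rotation n i j s r w"
  show G: "?G \<in> carrier_mat n n" by (simp add: plane_rotation_def)
  have ww: "cnj w * w = 1" using w complex_norm_square[of w] by (simp add: mult.commute)
  have sr': "complex_of_real s * of_real s + of_real r * of_real r = 1"
    using arg_cong[OF sr, of complex_of_real] by (simp add: power2_eq_square)
  have sr'': "complex_of_real s * of_real s + cnj w * (w * (of_real r * of_real r)) = 1"
    "of_real r * (of_real r * (cnj w * w)) + complex_of_real s * of_real s = 1"
    using sr' ww by (simp_all add: mult.assoc[symmetric] add.commute)
  show "mat_adjoint ?G * ?G = 1\<^sub>m n"
  proof (rule eq_matI)
    fix p q assume "p < dim_row (1\<^sub>m n :: complex mat)" "q < dim_col (1\<^sub>m n :: complex mat)"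
    then have pq: "p < n" "q < n" by auto
    have "(mat_adjoint ?G * ?G) $$ (p, q) = (\<Sum>l<n. cnj (?G $$ (l, p)) * ?G $$ (l, q))"
      using index_mult_mat_sum[OF carrier_mat_adjoint[OF G] G pq] G pq by simp
    also have "\<dots> = (if p = q then 1 else 0)"
      unfolding plane_rotation_mult_sum[OF ij pq(2)]
      using ij pq sr'' ww by (auto simp: plane_rotation_def mult_ac)
    finally show "(mat_adjoint ?G * ?G) $$ (p, q) = 1\<^sub>m n $$ (p, q)" using pq by simp
  qed (use G in auto)
qed

text \<open>A rotation in the plane of two coordinates averages the two diagonal entries, except for a
  contribution of the off-diagonal entry, which is removed by a suitable phase.\<close>

lemma orbit_diagonals_t_closed: "t_closed n (orbit_diagonals n c)"
  unfolding t_closed_def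
proof (intro ballI allI impI)
  fix x i j and t :: real
  assume x: "x \<in> orbit_diagonals n c" and ij: "i < n" "j < n" "i \<noteq> j" and t: "t \<in> {0..1}"
  obtain U where U: "U \<in> unitary_mats n" "\<And>i. i < n \<Longrightarrow> complex_of_real (x i) = conj_by U (real_diag n c) $$ (i, i)"
    using x by (auto simp: orbit_diagonals_def)
  define A where "A = conj_by U (real_diag n c)"
  have Uc: "U \<in> carrier_mat n n" by (rule unitary_carrier[OF U(1)])
  have A: "A \<in> carrier_mat n n" using Uc by (simp add: A_def)
  have "hermitian_mat (real_diag n c)" by (simp add: hermitian_mat_def mat_adjoint_diag)
  then have "hermitian_mat A" unfolding A_def by (rule hermitian_conj_by[OF Uc mat_diag_dim])
  then have Aji: "A $$ (j, i) = cnj (A $$ (i, j))" by (rule hermitian_entry[OF _ A ij(2,1)])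
  \<comment> \<open>A phase that makes the off-diagonal contribution purely imaginary.\<close>
  define w where "w = (if A $$ (i, j) = 0 then 1 else \<i> * cnj (A $$ (i, j)) / of_real (cmod (A $$ (i, j))))"
  have w: "cmod w = 1" by (simp add: w_def norm_divide norm_mult)
  have wA: "w * A $$ (i, j) + cnj w * A $$ (j, i) = 0"
    by (simp add: w_def Aji)
  have ww: "cnj w * w = 1" using w complex_norm_square[of w] by (simp add: mult.commute)
  define G where "G = plane_rotation n i j (sqrt t) (sqrt (1 - t)) w"
  have G: "G \<in> unitary_mats n"
    unfolding G_def using t by (intro unitary_plane_rotation ij w) simp
  have "complex_of_real (t_transform t i j x p) = conj_by (U * G) (real_diag n c) $$ (p, p)" if p: "p < n" for p
  proof -
    have "conj_by (U * G) (real_diag n c) = conj_by G A"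
      unfolding A_def by (rule conj_by_conj_by[symmetric, OF Uc unitary_carrier[OF G] mat_diag_dim])
    also have "\<dots> $$ (p, p) = (if p = i then of_real t * A $$ (i, i) + of_real (1 - t) * A $$ (j, j)
        else if p = j then of_real (1 - t) * A $$ (i, i) + of_real t * A $$ (j, j) else A $$ (p, p))"
      unfolding G_def conj_by_plane_rotation_diag[OF A ij p] wA ww using t by simp
    also have "\<dots> = complex_of_real (t_transform t i j x p)"
      using U(2)[OF p] U(2)[OF ij(1)] U(2)[OF ij(2)] ij by (simp add: A_def t_transform_def)
    finally show ?thesis by simp
  qed
  then show "t_transform t i j x \<in> orbit_diagonals n c"
    using unitary_mats_mult[OF U(1) G] by (auto simp: orbit_diagonals_def)
qed

lemma spectrum_in_orbit_diagonals: "c \<in> orbit_diagonals n c"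
  unfolding orbit_diagonals_def
  by (auto intro!: bexI[of _ "1\<^sub>m n"] simp: unitary_mats_one conj_by_one[of _ n]) (simp add: mat_diag_def)

text \<open>The linear image of the permutohedron of \<open>c\<close>. The diagonals of the orbit are majorized by \<open>c\<close>, and every T-closed set that contains \<open>c\<close>
  reaches all vectors majorized by \<open>c\<close>. Applied to the vectors whose permutations are mapped into the convex hull,
  this gives one inclusion; applied to the orbit itself, it gives the other one, because the
  majorized vectors form a convex set.\<close>

theorem schur_horn_image:
  fixes e :: "nat \<Rightarrow> 'v::real_vector"
  assumes c: "antimono_on {..<n} c"
  defines "L \<equiv> \<lambda>x. \<Sum>b<n. x b *\<^sub>R e b"
  shows "L ` orbit_diagonals n c = convex hull ((\<lambda>\<pi>. L (c \<circ> \<pi>)) ` {\<pi>. \<pi> permutes {..<n}})" (is "_ = convex hull ?S")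
proof
  have L_cong: "L x = L y" if "\<forall>i<n. x i = y i" for x y
    using that by (simp add: L_def)
  have L_comb: "L (\<lambda>i. a * x i + b * y i) = a *\<^sub>R L x + b *\<^sub>R L y" for a b x y
    by (simp add: L_def scaleR_add_left sum.distrib scaleR_sum_right)
  define E where "E = {z. \<forall>\<sigma>. \<sigma> permutes {..<n} \<longrightarrow> L (z \<circ> \<sigma>) \<in> convex hull ?S}"
  have "c \<in> E" by (auto simp: E_def intro!: hull_inc)
  have E: "t_closed n E"
    unfolding t_closed_def
  proof (intro ballI allI impI)
    fix z i j and t :: real
    assume z: "z \<in> E" and ij: "i < n" "j < n" "i \<noteq> j" and t: "t \<in> {0..1}"
    have "L (t_transform t i j z \<circ> \<sigma>) \<in> convex hull ?S" if \<sigma>: "\<sigma> permutes {..<n}" for \<sigma>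
    proof -
      have tr: "Transposition.transpose i j \<circ> \<sigma> permutes {..<n}"
        using \<sigma> ij by (intro permutes_compose permutes_swap_id) auto
      have "t_transform t i j z \<circ> \<sigma> =
          (\<lambda>a. t * (z \<circ> \<sigma>) a + (1 - t) * (z \<circ> (Transposition.transpose i j \<circ> \<sigma>)) a)"
        using ij by (auto simp: fun_eq_iff t_transform_def Transposition.transpose_def algebra_simps)
      then have eq: "L (t_transform t i j z \<circ> \<sigma>) = t *\<^sub>R L (z \<circ> \<sigma>) + (1 - t) *\<^sub>R L (z \<circ> (Transposition.transpose i j \<circ> \<sigma>))"
        by (simp only: L_comb)
      have "L (z \<circ> \<sigma>) \<in> convex hull ?S" "L (z \<circ> (Transposition.transpose i j \<circ> \<sigma>)) \<in> convex hull ?S"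
        using z \<sigma> tr by (auto simp: E_def)
      then show ?thesis unfolding eq by (rule convexD[OF convex_convex_hull]) (use t in auto)
    qed
    then show "t_transform t i j z \<in> E" by (simp add: E_def)
  qed
  show "L ` orbit_diagonals n c \<subseteq> convex hull ?S"
  proof
    fix y assume "y \<in> L ` orbit_diagonals n c"
    then obtain x where x: "y = L x" "x \<in> orbit_diagonals n c" by (rule imageE)
    have "\<exists>z\<in>E. \<forall>i<n. z i = x i"
      by (rule t_closed_reaches_majorized[OF E \<open>c \<in> E\<close> c orbit_diagonals_majorized[OF c x(2)]])
    then obtain z where z: "z \<in> E" "\<forall>i<n. z i = x i" by (rule bexE)
    have "L (z \<circ> id) \<in> convex hull ?S" using z(1)[unfolded E_def mem_Collect_eq, rule_format, OF permutes_id] .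
    then show "y \<in> convex hull ?S" unfolding x(1) L_cong[OF z(2), symmetric] by (simp only: comp_id)
  qed
  define M where "M = {x. majorized n x c}"
  have "convex (L ` M)"
    unfolding convex_def
  proof (intro ballI allI impI)
    fix p q and a b :: real
    assume "p \<in> L ` M" "q \<in> L ` M" and ab: "0 \<le> a" "0 \<le> b" "a + b = 1"
    then obtain x y where xy: "majorized n x c" "majorized n y c" "p = L x" "q = L y"
      unfolding M_def by (elim imageE CollectE)
    have "majorized n (\<lambda>i. a * x i + b * y i) c"
      unfolding majorized_def
    proof (intro conjI allI impI)
      have ab1: "a * s + b * s = s" for s using ab(3) by (simp flip: distrib_right)
      fix I assume "I \<subseteq> {..<n}"
      then have "a * (\<Sum>i\<in>I. x i) \<le> a * (\<Sum>a<card I. c a)" "b * (\<Sum>i\<in>I. y i) \<le> b * (\<Sum>a<card I. c a)"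
        using xy ab by (auto simp: majorized_def intro!: mult_left_mono)
      then show "(\<Sum>i\<in>I. a * x i + b * y i) \<le> (\<Sum>a<card I. c a)"
        using ab1[of "\<Sum>a<card I. c a"] by (simp add: sum.distrib flip: sum_distrib_left)
    next
      have ab1: "a * s + b * s = s" for s using ab(3) by (simp flip: distrib_right)
      show "(\<Sum>i<n. a * x i + b * y i) = (\<Sum>a<n. c a)"
        using xy ab1[of "\<Sum>a<n. c a"] by (simp add: majorized_def sum.distrib flip: sum_distrib_left)
    qed
    then show "a *\<^sub>R p + b *\<^sub>R q \<in> L ` M" unfolding xy(3,4) L_comb[symmetric] M_def by blast
  qed
  moreover have "?S \<subseteq> L ` M"
  proof
    fix y assume "y \<in> ?S"
    then obtain \<pi> where \<pi>: "\<pi> permutes {..<n}" "y = L (c \<circ> \<pi>)" by (elim imageE CollectE)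
    have "c \<circ> \<pi> \<in> orbit_diagonals n c"
      by (rule t_closed_permute[OF orbit_diagonals_t_closed \<pi>(1) spectrum_in_orbit_diagonals])
    then have "c \<circ> \<pi> \<in> M" unfolding M_def mem_Collect_eq by (rule orbit_diagonals_majorized[OF c])
    then show "y \<in> L ` M" unfolding \<pi>(2) by (rule imageI)
  qed
  ultimately have "convex hull ?S \<subseteq> L ` M" by (intro hull_minimal)
  also have "L ` M \<subseteq> L ` orbit_diagonals n c"
  proof
    fix y assume "y \<in> L ` M"
    then obtain x where x: "majorized n x c" "y = L x" unfolding M_def by (elim imageE CollectE)
    obtain z where z: "z \<in> orbit_diagonals n c" "\<forall>i<n. z i = x i"
      using t_closed_reaches_majorized[OF orbit_diagonals_t_closed spectrum_in_orbit_diagonals c x(1)] by (rule bexE)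
    show "y \<in> L ` orbit_diagonals n c" unfolding x(2) L_cong[OF z(2), symmetric] using z(1) by (rule imageI)
  qed
  finally show "convex hull ?S \<subseteq> L ` orbit_diagonals n c" .
qed

section \<open>Joint C-numerical ranges\<close>

definition joint_point :: "complex mat \<Rightarrow> complex mat list \<Rightarrow> complex mat \<Rightarrow> nat \<Rightarrow>\<^sub>0 complex" where
  "joint_point C As U = Poly_Mapping.nth (map (\<lambda>A. mat_trace (C * conj_by U A)) As)"

lemma joint_C_range_eq:
  assumes C: "C \<in> carrier_mat n n" and As: "set As \<subseteq> carrier_mat n n"
  shows "joint_C_range n C As = joint_point C As ` unitary_mats n"
proof -
  have eq: "map (\<lambda>A. mat_trace (C * mat_adjoint U * A * U)) As = map (\<lambda>A. mat_trace (C * conj_by U A)) As"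
    if U: "U \<in> unitary_mats n" for U
  proof (rule map_cong[OF refl])
    fix A assume "A \<in> set As"
    then have A: "A \<in> carrier_mat n n" using As by blast
    show "mat_trace (C * mat_adjoint U * A * U) = mat_trace (C * conj_by U A)"
      using C A unitary_carrier[OF U] by (simp add: conj_by_def assoc_sq[where n = n])
  qed
  show ?thesis
    unfolding joint_C_range_def setcompr_eq_image Collect_mem_eq
    by (rule image_cong[OF refl]) (simp only: joint_point_def eq)
qed

lemma lookup_scaleR_poly_mapping:
  "Poly_Mapping.lookup (r *\<^sub>R p) k = r *\<^sub>R Poly_Mapping.lookup p k" for p :: "'a \<Rightarrow>\<^sub>0 'b::real_vector"
proof -
  have "finite {i. r *\<^sub>R Poly_Mapping.lookup p i \<noteq> 0}"
    by (rule finite_subset[OF _ finite_lookup[of p]]) auto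
  then show ?thesis by (simp add: scaleR_poly_mapping_def Abs_poly_mapping_inverse)
qed

lemma nth_map_sum:
  "Poly_Mapping.nth (map (\<lambda>A. \<Sum>b<n. complex_of_real (x b) * f A b) As) =
    (\<Sum>b<n. x b *\<^sub>R Poly_Mapping.nth (map (\<lambda>A. f A b) As))"
proof (rule poly_mapping_eqI)
  fix k
  show "Poly_Mapping.lookup (Poly_Mapping.nth (map (\<lambda>A. \<Sum>b<n. complex_of_real (x b) * f A b) As)) k =
    Poly_Mapping.lookup (\<Sum>b<n. x b *\<^sub>R Poly_Mapping.nth (map (\<lambda>A. f A b) As)) k"
    by (simp add: lookup_sum lookup_scaleR_poly_mapping nth_default_def scaleR_conv_of_real)
qed

text \<open>If all \<open>A\<close> are diagonal in a common basis, the trace against \<open>A\<close> only sees the diagonal of the conjugate of \<open>C\<close> in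
  this basis. Hence the joint range is a linear image of the diagonals of the unitary orbit of \<open>C\<close>.\<close>

theorem diagonalizable_joint_range_polytope:
  assumes C: "C \<in> carrier_mat n n" "hermitian_mat C" and As: "set As \<subseteq> carrier_mat n n"
    and U0: "U0 \<in> unitary_mats n" and diag: "\<And>A. A \<in> set As \<Longrightarrow> \<exists>f. conj_by U0 A = mat_diag n f"
  shows "polytope (joint_C_range n C As)"
proof -
  obtain W c where W: "W \<in> unitary_mats n" and c: "antimono_on {..<n} c" and dC: "conj_by W C = real_diag n c"
    by (rule hermitian_spectral[OF C])
  define \<delta> where "\<delta> A b = conj_by U0 A $$ (b, b)" for A b
  define e where "e b = Poly_Mapping.nth (map (\<lambda>A. \<delta> A b) As)" for b
  have c0 [simp]: "U0 \<in> carrier_mat n n" "W \<in> carrier_mat n n" using U0 W by (auto intro: unitary_carrier)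
  have trace: "mat_trace (C * conj_by U A) = (\<Sum>b<n. complex_of_real (x b) * \<delta> A b)"
    if U: "U \<in> unitary_mats n" and A: "A \<in> set As"
      and x: "\<And>b. b < n \<Longrightarrow> complex_of_real (x b) = conj_by (mat_adjoint W * (mat_adjoint U * U0)) (real_diag n c) $$ (b, b)"
    for U A x
  proof -
    have Uc [simp]: "U \<in> carrier_mat n n" by (rule unitary_carrier[OF U])
    have Ac [simp]: "A \<in> carrier_mat n n" using A As by blast
    define Y where "Y = mat_adjoint U * U0"
    have Y: "Y \<in> unitary_mats n" unfolding Y_def by (intro unitary_mats_mult unitary_mats_adjoint U U0)
    have Yc [simp]: "Y \<in> carrier_mat n n" by (rule unitary_carrier[OF Y])
    have "conj_by Y (conj_by U A) = conj_by U0 A"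
    proof -
      have "U * Y = (U * mat_adjoint U) * U0" by (simp add: Y_def assoc_sq[where n = n])
      then have "U * Y = U0" using U by (simp add: unitary_mats_def)
      then show ?thesis using conj_by_conj_by[OF Uc Yc Ac] by simp
    qed
    moreover have "conj_by Y C = conj_by (mat_adjoint W * Y) (real_diag n c)"
    proof -
      have "C = conj_by (mat_adjoint W) (real_diag n c)" unfolding dC[symmetric] by (rule conj_by_adjoint_cancel(1)[OF W C(1), symmetric])
      then show ?thesis by (simp add: conj_by_conj_by[of _ n])
    qed
    moreover have "mat_trace (C * conj_by U A) = mat_trace (conj_by Y C * conj_by Y (conj_by U A))"
      using mat_trace_conj_by[OF Y, of "C * conj_by U A"] conj_by_mult[OF Y C(1), of "conj_by U A"] C(1) by simp
    ultimately have eq: "mat_trace (C * conj_by U A) = mat_trace (conj_by (mat_adjoint W * Y) (real_diag n c) * conj_by U0 A)"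
      by simp
    obtain f where f: "conj_by U0 A = mat_diag n f" using diag[OF A] by blast
    have Vc: "conj_by (mat_adjoint W * Y) (real_diag n c) \<in> carrier_mat n n" by simp
    have "mat_trace (conj_by (mat_adjoint W * Y) (real_diag n c) * mat_diag n f) =
        (\<Sum>b<n. conj_by (mat_adjoint W * Y) (real_diag n c) $$ (b, b) * f b)"
      unfolding mat_diag_mult_right[OF Vc] by (simp add: mat_trace_def)
    also have "\<dots> = (\<Sum>b<n. complex_of_real (x b) * \<delta> A b)"
      by (intro sum.cong refl) (simp add: x Y_def \<delta>_def f, simp add: mat_diag_def)
    finally show ?thesis unfolding eq f .
  qed
  have point: "joint_point C As U = (\<Sum>b<n. x b *\<^sub>R e b)"
    if U: "U \<in> unitary_mats n"
      and x: "\<And>b. b < n \<Longrightarrow> complex_of_real (x b) = conj_by (mat_adjoint W * (mat_adjoint U * U0)) (real_diag n c) $$ (b, b)"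
    for U x
  proof -
    have "map (\<lambda>A. mat_trace (C * conj_by U A)) As = map (\<lambda>A. \<Sum>b<n. complex_of_real (x b) * \<delta> A b) As"
      by (rule map_cong[OF refl]) (rule trace[OF U _ x])
    then show ?thesis unfolding joint_point_def e_def nth_map_sum[symmetric] by (rule arg_cong)
  qed
  have "joint_C_range n C As = (\<lambda>x. \<Sum>b<n. x b *\<^sub>R e b) ` orbit_diagonals n c"
    unfolding joint_C_range_eq[OF C(1) As]
  proof (intro equalityI subsetI)
    fix p assume "p \<in> joint_point C As ` unitary_mats n"
    then obtain U where U: "U \<in> unitary_mats n" "p = joint_point C As U" by blast
    define V where "V = mat_adjoint W * (mat_adjoint U * U0)"
    have V: "V \<in> unitary_mats n" unfolding V_def by (intro unitary_mats_mult unitary_mats_adjoint U U0 W)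
    define x where "x b = Re (conj_by V (real_diag n c) $$ (b, b))" for b
    have x: "complex_of_real (x b) = conj_by V (real_diag n c) $$ (b, b)" if b: "b < n" for b
    proof -
      have "hermitian_mat (real_diag n c)" by (simp add: hermitian_mat_def mat_adjoint_diag)
      then have "hermitian_mat (conj_by V (real_diag n c))"
        by (intro hermitian_conj_by[OF unitary_carrier[OF V]]) auto
      then have "conj_by V (real_diag n c) $$ (b, b) = cnj (conj_by V (real_diag n c) $$ (b, b))"
        using hermitian_entry[OF _ carrier_conj_by[OF unitary_carrier[OF V] mat_diag_dim] b b] by blast
      then show ?thesis unfolding x_def by (metis Reals_cnj_iff of_real_Re)
    qed
    have "x \<in> orbit_diagonals n c" unfolding orbit_diagonals_def using V x by blast
    moreover have "p = (\<Sum>b<n. x b *\<^sub>R e b)" unfolding U(2) by (rule point[OF U(1)]) (use x in \<open>simp add: V_def\<close>)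
    ultimately show "p \<in> (\<lambda>x. \<Sum>b<n. x b *\<^sub>R e b) ` orbit_diagonals n c" by blast
  next
    fix p assume "p \<in> (\<lambda>x. \<Sum>b<n. x b *\<^sub>R e b) ` orbit_diagonals n c"
    then obtain x V where x: "p = (\<Sum>b<n. x b *\<^sub>R e b)" and V: "V \<in> unitary_mats n"
      and xV: "\<And>b. b < n \<Longrightarrow> complex_of_real (x b) = conj_by V (real_diag n c) $$ (b, b)"
      unfolding orbit_diagonals_def by blast
    define U where "U = U0 * (mat_adjoint V * mat_adjoint W)"
    have U: "U \<in> unitary_mats n" unfolding U_def by (intro unitary_mats_mult unitary_mats_adjoint V U0 W)
    have [simp]: "V \<in> carrier_mat n n" by (rule unitary_carrier[OF V])
    have "mat_adjoint W * (mat_adjoint U * U0) = (mat_adjoint W * W) * (V * (mat_adjoint U0 * U0))"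
      by (simp add: U_def mat_adjoint_mult[of _ n n _ n] assoc_sq[where n = n])
    also have "\<dots> = V" using W U0 by (simp add: unitary_mats_def)
    finally have "p = joint_point C As U" unfolding x using point[OF U, of x] xV by simp
    then show "p \<in> joint_point C As ` unitary_mats n" using U by blast
  qed
  also have "\<dots> = convex hull ((\<lambda>\<pi>. (\<lambda>x. \<Sum>b<n. x b *\<^sub>R e b) (c \<circ> \<pi>)) ` {\<pi>. \<pi> permutes {..<n}})"
    by (rule schur_horn_image[OF c])
  finally show ?thesis unfolding polytope_def using finite_permutations[of "{..<n}"] by blast
qed

text \<open>The flag selects the real or the imaginary part, so that the four combinations of parts of two
  matrices can be treated at once.\<close>

definition hermitian_part :: "bool \<Rightarrow> complex mat \<Rightarrow> complex mat" where
  "hermitian_part s X = (if s then re_part X else im_part X)"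

definition real_coord :: "bool \<Rightarrow> complex \<Rightarrow> real" where
  "real_coord s z = (if s then Re z else Im z)"

lemma carrier_hermitian_part [simp]: "X \<in> carrier_mat n n \<Longrightarrow> hermitian_part s X \<in> carrier_mat n n"
  by (simp add: hermitian_part_def)

lemma trace_hermitian_part:
  assumes C: "C \<in> carrier_mat n n" "hermitian_mat C" and X: "X \<in> carrier_mat n n" and U: "U \<in> carrier_mat n n"
  shows "Re (mat_trace (C * conj_by U (hermitian_part s X))) = real_coord s (mat_trace (C * conj_by U X))"
proof -
  have "mat_trace (C * conj_by U (mat_adjoint X)) = mat_trace (conj_by U (mat_adjoint X) * C)"
    using C X U by (intro mat_trace_commute[of _ n n]) auto
  also have "conj_by U (mat_adjoint X) * C = mat_adjoint (C * conj_by U X)"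
    using C X U by (simp add: mat_adjoint_mult[of _ n n _ n] mat_adjoint_conj_by[of _ n] hermitian_mat_def)
  also have "mat_trace \<dots> = cnj (mat_trace (C * conj_by U X))"
    using C X U by (intro mat_trace_adjoint[of _ n]) auto
  finally have adj: "mat_trace (C * conj_by U (mat_adjoint X)) = cnj (mat_trace (C * conj_by U X))" .
  have comb: "mat_trace (C * conj_by U (a \<cdot>\<^sub>m X + b \<cdot>\<^sub>m mat_adjoint X)) =
      a * mat_trace (C * conj_by U X) + b * cnj (mat_trace (C * conj_by U X))" for a b
    unfolding adj[symmetric]
    using C X U by (simp add: conj_by_add[of _ n] conj_by_smult[of _ n] mult_add_distrib_mat[of _ n n _ n]
        mult_smult_distrib[of _ n n _ n] mat_trace_add[of _ n] mat_trace_smult[of _ n])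
  show ?thesis
    by (auto simp: hermitian_part_def real_coord_def re_part_def im_part_def comb)
qed

text \<open>Taking the real or imaginary part of two chosen coordinates is a linear map of the joint range onto a planar range
  of two Hermitian matrices.\<close>

theorem polytope_imp_parts_commute:
  assumes C: "C \<in> carrier_mat n n" "hermitian_mat C" and gap: "has_central_gap n C"
    and As: "set As \<subseteq> carrier_mat n n" and poly: "polytope (joint_C_range n C As)"
    and ab: "a < length As" "b < length As"
  shows "hermitian_part s (As ! a) * hermitian_part t (As ! b) = hermitian_part t (As ! b) * hermitian_part s (As ! a)"
proof -
  obtain c k where c: "ordered_eigenvalues n C c" and k: "central_index n k" "c (k + 1) < c k"
    using gap by (auto simp: has_central_gap_def)
  obtain W where W: "W \<in> unitary_mats n" and dC: "conj_by W C = real_diag n (\<lambda>i. c (Suc i))"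
    and mono: "antimono_on {..<n} (\<lambda>i. c (Suc i))"
    by (rule ordered_eigenvalues_diagonalize[OF C c])
  have k1: "1 \<le> k" using k(1) by (simp add: central_index_def)
  define X where "X = As ! a"
  define Y where "Y = As ! b"
  have XY: "X \<in> carrier_mat n n" "Y \<in> carrier_mat n n"
    using As ab nth_mem unfolding X_def Y_def by blast+
  define H where "H = hermitian_part s X"
  define K where "K = hermitian_part t Y"
  have HK: "H \<in> carrier_mat n n" "K \<in> carrier_mat n n" using XY by (simp_all add: H_def K_def)
  have herm: "hermitian_mat H" "hermitian_mat K"
    using hermitian_parts[OF XY(1)] hermitian_parts[OF XY(2)] by (simp_all add: H_def K_def hermitian_part_def)
  define \<phi> where "\<phi> p = Complex (real_coord s (Poly_Mapping.lookup p a)) (real_coord t (Poly_Mapping.lookup p b))"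
    for p :: "nat \<Rightarrow>\<^sub>0 complex"
  have "linear \<phi>"
    by (rule linearI) (auto simp: \<phi>_def real_coord_def lookup_add lookup_scaleR_poly_mapping complex_eq_iff)
  then have poly': "polytope (\<phi> ` joint_C_range n C As)" using poly by (rule polytope_linear_image)
  have Wc [simp]: "W \<in> carrier_mat n n" by (rule unitary_carrier[OF W])
  have pt: "trace_point n (\<lambda>i. c (Suc i)) H K (U * W) = \<phi> (joint_point C As U)" if U: "U \<in> unitary_mats n" for U
  proof -
    have Uc [simp]: "U \<in> carrier_mat n n" by (rule unitary_carrier[OF U])
    have tr: "mat_trace (real_diag n (\<lambda>i. c (Suc i)) * conj_by (U * W) A) = mat_trace (C * conj_by U A)"
      if A: "A \<in> carrier_mat n n" for A
    proof -
      have "real_diag n (\<lambda>i. c (Suc i)) * conj_by (U * W) A = conj_by W (C * conj_by U A)"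
        unfolding dC[symmetric] conj_by_conj_by[OF Uc Wc A, symmetric]
        using C A by (simp add: conj_by_mult[OF W])
      then show ?thesis using mat_trace_conj_by[OF W, of "C * conj_by U A"] C A by simp
    qed
    show ?thesis
      unfolding trace_point_def tr[OF HK(1)] tr[OF HK(2)] \<phi>_def joint_point_def
      using trace_hermitian_part[OF C XY(1) Uc, of s] trace_hermitian_part[OF C XY(2) Uc, of t] ab
      by (simp add: H_def K_def X_def Y_def nth_default_def)
  qed
  have "trace_point n (\<lambda>i. c (Suc i)) H K ` unitary_mats n = \<phi> ` joint_C_range n C As"
    unfolding joint_C_range_eq[OF C(1) As]
  proof (intro equalityI subsetI)
    fix z assume "z \<in> trace_point n (\<lambda>i. c (Suc i)) H K ` unitary_mats n"
    then obtain V where V: "V \<in> unitary_mats n" "z = trace_point n (\<lambda>i. c (Suc i)) H K V" by blast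
    have VW: "V * mat_adjoint W \<in> unitary_mats n" by (intro unitary_mats_mult unitary_mats_adjoint V W)
    have "V * mat_adjoint W * W = V"
      using W unitary_carrier[OF V(1)] by (simp add: assoc_sq[where n = n] unitary_mats_def)
    then have "z = \<phi> (joint_point C As (V * mat_adjoint W))" using pt[OF VW] V(2) by simp
    then show "z \<in> \<phi> ` joint_point C As ` unitary_mats n" using VW by blast
  next
    fix z assume "z \<in> \<phi> ` joint_point C As ` unitary_mats n"
    then obtain U where U: "U \<in> unitary_mats n" "z = \<phi> (joint_point C As U)" by blast
    then have "z = trace_point n (\<lambda>i. c (Suc i)) H K (U * W)" using pt by simp
    then show "z \<in> trace_point n (\<lambda>i. c (Suc i)) H K ` unitary_mats n" using unitary_mats_mult[OF U(1) W] by blast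
  qed
  then have "polytope (trace_point n (\<lambda>i. c (Suc i)) H K ` unitary_mats n)" using poly' by simp
  then have "H * K = K * H"
    using polygonal_trace_range_imp_commute[OF HK herm mono k(1)] k k1 by simp
  then show ?thesis by (simp add: H_def K_def X_def Y_def)
qed

section \<open>Star-commuting families\<close>

text \<open>The condition at the centre of all equivalences: it can be compared directly with the commutation of
  Hermitian parts, and it passes to linear spans.\<close>

definition star_commuting :: "complex mat set \<Rightarrow> bool" where
  "star_commuting S \<longleftrightarrow> (\<forall>X\<in>S \<union> adjoints S. \<forall>Y\<in>S \<union> adjoints S. X * Y = Y * X)"

lemma adjoints_adjoints [simp]: "adjoints (adjoints S) = S"
  by (auto simp: adjoints_def image_image)

lemma adjoints_Un [simp]: "adjoints (S \<union> T) = adjoints S \<union> adjoints T"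
  by (auto simp: adjoints_def)

lemma adjoints_carrier: "S \<subseteq> carrier_mat n n \<Longrightarrow> adjoints S \<subseteq> carrier_mat n n"
  by (auto simp: adjoints_def)

lemma star_commuting_simps [simp]:
  "star_commuting (adjoints S) = star_commuting S" "star_commuting (S \<union> adjoints S) = star_commuting S"
  by (auto simp: star_commuting_def)

lemma star_commuting_mono: "star_commuting T \<Longrightarrow> S \<subseteq> T \<Longrightarrow> star_commuting S"
  unfolding star_commuting_def adjoints_def by blast

lemma star_commuting_imp_commuting_normal: "star_commuting S \<Longrightarrow> commuting_normal S"
  by (auto simp: star_commuting_def commuting_normal_def normal_mat_def adjoints_def)

lemma commuting_normal_imp_star_commuting:
  assumes T: "T \<subseteq> carrier_mat n n" and cn: "commuting_normal T"
  shows "star_commuting T"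
proof -
  have fug: "mat_adjoint X * Y = Y * mat_adjoint X" if "X \<in> T" "Y \<in> T" for X Y
    using fuglede[of X n Y] that T cn by (auto simp: commuting_normal_def)
  have adj: "mat_adjoint X * mat_adjoint Y = mat_adjoint Y * mat_adjoint X" if XY: "X \<in> T" "Y \<in> T" for X Y
  proof -
    have "X \<in> carrier_mat n n" "Y \<in> carrier_mat n n" using XY T by auto
    then have "mat_adjoint X * mat_adjoint Y = mat_adjoint (Y * X)" "mat_adjoint Y * mat_adjoint X = mat_adjoint (X * Y)"
      by (simp_all add: mat_adjoint_mult[of _ n n _ n])
    then show ?thesis using cn XY by (simp add: commuting_normal_def)
  qed
  show ?thesis
    unfolding star_commuting_def adjoints_def
    using fug adj cn by (auto simp: commuting_normal_def)
qed

lemma commuting_parts_imp_star_commute: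
  assumes XY: "X \<in> carrier_mat n n" "Y \<in> carrier_mat n n"
    and comm: "\<And>s t. hermitian_part s X * hermitian_part t Y = hermitian_part t Y * hermitian_part s X"
    and X': "X' \<in> {X, mat_adjoint X}" and Y': "Y' \<in> {Y, mat_adjoint Y}"
  shows "X' * Y' = Y' * X'"
proof -
  have c: "re_part X \<in> carrier_mat n n" "im_part X \<in> carrier_mat n n" "re_part Y \<in> carrier_mat n n" "im_part Y \<in> carrier_mat n n"
    using XY by simp_all
  have comm': "re_part X * re_part Y = re_part Y * re_part X" "re_part X * im_part Y = im_part Y * re_part X"
    "im_part X * re_part Y = re_part Y * im_part X" "im_part X * im_part Y = im_part Y * im_part X"
    using comm[of True True] comm[of True False] comm[of False True] comm[of False False]
    by (simp_all add: hermitian_part_def)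
  obtain x where x: "X' = 1 \<cdot>\<^sub>m re_part X + x \<cdot>\<^sub>m im_part X"
    using X' cartesian_decomposition[OF XY(1)] by auto
  obtain y where y: "Y' = 1 \<cdot>\<^sub>m re_part Y + y \<cdot>\<^sub>m im_part Y"
    using Y' cartesian_decomposition[OF XY(2)] by auto
  have X'c: "X' \<in> carrier_mat n n" using X' XY by auto
  have "re_part X * Y' = Y' * re_part X" unfolding y by (rule commute_lincomb[OF c(1,3,4) comm'(1,2)])
  moreover have "im_part X * Y' = Y' * im_part X" unfolding y by (rule commute_lincomb[OF c(2,3,4) comm'(3,4)])
  moreover have "Y' \<in> carrier_mat n n" using Y' XY by auto
  ultimately show ?thesis unfolding x using commute_lincomb[of Y' n "re_part X" "im_part X" 1 x] c by simp
qed

lemma polytope_imp_star_commuting: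
  assumes C: "C \<in> carrier_mat n n" "hermitian_mat C" "has_central_gap n C"
    and As: "set As \<subseteq> carrier_mat n n" and poly: "polytope (joint_C_range n C As)"
  shows "star_commuting (set As)"
  unfolding star_commuting_def
proof (intro ballI)
  fix X' Y' assume "X' \<in> set As \<union> adjoints (set As)" "Y' \<in> set As \<union> adjoints (set As)"
  then obtain X Y where XY: "X \<in> set As" "Y \<in> set As" "X' \<in> {X, mat_adjoint X}" "Y' \<in> {Y, mat_adjoint Y}"
    unfolding adjoints_def by blast
  then obtain a b where ab: "a < length As" "b < length As" "X = As ! a" "Y = As ! b"
    by (metis in_set_conv_nth)
  show "X' * Y' = Y' * X'"
  proof (rule commuting_parts_imp_star_commute[OF _ _ _ XY(3,4)])
    show "hermitian_part s X * hermitian_part t Y = hermitian_part t Y * hermitian_part s X" for s t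
      unfolding ab(3,4) by (rule polytope_imp_parts_commute[OF C As poly ab(1,2)])
  qed (use XY As in auto)
qed

lemma pairwise_C_range_imp_star_commuting:
  assumes S: "S \<subseteq> carrier_mat n n" and pw: "pairwise_C_range_polyhedral n S"
  shows "star_commuting S"
proof -
  obtain C where C: "C \<in> carrier_mat n n" "hermitian_mat C" "has_central_gap n C"
    and poly: "\<And>X Y. X \<in> S \<Longrightarrow> Y \<in> S \<Longrightarrow> polytope (joint_C_range n C [X, Y])"
    using pw by (auto simp: pairwise_C_range_polyhedral_def)
  have pair: "star_commuting {X, Y}" if "X \<in> S" "Y \<in> S" for X Y
    using polytope_imp_star_commuting[OF C _ poly[OF that]] that S by auto
  show ?thesis
    unfolding star_commuting_def
  proof (intro ballI)
    fix X' Y' assume "X' \<in> S \<union> adjoints S" "Y' \<in> S \<union> adjoints S"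
    then obtain X Y where "X \<in> S" "Y \<in> S" "X' \<in> {X, mat_adjoint X}" "Y' \<in> {Y, mat_adjoint Y}"
      unfolding adjoints_def by blast
    then show "X' * Y' = Y' * X'" using pair[of X Y] unfolding star_commuting_def adjoints_def by blast
  qed
qed

lemma basis_C_range_imp_star_commuting:
  "set Bs \<subseteq> carrier_mat n n \<Longrightarrow> basis_C_range_polyhedral n Bs \<Longrightarrow> star_commuting (set Bs)"
  unfolding basis_C_range_polyhedral_def using polytope_imp_star_commuting by blast

definition block_projection :: "nat \<Rightarrow> nat \<Rightarrow> complex mat" where
  "block_projection n k = diag_block_mat [1\<^sub>m k, 0\<^sub>m (n - k) (n - k)]"

lemma block_projection_eq:
  assumes "k \<le> n"
  shows "block_projection n k = coord_projection n k"
  using assms unfolding block_projection_def coord_projection_def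
  by (intro eq_matI) (auto simp: mat_diag_def Let_def)

lemma char_poly_diag: "char_poly (mat_diag n f) = (\<Prod>a\<leftarrow>map f [0..<n]. [:- a, 1:])"
proof -
  have "upper_triangular (mat_diag n f)" by (auto simp: mat_diag_def)
  then have "char_poly (mat_diag n f) = (\<Prod>a\<leftarrow>diag_mat (mat_diag n f). [:- a, 1:])"
    by (intro char_poly_upper_triangular[of _ n]) auto
  moreover have "diag_mat (mat_diag n f) = map f [0..<n]"
    by (auto simp: diag_mat_def mat_diag_def)
  ultimately show ?thesis by simp
qed

text \<open>The joint \<open>k\<close>-numerical range is the special case of a spectrum with its only gap at \<open>k\<close>.\<close>

lemma block_projection_gap:
  assumes k: "central_index n k"
  shows "block_projection n k \<in> carrier_mat n n" "hermitian_mat (block_projection n k)"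
    "has_central_gap n (block_projection n k)"
proof -
  have kn: "1 \<le> k" "k < n" using k by (auto simp: central_index_def)
  have proj: "projection_mat n k (coord_projection n k)" by (rule projection_mat_coord) (use kn in simp)
  have eq: "block_projection n k = coord_projection n k" by (rule block_projection_eq) (use kn in simp)
  show "block_projection n k \<in> carrier_mat n n" "hermitian_mat (block_projection n k)"
    using proj by (simp_all add: eq projection_mat_def)
  define c where "c i = (if i \<le> k then 1 else 0 :: real)" for i :: nat
  have "char_poly (coord_projection n k) = (\<Prod>i\<in>{0..<n}. [:- complex_of_real (c (Suc i)), 1:])"
    unfolding coord_projection_def char_poly_diag
    by (simp add: prod.distinct_set_conv_list[symmetric] o_def c_def) (intro prod.cong; auto)
  also have "\<dots> = (\<Prod>i\<in>{1..n}. [:- complex_of_real (c i), 1:])"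
    by (rule prod.reindex_bij_witness[of _ "\<lambda>i. i - 1" Suc]) auto
  finally have "ordered_eigenvalues n (block_projection n k) c"
    by (simp add: ordered_eigenvalues_def eq c_def)
  moreover have "c (k + 1) < c k" by (simp add: c_def)
  ultimately show "has_central_gap n (block_projection n k)" using k unfolding has_central_gap_def by blast
qed

lemma pairwise_k_imp_pairwise_C:
  "pairwise_k_range_polyhedral n S \<Longrightarrow> pairwise_C_range_polyhedral n S"
  unfolding pairwise_k_range_polyhedral_def pairwise_C_range_polyhedral_def joint_k_range_def
    block_projection_def[symmetric]
  using block_projection_gap by blast

text \<open>Some central index always exists, so the conditions that assert the existence of a suitable \<open>C\<close> or \<open>k\<close> follow from the condition on all \<open>C\<close>.\<close>

lemma central_index_half: "2 \<le> n \<Longrightarrow> central_index n (n div 2)"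
  by (auto simp: central_index_def)


section \<open>Spans and bases of matrices\<close>

abbreviation mat_space :: "nat \<Rightarrow> (complex, complex mat) module" where
  "mat_space n \<equiv> module_mat TYPE(complex) n n"

interpretation mat_space: vectorspace "class_ring :: complex ring" "mat_space n" for n
  by (rule matrix_vs)

lemma submodule_mat_iff:
  "submodule class_ring N (mat_space n) \<longleftrightarrow> N \<subseteq> carrier_mat n n \<and> 0\<^sub>m n n \<in> N \<and>
    (\<forall>A\<in>N. \<forall>B\<in>N. A + B \<in> N) \<and> (\<forall>c. \<forall>A\<in>N. c \<cdot>\<^sub>m A \<in> N)"
proof -
  have carrier_UNIV: "carrier (class_ring :: complex ring) = UNIV" by simp
  show ?thesis
    unfolding submodule_def module_mat_simps carrier_UNIV using mat_space.module_axioms[of n] by blast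
qed

lemma cspan_submodule: "S \<subseteq> carrier_mat n n \<Longrightarrow> submodule class_ring (cspan n S) (mat_space n)"
  using mat_space.span_is_submodule[of S n] by (simp only: module_mat_simps)

lemma cspan_carrier: "S \<subseteq> carrier_mat n n \<Longrightarrow> cspan n S \<subseteq> carrier_mat n n"
  using cspan_submodule[of S n] unfolding submodule_mat_iff by (rule conjunct1)

lemma subset_cspan: "S \<subseteq> carrier_mat n n \<Longrightarrow> S \<subseteq> cspan n S"
  using mat_space.in_own_span[of S n] by (simp only: module_mat_simps)

lemma cspan_least: "S \<subseteq> N \<Longrightarrow> submodule class_ring N (mat_space n) \<Longrightarrow> cspan n S \<subseteq> N"
  by (rule mat_space.span_is_subset)

lemma cspan_subset_cspan:
  "S \<subseteq> cspan n T \<Longrightarrow> T \<subseteq> carrier_mat n n \<Longrightarrow> cspan n S \<subseteq> cspan n T"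
  by (intro cspan_least cspan_submodule)

lemma commutant_submodule:
  assumes "S \<subseteq> carrier_mat n n"
  shows "submodule class_ring {A \<in> carrier_mat n n. \<forall>B\<in>S. A * B = B * A} (mat_space n)"
  unfolding submodule_mat_iff
proof (intro conjI ballI allI)
  show "0\<^sub>m n n \<in> {A \<in> carrier_mat n n. \<forall>B\<in>S. A * B = B * A}"
    using assms by auto
  show "A + A' \<in> {A \<in> carrier_mat n n. \<forall>B\<in>S. A * B = B * A}"
    if "A \<in> {A \<in> carrier_mat n n. \<forall>B\<in>S. A * B = B * A}" "A' \<in> {A \<in> carrier_mat n n. \<forall>B\<in>S. A * B = B * A}" for A A'
    using that assms
    by (auto simp: subset_iff mult_add_distrib_mat[of _ n n _ n] add_mult_distrib_mat[of _ n n _ _ n])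
  show "c \<cdot>\<^sub>m A \<in> {A \<in> carrier_mat n n. \<forall>B\<in>S. A * B = B * A}"
    if "A \<in> {A \<in> carrier_mat n n. \<forall>B\<in>S. A * B = B * A}" for c A
    using that assms
    by (auto simp: subset_iff mult_smult_distrib[of _ n n _ n] mult_smult_assoc_mat[of _ n n _ n])
qed auto

text \<open>Two applications of the fact that a commutant is a subspace, one for each factor.\<close>

lemma cspan_commute:
  assumes S: "S \<subseteq> carrier_mat n n" and comm: "\<And>A B. A \<in> S \<Longrightarrow> B \<in> S \<Longrightarrow> A * B = B * A"
    and AB: "A \<in> cspan n S" "B \<in> cspan n S"
  shows "A * B = B * A"
proof -
  have 1: "cspan n S \<subseteq> {A \<in> carrier_mat n n. \<forall>B\<in>S. A * B = B * A}"
    by (rule cspan_least[OF _ commutant_submodule[OF S]]) (use S comm in auto)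
  have "cspan n S \<subseteq> {A \<in> carrier_mat n n. \<forall>B\<in>cspan n S. A * B = B * A}"
    by (rule cspan_least[OF _ commutant_submodule[OF cspan_carrier[OF S]]]) (use S 1 in force)
  with AB show ?thesis by blast
qed

lemma adjoints_submodule:
  assumes "submodule class_ring N (mat_space n)"
  shows "submodule class_ring (adjoints N) (mat_space n)"
proof -
  have N: "N \<subseteq> carrier_mat n n" "0\<^sub>m n n \<in> N" "\<And>A B. A \<in> N \<Longrightarrow> B \<in> N \<Longrightarrow> A + B \<in> N"
    "\<And>c A. A \<in> N \<Longrightarrow> c \<cdot>\<^sub>m A \<in> N"
    using assms unfolding submodule_mat_iff by blast+
  have "mat_adjoint (0\<^sub>m n n) = (0\<^sub>m n n :: complex mat)" by (intro eq_matI) auto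
  then have "0\<^sub>m n n \<in> adjoints N" using N(2) unfolding adjoints_def by (metis imageI)
  moreover have "A + B \<in> adjoints N" if "A \<in> adjoints N" "B \<in> adjoints N" for A B
  proof -
    obtain A' B' where "A' \<in> N" "B' \<in> N" "A = mat_adjoint A'" "B = mat_adjoint B'"
      using \<open>A \<in> adjoints N\<close> \<open>B \<in> adjoints N\<close> unfolding adjoints_def by blast
    then show ?thesis
      using N(1,3) mat_adjoint_add[of A' n n B'] unfolding adjoints_def by (metis imageI subsetD)
  qed
  moreover have "c \<cdot>\<^sub>m A \<in> adjoints N" if A: "A \<in> adjoints N" for c A
  proof -
    obtain A' where A': "A' \<in> N" "A = mat_adjoint A'" using A unfolding adjoints_def by blast
    then have "c \<cdot>\<^sub>m A = mat_adjoint (cnj c \<cdot>\<^sub>m A')" by (simp add: mat_adjoint_smult)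
    then show ?thesis using N(4)[OF A'(1)] unfolding adjoints_def by blast
  qed
  ultimately show ?thesis using adjoints_carrier[OF N(1)] unfolding submodule_mat_iff by blast
qed

lemma adjoints_cspan_subset:
  assumes S: "S \<subseteq> carrier_mat n n"
  shows "adjoints (cspan n S) \<subseteq> cspan n (adjoints S)"
proof -
  have "cspan n S \<subseteq> adjoints (cspan n (adjoints S))"
  proof (rule cspan_least)
    have "adjoints S \<subseteq> cspan n (adjoints S)" by (rule subset_cspan[OF adjoints_carrier[OF S]])
    then have "adjoints (adjoints S) \<subseteq> adjoints (cspan n (adjoints S))" unfolding adjoints_def by (rule image_mono)
    then show "S \<subseteq> adjoints (cspan n (adjoints S))" by simp
  qed (intro adjoints_submodule cspan_submodule adjoints_carrier S)
  then have "adjoints (cspan n S) \<subseteq> adjoints (adjoints (cspan n (adjoints S)))"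
    unfolding adjoints_def by (rule image_mono)
  then show ?thesis by simp
qed

lemma star_commuting_cspan:
  assumes S: "S \<subseteq> carrier_mat n n" and comm: "star_commuting S"
  shows "star_commuting (cspan n (S \<union> adjoints S))"
proof -
  define T where "T = S \<union> adjoints S"
  have T: "T \<subseteq> carrier_mat n n" "adjoints T = T" using S adjoints_carrier[OF S] by (auto simp: T_def)
  have "adjoints (cspan n T) \<subseteq> cspan n T" using adjoints_cspan_subset[OF T(1)] T(2) by simp
  moreover have "A * B = B * A" if "A \<in> cspan n T" "B \<in> cspan n T" for A B
    by (rule cspan_commute[OF T(1) _ that]) (use comm in \<open>auto simp: star_commuting_def T_def\<close>)
  ultimately show ?thesis unfolding star_commuting_def T_def[symmetric] by blast
qed

lemma parts_in_cspan:
  assumes X: "X \<in> cspan n (F \<union> adjoints F)" and F: "F \<subseteq> carrier_mat n n"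
  shows "hermitian_part s X \<in> cspan n (F \<union> adjoints F)"
proof -
  have c: "F \<union> adjoints F \<subseteq> carrier_mat n n" using F adjoints_carrier[OF F] by blast
  have sub: "A + B \<in> cspan n (F \<union> adjoints F)" "a \<cdot>\<^sub>m A \<in> cspan n (F \<union> adjoints F)"
    if "A \<in> cspan n (F \<union> adjoints F)" "B \<in> cspan n (F \<union> adjoints F)" for A B a
    using cspan_submodule[OF c] that unfolding submodule_mat_iff by blast+
  have "mat_adjoint X \<in> adjoints (cspan n (F \<union> adjoints F))" using X by (simp add: adjoints_def)
  then have "mat_adjoint X \<in> cspan n (F \<union> adjoints F)"
    using adjoints_cspan_subset[OF c] by (auto simp: Un_commute)
  then show ?thesis
    using X by (auto simp: hermitian_part_def re_part_def im_part_def intro!: sub)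
qed

theorem star_commuting_imp_all_polyhedral:
  assumes F: "F \<subseteq> carrier_mat n n" and comm: "star_commuting F"
  shows "all_C_ranges_polyhedral n F"
  unfolding all_C_ranges_polyhedral_def
proof (intro ballI allI impI)
  fix C As assume C: "C \<in> carrier_mat n n" "hermitian_mat C" and As: "set As \<subseteq> cspan n (F \<union> adjoints F)"
  define W where "W = cspan n (F \<union> adjoints F)"
  have W: "W \<subseteq> carrier_mat n n" unfolding W_def using F adjoints_carrier[OF F] by (intro cspan_carrier) blast
  have WW: "A * B = B * A" if "A \<in> W" "B \<in> W" for A B
    using star_commuting_cspan[OF F comm] that unfolding star_commuting_def W_def by blast
  define T where "T = {hermitian_part s X | s X. X \<in> W}"
  have TW: "T \<subseteq> W" using parts_in_cspan[OF _ F] unfolding T_def W_def by blast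
  have "\<exists>U\<in>unitary_mats n. \<forall>A\<in>T. \<exists>f. conj_by U A = mat_diag n f"
  proof (rule simultaneous_diagonalization)
    show "T \<subseteq> carrier_mat n n" using TW W by blast
    show "hermitian_mat A" if "A \<in> T" for A
    proof -
      obtain s X where X: "X \<in> W" "A = hermitian_part s X" using \<open>A \<in> T\<close> unfolding T_def by blast
      then show ?thesis using hermitian_parts[of X n] W by (auto simp: hermitian_part_def)
    qed
    show "A * B = B * A" if "A \<in> T" "B \<in> T" for A B using WW TW that by blast
  qed
  then obtain U where U: "U \<in> unitary_mats n" "\<forall>A\<in>T. \<exists>f. conj_by U A = mat_diag n f" by blast
  have diag: "\<exists>f. conj_by U X = mat_diag n f" if X: "X \<in> W" for X
  proof -
    have Xc: "X \<in> carrier_mat n n" using X W by blast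
    have "hermitian_part True X \<in> T" "hermitian_part False X \<in> T" using X unfolding T_def by blast+
    then have "re_part X \<in> T" "im_part X \<in> T" by (simp_all add: hermitian_part_def)
    then obtain f g where fg: "conj_by U (re_part X) = mat_diag n f" "conj_by U (im_part X) = mat_diag n g"
      using U(2) by blast
    have "conj_by U X = 1 \<cdot>\<^sub>m conj_by U (re_part X) + \<i> \<cdot>\<^sub>m conj_by U (im_part X)"
      using Xc unitary_carrier[OF U(1)]
      by (subst cartesian_decomposition(1)[OF Xc]) (simp add: conj_by_add[of _ n] conj_by_smult[of _ n])
    also have "\<dots> = mat_diag n (\<lambda>i. f i + \<i> * g i)"
      unfolding fg by (intro eq_matI) (auto simp: mat_diag_def)
    finally show ?thesis by blast
  qed
  show "polytope (joint_C_range n C As)"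
  proof (rule diagonalizable_joint_range_polytope[OF C _ U(1)])
    show "set As \<subseteq> carrier_mat n n" using As W unfolding W_def by (rule subset_trans)
    show "\<exists>f. conj_by U A = mat_diag n f" if "A \<in> set As" for A
      using diag[of A] that As unfolding W_def by blast
  qed
qed

lemma all_polyhedral_imp_pairwise_k:
  assumes n: "n \<ge> 2" and all: "all_C_ranges_polyhedral n F" and S: "S \<subseteq> cspan n (F \<union> adjoints F)"
  shows "pairwise_k_range_polyhedral n S"
  unfolding pairwise_k_range_polyhedral_def joint_k_range_def block_projection_def[symmetric]
proof (intro exI conjI ballI)
  show k: "central_index n (n div 2)" by (rule central_index_half[OF n])
  fix X Y assume "X \<in> S" "Y \<in> S"
  then have "set [X, Y] \<subseteq> cspan n (F \<union> adjoints F)" using S by auto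
  then show "polytope (joint_C_range n (block_projection n (n div 2)) [X, Y])"
    using all block_projection_gap(1,2)[OF k] unfolding all_C_ranges_polyhedral_def by blast
qed

lemma all_polyhedral_imp_basis_polyhedral:
  assumes n: "n \<ge> 2" and all: "all_C_ranges_polyhedral n F" and Bs: "set Bs \<subseteq> cspan n (F \<union> adjoints F)"
  shows "basis_C_range_polyhedral n Bs"
  unfolding basis_C_range_polyhedral_def
  using all block_projection_gap[OF central_index_half[OF n]] Bs unfolding all_C_ranges_polyhedral_def by blast

text \<open>The notions of span and linear dependence in a subspace are those of the whole matrix space.\<close>

lemma basis_mat_iff:
  assumes W: "submodule class_ring W (mat_space n)"
  shows "vectorspace.basis class_ring ((mat_space n)\<lparr>carrier := W\<rparr>) B \<longleftrightarrow>
    B \<subseteq> W \<and> \<not> LinearCombinations.module.lin_dep class_ring (mat_space n) B \<and> cspan n B = W"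
proof -
  have "VectorSpace.subspace class_ring W (mat_space n)"
    using W mat_space.vectorspace_axioms by (simp add: VectorSpace.subspace_def)
  then interpret W: vectorspace class_ring "(mat_space n)\<lparr>carrier := W\<rparr>"
    by (rule mat_space.subspace_is_vs)
  have "W.basis B \<longleftrightarrow> B \<subseteq> W \<and> \<not> W.lin_dep B \<and> W.span B = W"
    by (auto simp: W.basis_def)
  then show ?thesis using mat_space.span_li_not_depend[OF _ W, of B] by auto
qed

lemma mat_space_fin_dim: "mat_space.fin_dim n"
proof -
  define E where "E = (\<lambda>(i, j). mat n n (\<lambda>(a, b). if a = i \<and> b = j then 1 else 0 :: complex)) ` ({..<n} \<times> {..<n})"
  have Ec: "E \<subseteq> carrier_mat n n" by (auto simp: E_def)
  have fin: "finite E" by (simp add: E_def)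
  have "A \<in> cspan n E" if A: "A \<in> carrier_mat n n" for A
  proof -
    define R where "R S = mat n n (\<lambda>p. if p \<in> S then A $$ p else 0)" for S
    have sub: "X + Y \<in> cspan n E" "a \<cdot>\<^sub>m X \<in> cspan n E" "0\<^sub>m n n \<in> cspan n E"
      if "X \<in> cspan n E" "Y \<in> cspan n E" for X Y a
      using cspan_submodule[OF Ec] that unfolding submodule_mat_iff by blast+
    have "finite S \<Longrightarrow> S \<subseteq> {..<n} \<times> {..<n} \<Longrightarrow> R S \<in> cspan n E" for S
    proof (induction S rule: finite_induct)
      case empty
      have "R {} = 0\<^sub>m n n" by (intro eq_matI) (auto simp: R_def)
      then show ?case using cspan_submodule[OF Ec] unfolding submodule_mat_iff by simp
    next
      case (insert p S)
      obtain i j where p: "p = (i, j)" "i < n" "j < n" using insert.prems by auto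
      define Eij where "Eij = mat n n (\<lambda>(a, b). if a = i \<and> b = j then 1 else 0 :: complex)"
      have "Eij \<in> E" unfolding E_def Eij_def using p by force
      then have "Eij \<in> cspan n E" using subset_cspan[OF Ec] by blast
      moreover have "R (insert p S) = R S + (A $$ p) \<cdot>\<^sub>m Eij"
        using insert.hyps(2) p by (intro eq_matI) (auto simp: R_def Eij_def)
      ultimately show ?case using insert by (auto intro!: sub)
    qed
    from this[of "{..<n} \<times> {..<n}"] have "R ({..<n} \<times> {..<n}) \<in> cspan n E" by simp
    moreover have "R ({..<n} \<times> {..<n}) = A" using A by (intro eq_matI) (auto simp: R_def)
    ultimately show ?thesis by simp
  qed
  then have "cspan n E = carrier_mat n n" using cspan_carrier[OF Ec] by blast
  then show ?thesis unfolding mat_space.fin_dim_def using fin Ec by (auto simp: module_mat_simps)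
qed

text \<open>The Hermitian parts of the elements generate the span, so a maximal independent set of them is a basis.\<close>

theorem hermitian_basis_exists:
  assumes F: "F \<subseteq> carrier_mat n n"
  shows "\<exists>Hs. lists_basis n (cspan n (F \<union> adjoints F)) Hs \<and> (\<forall>H\<in>set Hs. hermitian_mat H)"
proof -
  define W where "W = cspan n (F \<union> adjoints F)"
  have FF: "F \<union> adjoints F \<subseteq> carrier_mat n n" using F adjoints_carrier[OF F] by blast
  have Wsub: "submodule class_ring W (mat_space n)" unfolding W_def by (rule cspan_submodule[OF FF])
  have Wc: "W \<subseteq> carrier_mat n n" unfolding W_def by (rule cspan_carrier[OF FF])
  define G where "G = {hermitian_part s X | s X. X \<in> W}"
  have GW: "G \<subseteq> W" using parts_in_cspan[OF _ F] unfolding G_def W_def by blast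
  have Gc: "G \<subseteq> carrier_mat n n" using GW Wc by blast
  define Q where "Q A \<longleftrightarrow> A \<subseteq> G \<and> \<not> mat_space.lin_dep n A" for A
  have bound: "finite A \<and> card A \<le> mat_space.dim n" if "Q A" for A
    using mat_space.li_le_dim[OF mat_space_fin_dim, of A n] that Gc by (auto simp: Q_def module_mat_simps)
  have "Q {}" by (simp add: Q_def mat_space.lin_dep_def)
  then obtain A where A: "finite A" "maximal A Q"
    using maximal_exists[of Q "mat_space.dim n" "{}"] bound by blast
  have QA: "A \<subseteq> G" "\<not> mat_space.lin_dep n A" using A(2) by (auto simp: maximal_def Q_def)
  have Ac: "A \<subseteq> carrier_mat n n" using QA(1) Gc by blast
  have "G \<subseteq> cspan n A"
  proof
    fix v assume v: "v \<in> G"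
    show "v \<in> cspan n A"
    proof (rule ccontr)
      assume nv: "v \<notin> cspan n A"
      then have "v \<notin> A" using subset_cspan[OF Ac] by blast
      then have "\<not> mat_space.lin_dep n (A \<union> {v})"
        using mat_space.lin_dep_iff_in_span[of A n v] Ac QA(2) v Gc nv by (auto simp: module_mat_simps)
      then have "Q (A \<union> {v})" using QA(1) v by (simp add: Q_def)
      then have "A \<union> {v} = A" using A(2) unfolding maximal_def by blast
      with \<open>v \<notin> A\<close> show False by blast
    qed
  qed
  moreover have "W \<subseteq> cspan n G"
  proof
    fix X assume X: "X \<in> W"
    then have "hermitian_part True X \<in> cspan n G" "hermitian_part False X \<in> cspan n G"
      using subset_cspan[OF Gc] unfolding G_def by blast+
    then have "1 \<cdot>\<^sub>m re_part X + \<i> \<cdot>\<^sub>m im_part X \<in> cspan n G"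
      using cspan_submodule[OF Gc] unfolding submodule_mat_iff hermitian_part_def by simp
    then show "X \<in> cspan n G" using cartesian_decomposition(1)[of X n] X Wc by auto
  qed
  ultimately have "W \<subseteq> cspan n A" using cspan_subset_cspan[of G n A] Ac by blast
  moreover have "cspan n A \<subseteq> W" using cspan_least[OF _ Wsub] QA(1) GW by blast
  ultimately have basis: "vectorspace.basis class_ring ((mat_space n)\<lparr>carrier := W\<rparr>) A"
    unfolding basis_mat_iff[OF Wsub] using QA GW by blast
  obtain Hs where Hs: "set Hs = A" "distinct Hs" using finite_distinct_list[OF A(1)] by blast
  have "lists_basis n W Hs" unfolding lists_basis_def using Hs basis by simp
  moreover have "hermitian_mat H" if H: "H \<in> set Hs" for H
  proof -
    obtain s X where X: "X \<in> W" "H = hermitian_part s X" using H Hs(1) QA(1) unfolding G_def by blast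
    then show ?thesis using hermitian_parts[of X n] Wc by (auto simp: hermitian_part_def)
  qed
  ultimately show ?thesis unfolding W_def by blast
qed

lemma lists_basis_span:
  assumes "S \<subseteq> carrier_mat n n" "lists_basis n (cspan n S) Bs"
  shows "set Bs \<subseteq> cspan n S" "cspan n (set Bs) = cspan n S"
  using assms basis_mat_iff[OF cspan_submodule[OF assms(1)], of "set Bs"] by (auto simp: lists_basis_def)

text \<open>Each of the three spans contains \<open>F\<close> or \<open>F\<^sup>*\<close>, hence so does the span of the basis; a condition that
  is symmetric under adjoints and passes to spans is transferred to \<open>F\<close>.\<close>

lemma basis_star_commuting:
  assumes F: "F \<subseteq> carrier_mat n n"
    and Bs: "lists_basis n (cspan n F) Bs \<or> lists_basis n (cspan n (adjoints F)) Bs \<or>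
      lists_basis n (cspan n (F \<union> adjoints F)) Bs"
  shows "set Bs \<subseteq> cspan n (F \<union> adjoints F)" "star_commuting (set Bs) \<Longrightarrow> star_commuting F"
proof -
  have FF: "F \<union> adjoints F \<subseteq> carrier_mat n n" using F adjoints_carrier[OF F] by blast
  obtain S where S: "S = F \<or> S = adjoints F \<or> S = F \<union> adjoints F" "lists_basis n (cspan n S) Bs"
    using Bs by blast
  have Sc: "S \<subseteq> carrier_mat n n" using S(1) FF by blast
  note span = lists_basis_span[OF Sc S(2)]
  have "S \<subseteq> cspan n (F \<union> adjoints F)" using S(1) subset_cspan[OF FF] by blast
  then have "cspan n S \<subseteq> cspan n (F \<union> adjoints F)" by (rule cspan_subset_cspan[OF _ FF])
  then show Bs_sub: "set Bs \<subseteq> cspan n (F \<union> adjoints F)" using span(1) by blast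
  assume comm: "star_commuting (set Bs)"
  have Bc: "set Bs \<subseteq> carrier_mat n n" using Bs_sub cspan_carrier[OF FF] by blast
  have BBc: "set Bs \<union> adjoints (set Bs) \<subseteq> carrier_mat n n" using Bc adjoints_carrier[OF Bc] by blast
  have "S \<subseteq> cspan n (set Bs)" using span(2) subset_cspan[OF Sc] by simp
  also have "\<dots> \<subseteq> cspan n (set Bs \<union> adjoints (set Bs))"
    by (rule cspan_subset_cspan[OF _ BBc]) (use subset_cspan[OF BBc] in blast)
  finally have "star_commuting S" using star_commuting_mono[OF star_commuting_cspan[OF Bc comm]] by blast
  then show "star_commuting F" using S(1) by auto
qed

theorem theorem3p4:
  fixes n :: nat and F :: "complex mat set" and Bs :: "complex mat list"
  assumes "n \<ge> 2"
    and "F \<subseteq> carrier_mat n n" and "F \<noteq> {}"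
    and "lists_basis n (cspan n F) Bs \<or> lists_basis n (cspan n (adjoints F)) Bs \<or>
      lists_basis n (cspan n (F \<union> adjoints F)) Bs"
  shows "(\<forall>T\<in>{F, F \<union> adjoints F, set Bs}.
            commuting_normal T \<longleftrightarrow> all_C_ranges_polyhedral n F)
       \<and> (\<forall>S\<in>{F, adjoints F, F \<union> adjoints F, set Bs}.
            pairwise_C_range_polyhedral n S \<longleftrightarrow> all_C_ranges_polyhedral n F)
       \<and> (\<forall>S\<in>{F, adjoints F, F \<union> adjoints F, set Bs}.
            pairwise_k_range_polyhedral n S \<longleftrightarrow> all_C_ranges_polyhedral n F)
       \<and> (basis_C_range_polyhedral n Bs \<longleftrightarrow> all_C_ranges_polyhedral n F)
       \<and> (\<exists>Hs. lists_basis n (cspan n (F \<union> adjoints F)) Hs \<and> (\<forall>H\<in>set Hs. hermitian_mat H))"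
proof -
  have F: "F \<subseteq> carrier_mat n n" by fact
  have FF: "F \<union> adjoints F \<subseteq> carrier_mat n n" using F adjoints_carrier[OF F] by blast
  note basis = basis_star_commuting[OF F assms(4)]
  let ?fam = "{F, adjoints F, F \<union> adjoints F, set Bs}"
  have sub: "S \<subseteq> cspan n (F \<union> adjoints F)" if "S \<in> ?fam" for S
    using that subset_cspan[OF FF] basis(1) by auto
  have carr: "S \<subseteq> carrier_mat n n" if "S \<in> ?fam" for S
    using sub[OF that] cspan_carrier[OF FF] by blast
  have star: "star_commuting F" if "S \<in> ?fam" "star_commuting S" for S
    using that basis(2) by auto
  have k: "pairwise_k_range_polyhedral n S" if "all_C_ranges_polyhedral n F" "S \<in> ?fam" for S
    using all_polyhedral_imp_pairwise_k[OF assms(1) that(1) sub[OF that(2)]] .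
  have C: "pairwise_C_range_polyhedral n S" if "all_C_ranges_polyhedral n F" "S \<in> ?fam" for S
    using k[OF that] by (rule pairwise_k_imp_pairwise_C)
  have C_star: "star_commuting S" if "pairwise_C_range_polyhedral n S" "S \<in> ?fam" for S
    by (rule pairwise_C_range_imp_star_commuting[OF carr[OF that(2)] that(1)])
  have all: "all_C_ranges_polyhedral n F" if "S \<in> ?fam" "star_commuting S" for S
    by (rule star_commuting_imp_all_polyhedral[OF F star[OF that]])
  have iff_normal: "commuting_normal T \<longleftrightarrow> all_C_ranges_polyhedral n F" if "T \<in> ?fam" for T
    using all[OF that commuting_normal_imp_star_commuting[OF carr[OF that]]]
      star_commuting_imp_commuting_normal[OF C_star[OF C[OF _ that] that]] by blast
  have iff_C: "pairwise_C_range_polyhedral n S \<longleftrightarrow> all_C_ranges_polyhedral n F" if "S \<in> ?fam" for S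
    using all[OF that C_star[OF _ that]] C[OF _ that] by blast
  have iff_k: "pairwise_k_range_polyhedral n S \<longleftrightarrow> all_C_ranges_polyhedral n F" if "S \<in> ?fam" for S
    using iff_C[OF that] k[OF _ that] pairwise_k_imp_pairwise_C by blast
  have "set Bs \<in> ?fam" by simp
  then have iff_basis: "basis_C_range_polyhedral n Bs \<longleftrightarrow> all_C_ranges_polyhedral n F"
    using all[of "set Bs"] basis_C_range_imp_star_commuting[OF carr[of "set Bs"]]
      all_polyhedral_imp_basis_polyhedral[OF assms(1) _ basis(1)] by blast
  show ?thesis
    using iff_normal iff_C iff_k iff_basis hermitian_basis_exists[OF F] by blast
qed

end
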